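(* Let $(X_i)_{i\in I}$ be a family of $H^1$-projective Banach spaces such that $$\eta=\sup\{\eta(X_i):i\in I\}<+\infty .$$ Then for every ultrafilter $\mathcal{U}$ on $I$ the ultraproduct $(\prod X_i)/\mathcal{U}$ is $H^1$-projective.
   Context: All Banach spaces are complex. Let $\mathbb{T}$ be the unit circle with normalized Haar measure $dm$. For a Banach space $X$, $\widetilde H^1(X)$ is the closure in the Bochner space $L^1(\mathbb{T};X)$ of the set of $X$-valued analytic polynomials $\sum_{k=0}^n z^k x_k$ ($n\in\mathbb{N}$, $x_k\in X$), with the $L^1(\mathbb{T};X)$-norm; $H^1=\widetilde H^1(\mathbb{C})$ is the scalar Hardy space. $\hat\otimes$ denotes the (completed) projective tensor product. There is a canonical norm-one inclusion map $H^1\hat\otimes X\hookrightarrow\widetilde H^1(X)$ sending $h\otimes x$ to $h(\cdot)x$. $X$ is called $H^1$-projective if this map is surjective; equivalently, if there is a constant $c$ such that $\|F\|_{H^1\hat\otimes X}\le c\,\|F\|_{\widetilde H^1(X)}$ for all $F\in H^1\hat\otimes X$. The smallest such $c$ is denoted $\eta(X)$. For a family $(E_i)_{i\in I}$ of Banach spaces, $\ell^\infty(I,(E_i)_{i\in I})$ is the Banach space of families $(x_i)_{i\in I}$, $x_i\in E_i$, with $\sup_i\|x_i\|_{E_i}<\infty$, with the sup norm. For an ultrafilter $\mathcal{U}$ on $I$, the ultraproduct $(\prod E_i)/\mathcal{U}$ is the quotient $\ell^\infty(I,(E_i)_{i\in I})/N_{\mathcal{U}}$ with the quotient norm, where $N_{\mathcal{U}}$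 is the closed subspace of families with $\lim_{\mathcal{U}}\|x_i\|_{E_i}=0$. *)

theory Defs
  imports "HOL-Analysis.Analysis" "HOL-Algebra.Module" "HOL-Algebra.AbelCoset"
begin

section \<open>Normed spaces with explicit carriers\<close>

text \<open>
  The members of a family of Banach spaces need not share a type-class structure, and ultraproducts
  are quotients. Normed spaces are therefore represented by HOL-Algebra module records over the
  field of complex numbers, extended by a norm. The fields \<open>mult\<close> and \<open>one\<close> that a module record
  inherits from the ring record carry no meaning and are left undefined.
\<close>

definition complex_ring :: "complex ring" where
  "complex_ring = \<lparr>carrier = UNIV, mult = (*), one = 1, zero = 0, add = (+)\<rparr>"

record 'a nspace = "(complex, 'a) module" +
  vnorm :: "'a \<Rightarrow> real"

abbreviation mk_nspace ::
    "'a set \<Rightarrow> 'a \<Rightarrow> ('a \<Rightarrow> 'a \<Rightarrow> 'a) \<Rightarrow> (complex \<Rightarrow> 'a \<Rightarrow> 'a) \<Rightarrow> ('a \<Rightarrow> real) \<Rightarrow> 'a nspace" where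
  "mk_nspace V z p s n \<equiv>
     \<lparr>carrier = V, mult = undefined, one = undefined, zero = z, add = p, smult = s, vnorm = n\<rparr>"

locale complex_normed_space = Module.module complex_ring X for X :: "'a nspace" (structure) +
  assumes vnorm_nonneg: "x \<in> carrier X \<Longrightarrow> 0 \<le> vnorm X x"
    and vnorm_eq_0_iff: "x \<in> carrier X \<Longrightarrow> vnorm X x = 0 \<longleftrightarrow> x = \<zero>"
    and vnorm_triangle:
      "x \<in> carrier X \<Longrightarrow> y \<in> carrier X \<Longrightarrow> vnorm X (x \<oplus> y) \<le> vnorm X x + vnorm X y"
    and vnorm_smult: "x \<in> carrier X \<Longrightarrow> vnorm X (c \<odot> x) = cmod c * vnorm X x"

text \<open>The locale \<open>Metric_space\<close> requires symmetry and nonnegativity off the carrier as well.\<close>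

definition vdist :: "'a nspace \<Rightarrow> 'a \<Rightarrow> 'a \<Rightarrow> real" where
  "vdist X x y = (if x \<in> carrier X \<and> y \<in> carrier X then vnorm X (x \<ominus>\<^bsub>X\<^esub> y) else 0)"

definition norm_topology :: "'a nspace \<Rightarrow> 'a topology" where
  "norm_topology X = Metric_space.mtopology (carrier X) (vdist X)"

locale complex_banach_space = complex_normed_space +
  assumes complete: "Metric_space.mcomplete (carrier X) (vdist X)"

definition complex_space :: "complex nspace" where
  "complex_space = mk_nspace UNIV 0 (+) (*) cmod"


section \<open>Quotients, completions and ultraproducts\<close>

text \<open>
  \<open>V\<close> may be a seminormed space. In \<open>smult\<close> the summand \<open>N\<close> only matters for the scalar \<open>0\<close>.
\<close>

definition quotient_space :: "'a nspace \<Rightarrow> 'a set \<Rightarrow> 'a set nspace" where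
  "quotient_space V N =
     mk_nspace (a_rcosets\<^bsub>V\<^esub> N) N (\<lambda>A B. A <+>\<^bsub>V\<^esub> B)
       (\<lambda>c A. N <+>\<^bsub>V\<^esub> ((\<lambda>a. c \<odot>\<^bsub>V\<^esub> a) ` A)) (\<lambda>A. INF a\<in>A. vnorm V a)"

text \<open>The completion consists of the Cauchy sequences modulo the null sequences.\<close>

definition cauchy_sequences :: "'a nspace \<Rightarrow> (nat \<Rightarrow> 'a) nspace" where
  "cauchy_sequences V =
     mk_nspace
       {u. range u \<subseteq> carrier V \<and>
           (\<forall>e>0. \<exists>N. \<forall>m\<ge>N. \<forall>n\<ge>N. vnorm V (u m \<ominus>\<^bsub>V\<^esub> u n) < e)}
       (\<lambda>n. \<zero>\<^bsub>V\<^esub>) (\<lambda>u v n. u n \<oplus>\<^bsub>V\<^esub> v n) (\<lambda>c u n. c \<odot>\<^bsub>V\<^esub> u n)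
       (\<lambda>u. lim (\<lambda>n. vnorm V (u n)))"

definition completion :: "'a nspace \<Rightarrow> (nat \<Rightarrow> 'a) set nspace" where
  "completion V =
     quotient_space (cauchy_sequences V)
       {u \<in> carrier (cauchy_sequences V). (\<lambda>n. vnorm V (u n)) \<longlonglongrightarrow> 0}"

definition ultrafilter :: "'i filter \<Rightarrow> bool" where
  "ultrafilter U \<longleftrightarrow> U \<noteq> bot \<and> (\<forall>P. eventually P U \<or> eventually (\<lambda>i. \<not> P i) U)"

definition linf_space :: "('i \<Rightarrow> 'a nspace) \<Rightarrow> ('i \<Rightarrow> 'a) nspace" where
  "linf_space E =
     mk_nspace
       {x. (\<forall>i. x i \<in> carrier (E i)) \<and> bdd_above (range (\<lambda>i. vnorm (E i) (x i)))}
       (\<lambda>i. \<zero>\<^bsub>E i\<^esub>) (\<lambda>x y i. x i \<oplus>\<^bsub>E i\<^esub> y i) (\<lambda>c x i. c \<odot>\<^bsub>E i\<^esub> x i)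
       (\<lambda>x. SUP i. vnorm (E i) (x i))"

definition ultraproduct :: "'i filter \<Rightarrow> ('i \<Rightarrow> 'a nspace) \<Rightarrow> ('i \<Rightarrow> 'a) set nspace" where
  "ultraproduct U E =
     quotient_space (linf_space E)
       {x \<in> carrier (linf_space E). ((\<lambda>i. vnorm (E i) (x i)) \<longlongrightarrow> 0) U}"


section \<open>The projective tensor product\<close>

text \<open>
  The vector space with basis \<open>carrier A \<times> carrier B\<close>; the basis vector belonging to \<open>p\<close> is
  \<open>indicator {p}\<close>. It carries the weighted \<open>\<ell>\<^sup>1\<close> seminorm, so that the quotient seminorm
  on the algebraic tensor product is the infimum of \<open>\<Sum>\<^sub>k |c\<^sub>k| \<parallel>a\<^sub>k\<parallel> \<parallel>b\<^sub>k\<parallel>\<close> over all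
  representations \<open>\<Sum>\<^sub>k c\<^sub>k (a\<^sub>k \<otimes> b\<^sub>k)\<close> of a tensor, that is, the projective norm.
\<close>

definition free_space :: "'a nspace \<Rightarrow> 'b nspace \<Rightarrow> ('a \<times> 'b \<Rightarrow> complex) nspace" where
  "free_space A B =
     mk_nspace {c. finite {p. c p \<noteq> 0} \<and> {p. c p \<noteq> 0} \<subseteq> carrier A \<times> carrier B}
       (\<lambda>p. 0) (\<lambda>c d p. c p + d p) (\<lambda>s c p. s * c p)
       (\<lambda>c. \<Sum>p | c p \<noteq> 0. cmod (c p) * vnorm A (fst p) * vnorm B (snd p))"

definition bilinear_relations :: "'a nspace \<Rightarrow> 'b nspace \<Rightarrow> ('a \<times> 'b \<Rightarrow> complex) set" where
  "bilinear_relations A B =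
     {\<lambda>p. indicator {(a \<oplus>\<^bsub>A\<^esub> a', b)} p - indicator {(a, b)} p - indicator {(a', b)} p | a a' b.
        a \<in> carrier A \<and> a' \<in> carrier A \<and> b \<in> carrier B} \<union>
     {\<lambda>p. indicator {(a, b \<oplus>\<^bsub>B\<^esub> b')} p - indicator {(a, b)} p - indicator {(a, b')} p | a b b'.
        a \<in> carrier A \<and> b \<in> carrier B \<and> b' \<in> carrier B} \<union>
     {\<lambda>p. indicator {(s \<odot>\<^bsub>A\<^esub> a, b)} p - s * indicator {(a, b)} p | s a b.
        a \<in> carrier A \<and> b \<in> carrier B} \<union>
     {\<lambda>p. indicator {(a, s \<odot>\<^bsub>B\<^esub> b)} p - s * indicator {(a, b)} p | s a b.
        a \<in> carrier A \<and> b \<in> carrier B}"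

definition tensor_product :: "'a nspace \<Rightarrow> 'b nspace \<Rightarrow> ('a \<times> 'b \<Rightarrow> complex) set nspace" where
  "tensor_product A B =
     quotient_space (free_space A B)
       (\<Inter>{N. submodule N complex_ring (free_space A B) \<and> bilinear_relations A B \<subseteq> N})"

definition projective_tensor ::
    "'a nspace \<Rightarrow> 'b nspace \<Rightarrow> (nat \<Rightarrow> ('a \<times> 'b \<Rightarrow> complex) set) set nspace" where
  "projective_tensor A B = completion (tensor_product A B)"


section \<open>The Bochner space of integrable functions\<close>

definition strongly_measurable :: "'m measure \<Rightarrow> 'a nspace \<Rightarrow> ('m \<Rightarrow> 'a) \<Rightarrow> bool" where
  "strongly_measurable M X f \<longleftrightarrow>
     (\<exists>s. (\<forall>n. simple_function M (s n) \<and> s n ` space M \<subseteq> carrier X) \<and>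
          (\<forall>z\<in>space M. (\<lambda>n. vnorm X (s n z \<ominus>\<^bsub>X\<^esub> f z)) \<longlonglongrightarrow> 0))"

text \<open>
  Functions are total with values in \<open>carrier X\<close>; their values outside \<open>space M\<close> are irrelevant, as
  they are not seen by the almost-everywhere quantifier in \<open>L1_null\<close>.
\<close>

definition L1_functions :: "'m measure \<Rightarrow> 'a nspace \<Rightarrow> ('m \<Rightarrow> 'a) nspace" where
  "L1_functions M X =
     mk_nspace
       {f. (\<forall>z. f z \<in> carrier X) \<and> strongly_measurable M X f \<and> integrable M (\<lambda>z. vnorm X (f z))}
       (\<lambda>z. \<zero>\<^bsub>X\<^esub>) (\<lambda>f g z. f z \<oplus>\<^bsub>X\<^esub> g z) (\<lambda>c f z. c \<odot>\<^bsub>X\<^esub> f z)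
       (\<lambda>f. \<integral>z. vnorm X (f z) \<partial>M)"

definition L1_null :: "'m measure \<Rightarrow> 'a nspace \<Rightarrow> ('m \<Rightarrow> 'a) set" where
  "L1_null M X = {f \<in> carrier (L1_functions M X). AE z in M. f z = \<zero>\<^bsub>X\<^esub>}"

definition L1_space :: "'m measure \<Rightarrow> 'a nspace \<Rightarrow> ('m \<Rightarrow> 'a) set nspace" where
  "L1_space M X = quotient_space (L1_functions M X) (L1_null M X)"

definition L1_class :: "'m measure \<Rightarrow> 'a nspace \<Rightarrow> ('m \<Rightarrow> 'a) \<Rightarrow> ('m \<Rightarrow> 'a) set" where
  "L1_class M X f = L1_null M X +>\<^bsub>L1_functions M X\<^esub> f"


section \<open>Vector-valued Hardy spaces\<close>

definition circle_measure :: "complex measure" where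
  "circle_measure =
     distr (uniform_measure lborel {0..2 * pi}) (restrict_space borel (sphere 0 1)) cis"

definition analytic_polynomial :: "'a nspace \<Rightarrow> nat \<Rightarrow> (nat \<Rightarrow> 'a) \<Rightarrow> complex \<Rightarrow> 'a" where
  "analytic_polynomial X n x z = (\<Oplus>\<^bsub>X\<^esub>k\<in>{..n}. (z ^ k) \<odot>\<^bsub>X\<^esub> x k)"

definition hardy_space :: "'a nspace \<Rightarrow> (complex \<Rightarrow> 'a) set nspace" where
  "hardy_space X =
     (L1_space circle_measure X)
       \<lparr>carrier := norm_topology (L1_space circle_measure X) closure_of
          {L1_class circle_measure X (analytic_polynomial X n x) | n x. \<forall>k\<le>n. x k \<in> carrier X}\<rparr>"

abbreviation scalar_hardy_space :: "(complex \<Rightarrow> complex) set nspace" where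
  "scalar_hardy_space \<equiv> hardy_space complex_space"

abbreviation hardy_tensor where
  "hardy_tensor X \<equiv> projective_tensor scalar_hardy_space X"


section \<open>The canonical inclusion and projectivity\<close>

text \<open>
  The class of \<open>\<lambda>z. f z \<odot> x\<close> does not depend on the representative \<open>f\<close> of \<open>h\<close>, so the union is
  over a single set; likewise for the union over the representatives of a tensor below.
\<close>

definition hardy_mult ::
    "'a nspace \<Rightarrow> (complex \<Rightarrow> complex) set \<Rightarrow> 'a \<Rightarrow> (complex \<Rightarrow> 'a) set" where
  "hardy_mult X h x = (\<Union>f\<in>h. L1_class circle_measure X (\<lambda>z. f z \<odot>\<^bsub>X\<^esub> x))"

text \<open>The linearization of \<open>h \<otimes> x \<mapsto> h(\<sqdot>)x\<close> on the algebraic tensor product.\<close>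

definition tensor_inclusion ::
    "'a nspace \<Rightarrow> ((complex \<Rightarrow> complex) set \<times> 'a \<Rightarrow> complex) set \<Rightarrow> (complex \<Rightarrow> 'a) set" where
  "tensor_inclusion X t =
     (\<Union>c\<in>t. \<Oplus>\<^bsub>hardy_space X\<^esub>p\<in>{p. c p \<noteq> 0}.
        c p \<odot>\<^bsub>hardy_space X\<^esub> hardy_mult X (fst p) (snd p))"

text \<open>Its extension to the completion by continuity.\<close>

definition hardy_inclusion ::
    "'a nspace \<Rightarrow> (nat \<Rightarrow> ((complex \<Rightarrow> complex) set \<times> 'a \<Rightarrow> complex) set) set
       \<Rightarrow> (complex \<Rightarrow> 'a) set" where
  "hardy_inclusion X \<xi> =
     (THE F. \<forall>u\<in>\<xi>. limitin (norm_topology (hardy_space X)) (\<lambda>n. tensor_inclusion X (u n)) F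
        sequentially)"

definition H1_projective :: "'a nspace \<Rightarrow> bool" where
  "H1_projective X \<longleftrightarrow>
     complex_banach_space X \<and>
     hardy_inclusion X ` carrier (hardy_tensor X) = carrier (hardy_space X)"

text \<open>The value is \<open>\<infinity>\<close> if no finite constant exists.\<close>

definition H1_constant :: "'a nspace \<Rightarrow> ennreal" where
  "H1_constant X =
     Inf {c. \<forall>\<xi>\<in>carrier (hardy_tensor X).
            ennreal (vnorm (hardy_tensor X) \<xi>)
              \<le> c * ennreal (vnorm (hardy_space X) (hardy_inclusion X \<xi>))}"


section \<open>Basic facts\<close>

lemma cring_complex_ring: "cring complex_ring"
proof -
  have "\<exists>y. x + y = 0" for x :: complex
    by (rule exI[of _ "- x"]) simp
  then show ?thesis
    by (intro cringI abelian_groupI comm_monoidI)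
       (auto simp: complex_ring_def algebra_simps intro: add.commute)
qed

lemma emeasure_circle_measure: "emeasure circle_measure (sphere 0 1) = 1"
proof -
  let ?M = "uniform_measure lborel {0..2 * pi}"
  have meas: "cis \<in> ?M \<rightarrow>\<^sub>M restrict_space borel (sphere 0 1)"
  proof (rule measurable_restrict_space2)
    have "continuous_on UNIV cis"
      unfolding cis_conv_exp by (intro continuous_intros)
    then show "cis \<in> ?M \<rightarrow>\<^sub>M borel"
      using borel_measurable_continuous_onI[of cis] by (simp add: measurable_def)
  qed simp
  have "emeasure circle_measure (sphere 0 1) = emeasure ?M (cis -` sphere 0 1 \<inter> space ?M)"
    unfolding circle_measure_def
    by (rule emeasure_distr[OF meas]) (auto simp: sets_restrict_space intro!: image_eqI[of _ _ UNIV])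
  also have "cis -` sphere 0 1 \<inter> space ?M = UNIV"
    by auto
  also have "emeasure ?M UNIV = 1"
    by (simp add: ennreal_divide_self)
  finally show ?thesis .
qed

lemma complex_banach_space_complex: "complex_banach_space complex_space"
proof -
  have inv: "\<exists>y. x + y = 0" for x :: complex
    by (rule exI[of _ "- x"]) simp
  have ag: "abelian_group complex_space"
    by (rule abelian_groupI) (use inv in \<open>auto simp: complex_space_def algebra_simps\<close>)
  interpret abelian_group complex_space by (fact ag)
  have "Module.module complex_ring complex_space"
    by (rule moduleI[OF cring_complex_ring ag])
       (auto simp: complex_ring_def complex_space_def algebra_simps)
  then have ns: "complex_normed_space complex_space"
    by (intro complex_normed_space.intro complex_normed_space_axioms.intro)
       (auto simp: complex_space_def norm_triangle_ineq norm_mult)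
  have neg: "\<ominus>\<^bsub>complex_space\<^esub> y = - y" for y
    by (rule minus_equality) (auto simp: complex_space_def)
  have "vdist complex_space = dist"
    by (intro ext) (simp add: vdist_def a_minus_def neg, simp add: complex_space_def dist_norm)
  then have "Metric_space.mcomplete (carrier complex_space) (vdist complex_space)"
    by (simp add: complex_space_def mcomplete_iff_complete complete_UNIV)
  with ns show ?thesis
    by (intro complex_banach_space.intro complex_banach_space_axioms.intro)
qed

end

theory Submission
  imports Defs
begin

text \<open>
  Write \<open>\<parallel>P\<parallel>\<close> for the \<open>L\<^sup>1\<close> norm of an analytic polynomial \<open>P = \<Sum>\<^sub>k z\<^sup>k x\<^sub>k\<close> with coefficients in a Banach
  space \<open>X\<close>. Projectivity is a statement about polynomials. On the one hand, \<open>X\<close> is projective as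
  soon as, for some \<open>C\<close>, every \<open>P\<close> has for each \<open>e > 0\<close> a preimage of norm at most \<open>C \<parallel>P\<parallel> + e\<close> in
  the algebraic tensor product, because a rapidly converging series of polynomials can be lifted
  term by term (\<open>H1_projectiveI\<close>). On the other hand, if the constant of \<open>X\<close> is less than \<open>c\<close>, then
  the tensor \<open>\<Sum>\<^sub>k z\<^sup>k \<otimes> x\<^sub>k\<close> has norm at most \<open>c \<parallel>P\<parallel>\<close> (\<open>H1_constant_norm_le\<close>), so it has
  representations \<open>\<Sum>\<^sub>j h\<^sub>j \<otimes> y\<^sub>j\<close> with \<open>\<Sum>\<^sub>j \<parallel>h\<^sub>j\<parallel> \<parallel>y\<^sub>j\<parallel> < c \<parallel>P\<parallel> + e\<close>.

  Such representations do not pass to an ultraproduct directly, because the number of their terms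
  may be unbounded over the family. Fejer means repair this. The mean of order \<open>N\<close> is a contraction
  of the scalar Hardy space into the polynomials of degree at most \<open>N\<close> (\<open>fejer_bound\<close>), and for
  large \<open>N\<close> it changes a polynomial of fixed degree \<open>n\<close> with bounded coefficients very little. The
  scalar polynomials of degree at most \<open>N\<close> and norm at most \<open>1\<close> have a finite \<open>\<delta>\<close>-net \<open>G\<close>. Replacing
  the mean of each \<open>h\<^sub>j\<close> by a multiple of an element of \<open>G\<close> and collecting terms gives vectors
  \<open>y\<^sub>g\<close>, \<open>g \<in> G\<close>, with \<open>\<Sum>\<^sub>g \<parallel>y\<^sub>g\<parallel> \<le> c \<parallel>P\<parallel> + e\<close> and small remainders \<open>r\<^sub>k = x\<^sub>k - \<Sum>\<^sub>g g\<^sub>k y\<^sub>g\<close>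
  (\<open>approximate_factorization\<close>). Here \<open>N\<close> and \<open>G\<close> do not depend on the space.

  Given a polynomial \<open>P\<close> over the ultraproduct, choose representing polynomials \<open>P\<^sub>i\<close> and factorize
  each of them in this way. As \<open>G\<close> is finite, the vectors \<open>y\<^sub>g\<close> and \<open>r\<^sub>k\<close> of the individual spaces
  define elements of the ultraproduct that satisfy the same relations and the limits of the
  bounds. The \<open>P\<^sub>i\<close> are equi-Lipschitz on the circle, so \<open>\<parallel>P\<^sub>i\<parallel> \<le> \<parallel>P\<parallel> + e\<close> holds eventually
  (\<open>eventually_polynomial_norm_le\<close>). Hence \<open>\<Sum>\<^sub>g g \<otimes> y\<^sub>g + \<Sum>\<^sub>k z\<^sup>k \<otimes> r\<^sub>k\<close> is a preimage of \<open>P\<close> of norm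
  at most \<open>c \<parallel>P\<parallel> + e'\<close>, with \<open>e'\<close> arbitrarily small, and the criterion applies with \<open>C = c\<close>.
\<close>

section \<open>Seminormed modules and linear maps\<close>

abbreviation H1 where "H1 \<equiv> scalar_hardy_space"

text \<open>The integrable functions on the circle, the normed space of their classes, and the class map.\<close>

abbreviation L1F where "L1F \<equiv> L1_functions circle_measure"
abbreviation L1T where "L1T \<equiv> L1_space circle_measure"
abbreviation L1cl where "L1cl \<equiv> L1_class circle_measure"


lemma complex_ring_simps [simp]:
  "carrier complex_ring = UNIV" "\<one>\<^bsub>complex_ring\<^esub> = 1" "\<zero>\<^bsub>complex_ring\<^esub> = 0"
  "s \<otimes>\<^bsub>complex_ring\<^esub> t = s * t" "s \<oplus>\<^bsub>complex_ring\<^esub> t = s + t"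
  by (auto simp: complex_ring_def)

lemma complex_ring_uminus [simp]: "\<ominus>\<^bsub>complex_ring\<^esub> s = - s"
proof -
  interpret cring complex_ring by (rule cring_complex_ring)
  show ?thesis by (rule minus_equality) auto
qed

text \<open>
  Spaces of functions and of formal sums carry seminorms that need not be norms; the spaces of
  interest are quotients of them.
\<close>

locale seminormed_module = Module.module complex_ring V for V :: "'a nspace" (structure) +
  assumes norm_nonneg: "x \<in> carrier V \<Longrightarrow> 0 \<le> vnorm V x"
    and norm_triangle:
      "x \<in> carrier V \<Longrightarrow> y \<in> carrier V \<Longrightarrow> vnorm V (x \<oplus> y) \<le> vnorm V x + vnorm V y"
    and norm_smult: "x \<in> carrier V \<Longrightarrow> vnorm V (c \<odot> x) = cmod c * vnorm V x"

sublocale complex_normed_space \<subseteq> seminormed_module X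
  by unfold_locales (fact vnorm_nonneg vnorm_triangle vnorm_smult)+

context seminormed_module
begin

lemma smult_carrier [simp, intro]: "x \<in> carrier V \<Longrightarrow> c \<odot> x \<in> carrier V"
  by (rule smult_closed) auto

lemma smult_add: "x \<in> carrier V \<Longrightarrow> y \<in> carrier V \<Longrightarrow> c \<odot> (x \<oplus> y) = c \<odot> x \<oplus> c \<odot> y"
  by (rule smult_r_distr) auto

lemma add_smult: "x \<in> carrier V \<Longrightarrow> (c + d) \<odot> x = c \<odot> x \<oplus> d \<odot> x"
  using smult_l_distr[of c d x] by simp

lemma smult_smult: "x \<in> carrier V \<Longrightarrow> c \<odot> (d \<odot> x) = (c * d) \<odot> x"
  using smult_assoc1[of c d x] by simp

lemma one_smult [simp]: "x \<in> carrier V \<Longrightarrow> 1 \<odot> x = x"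
  using smult_one[of x] by simp

lemma zero_smult [simp]: "x \<in> carrier V \<Longrightarrow> 0 \<odot> x = \<zero>"
  using smult_l_null[of x] by simp

lemma smult_zero [simp]: "c \<odot> \<zero> = \<zero>"
  using smult_r_null[of c] by simp

lemma minus_smult: "x \<in> carrier V \<Longrightarrow> (- c) \<odot> x = \<ominus> (c \<odot> x)"
  using smult_l_minus[of c x] by simp

lemma smult_diff: "x \<in> carrier V \<Longrightarrow> y \<in> carrier V \<Longrightarrow> c \<odot> (x \<ominus> y) = c \<odot> x \<ominus> c \<odot> y"
  using smult_r_minus[of c y] by (simp add: a_minus_def smult_add)

lemma diff_smult: "x \<in> carrier V \<Longrightarrow> (c - d) \<odot> x = c \<odot> x \<ominus> d \<odot> x"
  using add_smult[of x c "- d"] by (simp add: a_minus_def minus_smult)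

lemma norm_zero [simp]: "vnorm V \<zero> = 0"
  using norm_smult[of \<zero> 0] by simp

lemma norm_uminus [simp]: "x \<in> carrier V \<Longrightarrow> vnorm V (\<ominus> x) = vnorm V x"
  using norm_smult[of x "- 1"] minus_smult[of x 1] by simp

lemma diff_self [simp]: "x \<in> carrier V \<Longrightarrow> x \<ominus> x = \<zero>"
  by (simp add: a_minus_def r_neg)

lemma diff_zero [simp]: "x \<in> carrier V \<Longrightarrow> x \<ominus> \<zero> = x"
  by (simp add: a_minus_def)

lemma diff_add_cancel: "x \<in> carrier V \<Longrightarrow> y \<in> carrier V \<Longrightarrow> (x \<ominus> y) \<oplus> y = x"
  by (simp add: a_minus_def a_assoc l_neg)

lemma add_diff_cancel: "x \<in> carrier V \<Longrightarrow> y \<in> carrier V \<Longrightarrow> (x \<oplus> y) \<ominus> y = x"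
  by (simp add: a_minus_def a_assoc r_neg)

lemma add_diff_cancel_left: "x \<in> carrier V \<Longrightarrow> y \<in> carrier V \<Longrightarrow> (y \<oplus> x) \<ominus> y = x"
  using add_diff_cancel[of x y] by (simp add: a_comm)

lemma uminus_diff: "x \<in> carrier V \<Longrightarrow> y \<in> carrier V \<Longrightarrow> \<ominus> (x \<ominus> y) = y \<ominus> x"
  by (simp add: a_minus_def minus_add a_comm)

lemma diff_add_diff:
  "x \<in> carrier V \<Longrightarrow> y \<in> carrier V \<Longrightarrow> z \<in> carrier V \<Longrightarrow> (x \<ominus> y) \<oplus> (y \<ominus> z) = x \<ominus> z"
  by (simp add: a_minus_def a_assoc r_neg1)

lemma add_diff_add:
  "\<lbrakk>a \<in> carrier V; b \<in> carrier V; c \<in> carrier V; d \<in> carrier V\<rbrakk>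
   \<Longrightarrow> (a \<oplus> b) \<ominus> (c \<oplus> d) = (a \<ominus> c) \<oplus> (b \<ominus> d)"
  by (simp add: a_minus_def minus_add a_ac)

lemma norm_diff_commute:
  "x \<in> carrier V \<Longrightarrow> y \<in> carrier V \<Longrightarrow> vnorm V (x \<ominus> y) = vnorm V (y \<ominus> x)"
  using norm_uminus[of "x \<ominus> y"] by (simp add: uminus_diff)

lemma norm_diff_triangle:
  "x \<in> carrier V \<Longrightarrow> y \<in> carrier V \<Longrightarrow> z \<in> carrier V \<Longrightarrow>
   vnorm V (x \<ominus> z) \<le> vnorm V (x \<ominus> y) + vnorm V (y \<ominus> z)"
  using norm_triangle[of "x \<ominus> y" "y \<ominus> z"] by (simp add: diff_add_diff)

lemma norm_diff_le: "x \<in> carrier V \<Longrightarrow> y \<in> carrier V \<Longrightarrow> vnorm V (x \<ominus> y) \<le> vnorm V x + vnorm V y"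
  using norm_triangle[of x "\<ominus> y"] by (simp add: a_minus_def)

lemma norm_le_add_diff:
  "x \<in> carrier V \<Longrightarrow> y \<in> carrier V \<Longrightarrow> vnorm V x \<le> vnorm V y + vnorm V (x \<ominus> y)"
  using norm_triangle[of "x \<ominus> y" y] by (simp add: diff_add_cancel)

lemma abs_norm_diff_le:
  "x \<in> carrier V \<Longrightarrow> y \<in> carrier V \<Longrightarrow> \<bar>vnorm V x - vnorm V y\<bar> \<le> vnorm V (x \<ominus> y)"
  using norm_le_add_diff[of x y] norm_le_add_diff[of y x] norm_diff_commute[of x y] by simp

lemma norm_add_diff_add:
  "\<lbrakk>a \<in> carrier V; b \<in> carrier V; c \<in> carrier V; d \<in> carrier V\<rbrakk>
   \<Longrightarrow> vnorm V ((a \<oplus> b) \<ominus> (c \<oplus> d)) \<le> vnorm V (a \<ominus> c) + vnorm V (b \<ominus> d)"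
  using norm_triangle[of "a \<ominus> c" "b \<ominus> d"] by (simp add: add_diff_add)

lemma norm_smult_diff:
  "a \<in> carrier V \<Longrightarrow> b \<in> carrier V \<Longrightarrow> vnorm V (s \<odot> a \<ominus> s \<odot> b) = cmod s * vnorm V (a \<ominus> b)"
  using norm_smult[of "a \<ominus> b" s] by (simp add: smult_diff)

lemma norm_finsum_le:
  assumes "finite S" "\<And>p. p \<in> S \<Longrightarrow> g p \<in> carrier V"
  shows "vnorm V (\<Oplus>p\<in>S. g p) \<le> (\<Sum>p\<in>S. vnorm V (g p))"
  using assms
proof (induction S)
  case (insert p S)
  have "vnorm V (\<Oplus>p\<in>insert p S. g p) \<le> vnorm V (g p) + vnorm V (\<Oplus>p\<in>S. g p)"
    using insert by (subst finsum_insert) (auto intro!: norm_triangle finsum_closed)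
  with insert show ?case by simp
qed simp

lemma finsum_smult:
  assumes "finite S" "\<And>p. p \<in> S \<Longrightarrow> g p \<in> carrier V"
  shows "c \<odot> (\<Oplus>p\<in>S. g p) = (\<Oplus>p\<in>S. c \<odot> g p)"
  using assms
proof (induction S)
  case (insert p S)
  then show ?case
    by (simp add: finsum_insert Pi_def smult_add finsum_closed)
qed simp

lemma smult_sum:
  assumes "finite S" "x \<in> carrier V"
  shows "(\<Sum>p\<in>S. a p) \<odot> x = (\<Oplus>p\<in>S. a p \<odot> x)"
  using assms
proof (induction S)
  case (insert p S)
  then show ?case
    by (simp add: finsum_insert Pi_def add_smult finsum_closed)
qed simp

lemma finsum_diff:
  assumes "finite S" "\<And>p. p \<in> S \<Longrightarrow> f p \<in> carrier V" "\<And>p. p \<in> S \<Longrightarrow> g p \<in> carrier V"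
  shows "(\<Oplus>p\<in>S. f p \<ominus> g p) = (\<Oplus>p\<in>S. f p) \<ominus> (\<Oplus>p\<in>S. g p)"
  using assms
proof (induction S)
  case (insert p S)
  then show ?case
    by (simp add: finsum_insert Pi_def finsum_closed add_diff_add)
qed simp

lemma finsum_mono_neutral:
  assumes "finite T" "S \<subseteq> T" "\<And>p. p \<in> S \<Longrightarrow> g p \<in> carrier V" "\<And>p. p \<in> T - S \<Longrightarrow> g p = \<zero>"
  shows "(\<Oplus>p\<in>T. g p) = (\<Oplus>p\<in>S. g p)"
proof -
  have "(\<Oplus>p\<in>S \<union> (T - S). g p) = (\<Oplus>p\<in>S. g p) \<oplus> (\<Oplus>p\<in>T - S. g p)"
    using assms by (intro finsum_Un_disjoint) (auto intro: finite_subset)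
  moreover have "(\<Oplus>p\<in>T - S. g p) = \<zero>"
    using assms(4) finsum_cong'[of "T - S" "T - S" "\<lambda>_. \<zero>" g] by (auto simp: finsum_zero)
  moreover have "S \<union> (T - S) = T" using assms(2) by blast
  ultimately show ?thesis
    using assms(3) by (simp add: finsum_closed)
qed

end

text \<open>
  Negation is multiplication by \<open>- 1\<close>, and the inequality for scalar multiples, applied to the scalar
  and to its inverse, yields the equality.
\<close>

lemma seminormed_moduleI:
  fixes V :: "'a nspace" (structure)
  assumes "\<And>x y. x \<in> carrier V \<Longrightarrow> y \<in> carrier V \<Longrightarrow> x \<oplus> y \<in> carrier V"
    and "\<zero> \<in> carrier V"
    and "\<And>c x. x \<in> carrier V \<Longrightarrow> c \<odot> x \<in> carrier V"
    and "\<And>x y z. \<lbrakk>x \<in> carrier V; y \<in> carrier V; z \<in> carrier V\<rbrakk> \<Longrightarrow> (x \<oplus> y) \<oplus> z = x \<oplus> (y \<oplus> z)"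
    and "\<And>x y. x \<in> carrier V \<Longrightarrow> y \<in> carrier V \<Longrightarrow> x \<oplus> y = y \<oplus> x"
    and "\<And>x. x \<in> carrier V \<Longrightarrow> \<zero> \<oplus> x = x"
    and "\<And>x. x \<in> carrier V \<Longrightarrow> 0 \<odot> x = \<zero>"
    and "\<And>c x y. x \<in> carrier V \<Longrightarrow> y \<in> carrier V \<Longrightarrow> c \<odot> (x \<oplus> y) = c \<odot> x \<oplus> c \<odot> y"
    and "\<And>c d x. x \<in> carrier V \<Longrightarrow> (c + d) \<odot> x = c \<odot> x \<oplus> d \<odot> x"
    and "\<And>c d x. x \<in> carrier V \<Longrightarrow> (c * d) \<odot> x = c \<odot> (d \<odot> x)"
    and "\<And>x. x \<in> carrier V \<Longrightarrow> 1 \<odot> x = x"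
    and "\<And>x. x \<in> carrier V \<Longrightarrow> 0 \<le> vnorm V x"
    and "\<And>x y. x \<in> carrier V \<Longrightarrow> y \<in> carrier V \<Longrightarrow> vnorm V (x \<oplus> y) \<le> vnorm V x + vnorm V y"
    and "\<And>c x. x \<in> carrier V \<Longrightarrow> vnorm V (c \<odot> x) \<le> cmod c * vnorm V x"
  shows "seminormed_module V"
proof -
  have inv: "\<exists>y\<in>carrier V. y \<oplus> x = \<zero>" if "x \<in> carrier V" for x
  proof
    show "(- 1) \<odot> x \<oplus> x = \<zero>"
      using assms(7)[OF that] assms(9)[OF that, of "- 1" 1] assms(11)[OF that] by simp
  qed (use assms(3) that in auto)
  have ag: "abelian_group V"
    by (rule abelian_groupI) (use assms inv in auto)
  have "Module.module complex_ring V"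
    by (rule moduleI[OF cring_complex_ring ag]) (use assms in auto)
  moreover have "vnorm V (c \<odot> x) = cmod c * vnorm V x" if x: "x \<in> carrier V" for c x
  proof (cases "c = 0")
    case True
    with assms(12)[OF assms(3)[OF x], of 0] assms(14)[OF x, of 0] show ?thesis by simp
  next
    case False
    have "cmod c * vnorm V x = cmod c * vnorm V (inverse c \<odot> (c \<odot> x))"
      using False assms(10)[OF x, of "inverse c" c] assms(11)[OF x] by simp
    also have "\<dots> \<le> cmod c * (cmod (inverse c) * vnorm V (c \<odot> x))"
      using x by (intro mult_left_mono assms) auto
    also have "\<dots> = vnorm V (c \<odot> x)"
      using False by (simp add: norm_inverse)
    finally show ?thesis using assms(14)[OF x, of c] by simp
  qed
  ultimately show ?thesis
    by (intro seminormed_module.intro seminormed_module_axioms.intro) (use assms in auto)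
qed

text \<open>Linearity is only required on the carrier; the values elsewhere are arbitrary.\<close>

definition linear_on :: "'a nspace \<Rightarrow> 'b nspace \<Rightarrow> ('a \<Rightarrow> 'b) \<Rightarrow> bool" where
  "linear_on V W h \<longleftrightarrow>
     (\<forall>x\<in>carrier V. h x \<in> carrier W) \<and>
     (\<forall>x\<in>carrier V. \<forall>y\<in>carrier V. h (x \<oplus>\<^bsub>V\<^esub> y) = h x \<oplus>\<^bsub>W\<^esub> h y) \<and>
     (\<forall>c. \<forall>x\<in>carrier V. h (c \<odot>\<^bsub>V\<^esub> x) = c \<odot>\<^bsub>W\<^esub> h x)"

lemma linear_onI:
  assumes "\<And>x. x \<in> carrier V \<Longrightarrow> h x \<in> carrier W"
    and "\<And>x y. x \<in> carrier V \<Longrightarrow> y \<in> carrier V \<Longrightarrow> h (x \<oplus>\<^bsub>V\<^esub> y) = h x \<oplus>\<^bsub>W\<^esub> h y"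
    and "\<And>c x. x \<in> carrier V \<Longrightarrow> h (c \<odot>\<^bsub>V\<^esub> x) = c \<odot>\<^bsub>W\<^esub> h x"
  shows "linear_on V W h"
  using assms by (auto simp: linear_on_def)

locale linear_pair = V: seminormed_module V + W: seminormed_module W
  for V :: "'a nspace" and W :: "'b nspace" +
  fixes h :: "'a \<Rightarrow> 'b"
  assumes lin: "linear_on V W h"
begin

lemma hom_carrier [simp, intro]: "x \<in> carrier V \<Longrightarrow> h x \<in> carrier W"
  and hom_add: "x \<in> carrier V \<Longrightarrow> y \<in> carrier V \<Longrightarrow> h (x \<oplus>\<^bsub>V\<^esub> y) = h x \<oplus>\<^bsub>W\<^esub> h y"
  and hom_smult: "x \<in> carrier V \<Longrightarrow> h (c \<odot>\<^bsub>V\<^esub> x) = c \<odot>\<^bsub>W\<^esub> h x"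
  using lin by (auto simp: linear_on_def)

lemma hom_zero [simp]: "h \<zero>\<^bsub>V\<^esub> = \<zero>\<^bsub>W\<^esub>"
  using hom_smult[of "\<zero>\<^bsub>V\<^esub>" 0] by simp

lemma hom_uminus: "x \<in> carrier V \<Longrightarrow> h (\<ominus>\<^bsub>V\<^esub> x) = \<ominus>\<^bsub>W\<^esub> h x"
  using hom_smult[of x "- 1"] V.minus_smult[of x 1] W.minus_smult[of "h x" 1] by simp

lemma hom_diff: "x \<in> carrier V \<Longrightarrow> y \<in> carrier V \<Longrightarrow> h (x \<ominus>\<^bsub>V\<^esub> y) = h x \<ominus>\<^bsub>W\<^esub> h y"
  by (simp add: a_minus_def hom_add hom_uminus)

lemma hom_finsum:
  assumes "finite S" "\<And>p. p \<in> S \<Longrightarrow> g p \<in> carrier V"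
  shows "h (\<Oplus>\<^bsub>V\<^esub>p\<in>S. g p) = (\<Oplus>\<^bsub>W\<^esub>p\<in>S. h (g p))"
  using assms
proof (induction S)
  case (insert p S)
  then show ?case
    by (simp add: V.finsum_insert W.finsum_insert Pi_def hom_add V.finsum_closed)
qed simp

end

section \<open>The norm metric and completeness\<close>

context complex_normed_space
begin

lemma vdist_eq: "x \<in> carrier X \<Longrightarrow> y \<in> carrier X \<Longrightarrow> vdist X x y = vnorm X (x \<ominus> y)"
  by (simp add: vdist_def)

lemma norm_diff_eq_0_iff:
  "x \<in> carrier X \<Longrightarrow> y \<in> carrier X \<Longrightarrow> vnorm X (x \<ominus> y) = 0 \<longleftrightarrow> x = y"
  using vnorm_eq_0_iff[of "x \<ominus> y"] diff_add_cancel[of x y] diff_self[of y] by auto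

lemma metric_space: "Metric_space (carrier X) (vdist X)"
proof
  show "0 \<le> vdist X x y" for x y
    by (simp add: vdist_def norm_nonneg)
  show "vdist X x y = vdist X y x" for x y
    by (simp add: vdist_def norm_diff_commute)
  show "(vdist X x y = 0) = (x = y)" if "x \<in> carrier X" "y \<in> carrier X" for x y
    using that by (simp add: vdist_eq norm_diff_eq_0_iff)
  show "vdist X x z \<le> vdist X x y + vdist X y z"
    if "x \<in> carrier X" "y \<in> carrier X" "z \<in> carrier X" for x y z
    using that by (simp add: vdist_eq norm_diff_triangle)
qed

sublocale Metric_space "carrier X" "vdist X"
  by (rule metric_space)

lemma limitin_iff:
  assumes "\<And>n. s n \<in> carrier X"
  shows "limitin (norm_topology X) s l sequentially \<longleftrightarrow>
           l \<in> carrier X \<and> (\<lambda>n. vnorm X (s n \<ominus> l)) \<longlonglongrightarrow> 0"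
  unfolding norm_topology_def limitin_metric_dist_null
  using assms by (auto simp: vdist_eq cong: conj_cong)

lemma closure_of_iff:
  assumes "S \<subseteq> carrier X"
  shows "x \<in> norm_topology X closure_of S \<longleftrightarrow>
           x \<in> carrier X \<and> (\<forall>e>0. \<exists>y\<in>S. vnorm X (x \<ominus> y) < e)"
  unfolding norm_topology_def metric_closure_of
  using assms by (auto simp: in_mball vdist_eq subset_iff) (metis vdist_eq)+

end

text \<open>
  Completeness, tested on sequences with rapidly decreasing steps only. The notion makes sense for
  seminorms and passes to quotients, since such a sequence can be lifted step by step.
\<close>

definition fast_complete :: "'a nspace \<Rightarrow> bool" where
  "fast_complete V \<longleftrightarrow>
     (\<forall>s. (\<forall>n. s n \<in> carrier V) \<and> (\<forall>n. vnorm V (s (Suc n) \<ominus>\<^bsub>V\<^esub> s n) \<le> (1/2) ^ n) \<longrightarrow>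
        (\<exists>l\<in>carrier V. (\<lambda>n. vnorm V (s n \<ominus>\<^bsub>V\<^esub> l)) \<longlonglongrightarrow> 0))"


context seminormed_module
begin

lemma Cauchy_step_bound:
  assumes s: "\<And>n. s n \<in> carrier V"
    and step: "\<And>n. vnorm V (s (Suc n) \<ominus> s n) \<le> d n" and "summable d"
  shows "m \<le> n \<Longrightarrow> vnorm V (s n \<ominus> s m) \<le> (\<Sum>k. d (k + m))"
proof -
  have d0: "0 \<le> d n" for n
    using step[of n] norm_nonneg[of "s (Suc n) \<ominus> s n"] s by (meson minus_closed order_trans)
  assume "m \<le> n"
  have sm: "summable (\<lambda>k. d (k + m))"
    using \<open>summable d\<close> by (simp add: summable_iff_shift)
  have "vnorm V (s (i + m) \<ominus> s m) \<le> (\<Sum>k<i. d (k + m))" for i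
  proof (induction i)
    case 0 then show ?case using s by simp
  next
    case (Suc i)
    have "vnorm V (s (Suc i + m) \<ominus> s m) \<le> vnorm V (s (Suc (i + m)) \<ominus> s (i + m)) + vnorm V (s (i + m) \<ominus> s m)"
      using s by (simp add: norm_diff_triangle)
    also have "\<dots> \<le> d (i + m) + (\<Sum>k<i. d (k + m))"
      by (intro add_mono step Suc)
    finally show ?case by simp
  qed
  from this[of "n - m"] show ?thesis
    using \<open>m \<le> n\<close> sum_le_suminf[OF sm, of "{..<n - m}"] d0 by simp
qed

end

context complex_normed_space
begin

lemma fast_complete_imp_mcomplete:
  assumes "fast_complete X"
  shows "mcomplete"
  unfolding mcomplete_def
proof (intro allI impI)
  fix s assume s: "MCauchy s"
  then have sX: "s n \<in> carrier X" for n
    by (auto simp: MCauchy_def)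
  have "\<exists>N. \<forall>m\<ge>N. \<forall>n\<ge>N. vnorm X (s m \<ominus> s n) < (1/2) ^ k" for k
    using s sX unfolding MCauchy_def by (simp add: vdist_eq)
  then obtain N where N: "\<And>k m n. m \<ge> N k \<Longrightarrow> n \<ge> N k \<Longrightarrow> vnorm X (s m \<ominus> s n) < (1/2) ^ k"
    by metis
  \<comment> \<open>Adding \<open>k\<close> makes the subsequence strictly increasing.\<close>
  define r where "r k = Max (N ` {..k}) + k" for k
  have rN: "N j \<le> r k" if "j \<le> k" for j k
    unfolding r_def using that by (intro trans_le_add1 Max_ge) auto
  have "\<exists>l\<in>carrier X. (\<lambda>k. vnorm X (s (r k) \<ominus> l)) \<longlonglongrightarrow> 0"
  proof (rule assms[unfolded fast_complete_def, rule_format, of "\<lambda>k. s (r k)"], intro conjI allI)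
    show "vnorm X (s (r (Suc k)) \<ominus> s (r k)) \<le> (1/2) ^ k" for k
      by (rule less_imp_le, rule N[OF rN rN]) auto
  qed (rule sX)
  then obtain l where l: "l \<in> carrier X" "(\<lambda>k. vnorm X (s (r k) \<ominus> l)) \<longlonglongrightarrow> 0"
    by blast
  have mono: "strict_mono r"
  proof (rule strict_mono_Suc_iff[THEN iffD2], rule allI)
    fix k
    have "Max (N ` {..k}) \<le> Max (N ` {..Suc k})"
      by (rule Max_mono) auto
    then show "r k < r (Suc k)" unfolding r_def by linarith
  qed
  have "limitin mtopology (s \<circ> r) l sequentially"
    using l limitin_iff[of "s \<circ> r" l] sX by (simp add: norm_topology_def)
  then have "limitin mtopology s l sequentially"
    using MCauchy_convergent_subsequence[OF s mono] by blast
  then show "\<exists>l. limitin mtopology s l sequentially" ..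
qed

lemma MCauchy_of_summable_steps:
  assumes s: "\<And>n. s n \<in> carrier X"
    and step: "\<And>n. vnorm X (s (Suc n) \<ominus> s n) \<le> d n" and d: "summable d"
  shows "MCauchy s"
  unfolding MCauchy_def
proof (intro conjI allI impI)
  fix e :: real assume "e > 0"
  have "eventually (\<lambda>m. (\<Sum>k. d (k + m)) < e) sequentially"
    using order_tendstoD(2)[OF suminf_exist_split2[OF d] \<open>e > 0\<close>] .
  then obtain N where N: "\<And>m. m \<ge> N \<Longrightarrow> (\<Sum>k. d (k + m)) < e"
    by (auto simp: eventually_sequentially)
  have *: "vnorm X (s n \<ominus> s m) < e" if "m \<le> n" "N \<le> m" for m n
    using Cauchy_step_bound[OF s step d that(1)] N[OF that(2)] by simp
  show "\<exists>N. \<forall>n n'. N \<le> n \<longrightarrow> N \<le> n' \<longrightarrow> vdist X (s n) (s n') < e"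
  proof (intro exI allI impI)
    fix n n' assume "N \<le> n" "N \<le> n'"
    then show "vdist X (s n) (s n') < e"
      using *[of n n'] *[of n' n] norm_diff_commute[OF s s] s by (cases "n \<le> n'") (auto simp: vdist_eq)
  qed
qed (use s in auto)

end

context complex_banach_space
begin

lemma convergent_of_summable_steps:
  assumes s: "\<And>n. s n \<in> carrier X"
    and step: "\<And>n. vnorm X (s (Suc n) \<ominus> s n) \<le> d n" and d: "summable d"
  shows "\<exists>l\<in>carrier X. (\<lambda>n. vnorm X (s n \<ominus> l)) \<longlonglongrightarrow> 0"
    and "l \<in> carrier X \<Longrightarrow> (\<lambda>n. vnorm X (s n \<ominus> l)) \<longlonglongrightarrow> 0 \<Longrightarrow>
      vnorm X (s m \<ominus> l) \<le> (\<Sum>k. d (k + m))"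
proof -
  have "MCauchy s"
    by (rule MCauchy_of_summable_steps[OF assms])
  then obtain l where "limitin mtopology s l sequentially"
    using complete by (auto simp: mcomplete_def)
  then show "\<exists>l\<in>carrier X. (\<lambda>n. vnorm X (s n \<ominus> l)) \<longlonglongrightarrow> 0"
    using limitin_iff[OF s] by (auto simp: norm_topology_def)
next
  assume l: "l \<in> carrier X" "(\<lambda>n. vnorm X (s n \<ominus> l)) \<longlonglongrightarrow> 0"
  have "vnorm X (s m \<ominus> l) \<le> (\<Sum>k. d (k + m)) + vnorm X (s n \<ominus> l)" if "n \<ge> m" for n
    using norm_diff_triangle[OF s s l(1), of m n] Cauchy_step_bound[OF s step d that]
      norm_diff_commute[OF s s, of m n] by simp
  moreover have "(\<lambda>n. (\<Sum>k. d (k + m)) + vnorm X (s n \<ominus> l)) \<longlonglongrightarrow> (\<Sum>k. d (k + m)) + 0"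
    by (intro tendsto_intros l)
  ultimately show "vnorm X (s m \<ominus> l) \<le> (\<Sum>k. d (k + m))"
    by (intro tendsto_lowerbound[OF _ _ trivial_limit_sequentially])
       (auto simp: eventually_sequentially)
qed

lemma fast_complete: "fast_complete X"
  unfolding fast_complete_def
proof (intro allI impI)
  fix s assume "(\<forall>n. s n \<in> carrier X) \<and> (\<forall>n. vnorm X (s (Suc n) \<ominus> s n) \<le> (1/2) ^ n)"
  then show "\<exists>l\<in>carrier X. (\<lambda>n. vnorm X (s n \<ominus> l)) \<longlonglongrightarrow> 0"
    by (intro convergent_of_summable_steps(1)[where d = "\<lambda>n. (1/2) ^ n"]) auto
qed

end

section \<open>Quotients of seminormed modules\<close>

lemma quotient_space_simps:
  "carrier (quotient_space V N) = a_rcosets\<^bsub>V\<^esub> N"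
  "\<zero>\<^bsub>quotient_space V N\<^esub> = N"
  "A \<oplus>\<^bsub>quotient_space V N\<^esub> B = A <+>\<^bsub>V\<^esub> B"
  "c \<odot>\<^bsub>quotient_space V N\<^esub> A = N <+>\<^bsub>V\<^esub> ((\<lambda>a. c \<odot>\<^bsub>V\<^esub> a) ` A)"
  "vnorm (quotient_space V N) A = (INF a\<in>A. vnorm V a)"
  by (auto simp: quotient_space_def)

text \<open>
  A seminormed module with a submodule; \<open>q\<close> is the quotient map and \<open>Q\<close> the quotient with the
  infimum seminorm.
\<close>

locale quotient_pair = seminormed_module V for V :: "'a nspace" (structure) +
  fixes N :: "'a set"
  assumes submodule: "submodule N complex_ring V"
begin

abbreviation Q where "Q \<equiv> quotient_space V N"
abbreviation q where "q v \<equiv> N +> v"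

sublocale N: abelian_subgroup N V
proof (rule abelian_subgroupI3)
  show "additive_subgroup N V"
    using submodule by (intro additive_subgroup.intro) (simp add: submodule_def)
qed (rule abelian_group_axioms)

lemma N_smult [intro]: "n \<in> N \<Longrightarrow> c \<odot> n \<in> N"
  using submodule by (simp add: submodule.smult_closed)

lemma mem_q_iff: "a \<in> q v \<longleftrightarrow> (\<exists>n\<in>N. a = n \<oplus> v)"
  by (auto simp: a_r_coset_def')

lemma mem_q_iff_diff: "v \<in> carrier V \<Longrightarrow> a \<in> q v \<longleftrightarrow> a \<in> carrier V \<and> a \<ominus> v \<in> N"
  unfolding mem_q_iff
  by (metis N.a_Hcarr add.m_closed add_diff_cancel diff_add_cancel)

lemma q_eq_iff: "v \<in> carrier V \<Longrightarrow> w \<in> carrier V \<Longrightarrow> q v = q w \<longleftrightarrow> v \<ominus> w \<in> N"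
  using mem_q_iff_diff[of w v] N.a_rcos_self[of v] N.a_repr_independence'[of v w] by blast

lemma carrier_Q: "carrier Q = q ` carrier V"
  by (auto simp: quotient_space_simps A_RCOSETS_def')

lemma q_carrier [simp, intro]: "v \<in> carrier V \<Longrightarrow> q v \<in> carrier Q"
  by (simp add: carrier_Q)

lemma zero_Q: "\<zero>\<^bsub>Q\<^esub> = q \<zero>"
  by (simp add: quotient_space_simps N.a_subset)

lemma q_add: "v \<in> carrier V \<Longrightarrow> w \<in> carrier V \<Longrightarrow> q v \<oplus>\<^bsub>Q\<^esub> q w = q (v \<oplus> w)"
  by (simp add: quotient_space_simps N.a_rcos_sum)

lemma q_smult: "v \<in> carrier V \<Longrightarrow> c \<odot>\<^bsub>Q\<^esub> q v = q (c \<odot> v)"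
proof -
  assume v: "v \<in> carrier V"
  have "N <+>\<^bsub>V\<^esub> ((\<lambda>a. c \<odot> a) ` q v) = q (c \<odot> v)"
  proof (rule Set.set_eqI, rule iffI)
    fix x assume "x \<in> N <+>\<^bsub>V\<^esub> ((\<lambda>a. c \<odot> a) ` q v)"
    then obtain m n where "m \<in> N" "n \<in> N" "x = m \<oplus> c \<odot> (n \<oplus> v)"
      by (auto simp: set_add_def' mem_q_iff)
    then show "x \<in> q (c \<odot> v)"
      using v by (auto simp: mem_q_iff smult_add a_assoc[symmetric] intro!: bexI[of _ "m \<oplus> c \<odot> n"])
  next
    fix x assume "x \<in> q (c \<odot> v)"
    then obtain n where "n \<in> N" "x = n \<oplus> c \<odot> v"
      by (auto simp: mem_q_iff)
    then show "x \<in> N <+>\<^bsub>V\<^esub> ((\<lambda>a. c \<odot> a) ` q v)"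
      using N.a_rcos_self[OF v] by (auto simp: set_add_def')
  qed
  then show ?thesis by (simp add: quotient_space_simps)
qed

lemma norm_q: "vnorm Q (q v) = (INF a\<in>q v. vnorm V a)"
  by (simp add: quotient_space_simps)

lemma q_subset: "v \<in> carrier V \<Longrightarrow> a \<in> q v \<Longrightarrow> a \<in> carrier V"
  by (simp add: mem_q_iff_diff)

lemma bdd_below_norm: "v \<in> carrier V \<Longrightarrow> bdd_below (vnorm V ` q v)"
  by (rule bdd_belowI[of _ 0]) (auto simp: norm_nonneg dest: q_subset)

lemma norm_q_le: "v \<in> carrier V \<Longrightarrow> a \<in> q v \<Longrightarrow> vnorm Q (q v) \<le> vnorm V a"
  unfolding norm_q by (rule cINF_lower[OF bdd_below_norm])

lemma norm_q_le_norm: "v \<in> carrier V \<Longrightarrow> vnorm Q (q v) \<le> vnorm V v"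
  by (rule norm_q_le) (auto simp: N.a_rcos_self)

lemma norm_q_nonneg: "v \<in> carrier V \<Longrightarrow> 0 \<le> vnorm Q (q v)"
  unfolding norm_q using N.a_rcos_self[of v]
  by (intro cINF_greatest) (auto simp: norm_nonneg dest: q_subset)

lemma norm_q_lessD: "v \<in> carrier V \<Longrightarrow> vnorm Q (q v) < r \<Longrightarrow> \<exists>a\<in>q v. vnorm V a < r"
  unfolding norm_q using N.a_rcos_self[of v]
  by (subst (asm) cINF_less_iff[OF _ bdd_below_norm]) auto

lemma q_rep: "v \<in> carrier V \<Longrightarrow> a \<in> q v \<Longrightarrow> q a = q v"
  using N.a_repr_independence' by blast

lemma seminormed_Q: "seminormed_module Q"
proof (rule seminormed_moduleI)
  fix x y z c d
  show "x \<oplus>\<^bsub>Q\<^esub> y \<in> carrier Q" if "x \<in> carrier Q" "y \<in> carrier Q"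
    using that by (auto simp: carrier_Q q_add)
  show "\<zero>\<^bsub>Q\<^esub> \<in> carrier Q" by (simp add: zero_Q)
  show "c \<odot>\<^bsub>Q\<^esub> x \<in> carrier Q" if "x \<in> carrier Q" for c
    using that by (auto simp: carrier_Q q_smult)
  show "(x \<oplus>\<^bsub>Q\<^esub> y) \<oplus>\<^bsub>Q\<^esub> z = x \<oplus>\<^bsub>Q\<^esub> (y \<oplus>\<^bsub>Q\<^esub> z)"
    if "x \<in> carrier Q" "y \<in> carrier Q" "z \<in> carrier Q"
    using that by (auto simp: carrier_Q q_add a_assoc)
  show "x \<oplus>\<^bsub>Q\<^esub> y = y \<oplus>\<^bsub>Q\<^esub> x" if "x \<in> carrier Q" "y \<in> carrier Q"
    using that by (auto simp: carrier_Q q_add a_comm)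
  show "\<zero>\<^bsub>Q\<^esub> \<oplus>\<^bsub>Q\<^esub> x = x" if "x \<in> carrier Q"
    using that by (auto simp: carrier_Q q_add zero_Q simp del: a_coset_add_zero)
  show "0 \<odot>\<^bsub>Q\<^esub> x = \<zero>\<^bsub>Q\<^esub>" if "x \<in> carrier Q"
    using that by (auto simp: carrier_Q q_smult zero_Q simp del: a_coset_add_zero)
  show "c \<odot>\<^bsub>Q\<^esub> (x \<oplus>\<^bsub>Q\<^esub> y) = c \<odot>\<^bsub>Q\<^esub> x \<oplus>\<^bsub>Q\<^esub> c \<odot>\<^bsub>Q\<^esub> y" if "x \<in> carrier Q" "y \<in> carrier Q" for c
    using that by (auto simp: carrier_Q q_smult q_add smult_add)
  show "(c + d) \<odot>\<^bsub>Q\<^esub> x = c \<odot>\<^bsub>Q\<^esub> x \<oplus>\<^bsub>Q\<^esub> d \<odot>\<^bsub>Q\<^esub> x" if "x \<in> carrier Q" for c d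
    using that by (auto simp: carrier_Q q_smult q_add add_smult)
  show "(c * d) \<odot>\<^bsub>Q\<^esub> x = c \<odot>\<^bsub>Q\<^esub> (d \<odot>\<^bsub>Q\<^esub> x)" if "x \<in> carrier Q" for c d
    using that by (auto simp: carrier_Q q_smult smult_smult)
  show "1 \<odot>\<^bsub>Q\<^esub> x = x" if "x \<in> carrier Q"
    using that by (auto simp: carrier_Q q_smult)
  show "0 \<le> vnorm Q x" if "x \<in> carrier Q"
    using that by (auto simp: carrier_Q norm_q_nonneg)
  show "vnorm Q (x \<oplus>\<^bsub>Q\<^esub> y) \<le> vnorm Q x + vnorm Q y" if "x \<in> carrier Q" "y \<in> carrier Q"
  proof -
    obtain v w where vw: "v \<in> carrier V" "w \<in> carrier V" "x = q v" "y = q w"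
      using \<open>x \<in> carrier Q\<close> \<open>y \<in> carrier Q\<close> by (auto simp: carrier_Q)
    show ?thesis
    proof (rule field_le_epsilon)
      fix e :: real assume "e > 0"
      obtain a where a: "a \<in> q v" "vnorm V a < vnorm Q x + e / 2"
        using norm_q_lessD[of v "vnorm Q x + e/2"] vw \<open>e > 0\<close> by auto
      obtain b where b: "b \<in> q w" "vnorm V b < vnorm Q y + e / 2"
        using norm_q_lessD[of w "vnorm Q y + e/2"] vw \<open>e > 0\<close> by auto
      have ab: "a \<in> carrier V" "b \<in> carrier V" using a b vw q_subset by auto
      have "x \<oplus>\<^bsub>Q\<^esub> y = q (a \<oplus> b)"
        using q_rep[OF _ a(1)] q_rep[OF _ b(1)] vw ab q_add[of a b] by simp
      then have "vnorm Q (x \<oplus>\<^bsub>Q\<^esub> y) \<le> vnorm V (a \<oplus> b)"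
        using norm_q_le_norm ab by simp
      also have "\<dots> \<le> vnorm V a + vnorm V b" using ab by (rule norm_triangle)
      finally show "vnorm Q (x \<oplus>\<^bsub>Q\<^esub> y) \<le> vnorm Q x + vnorm Q y + e"
        using a b by simp
    qed
  qed
  show "vnorm Q (c \<odot>\<^bsub>Q\<^esub> x) \<le> cmod c * vnorm Q x" if x: "x \<in> carrier Q" for c
  proof (rule field_le_epsilon)
    fix e :: real assume "e > 0"
    obtain v where v: "v \<in> carrier V" "x = q v" using x by (auto simp: carrier_Q)
    define e' where "e' = e / (cmod c + 1)"
    have e': "e' > 0" "cmod c * e' \<le> e"
      using \<open>e > 0\<close> by (auto simp: e'_def field_simps add_pos_nonneg add_nonneg_pos)
    obtain a where a: "a \<in> q v" "vnorm V a < vnorm Q (q v) + e'"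
      using norm_q_lessD[of v "vnorm Q (q v) + e'"] v e' by auto
    have aV: "a \<in> carrier V" using a v q_subset by auto
    have "vnorm Q (c \<odot>\<^bsub>Q\<^esub> q v) = vnorm Q (q (c \<odot> a))"
      using q_rep[OF v(1) a(1)] aV q_smult[of a c] by simp
    also have "\<dots> \<le> cmod c * vnorm V a"
      using norm_q_le_norm[of "c \<odot> a"] aV by (simp add: norm_smult)
    also have "\<dots> \<le> cmod c * (vnorm Q (q v) + e')"
      using a by (intro mult_left_mono) auto
    finally show "vnorm Q (c \<odot>\<^bsub>Q\<^esub> x) \<le> cmod c * vnorm Q x + e"
      using e' v by (simp add: algebra_simps)
  qed
qed

lemma linear_q: "linear_on V Q q"
  by (rule linear_onI) (auto simp: q_add q_smult)

lemma linear_pair_q: "linear_pair V Q q"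
  by (intro linear_pair.intro linear_pair_axioms.intro seminormed_module_axioms seminormed_Q linear_q)

lemma normed_Q:
  assumes closed: "\<And>v. v \<in> carrier V \<Longrightarrow> (\<And>e. e > 0 \<Longrightarrow> \<exists>n\<in>N. vnorm V (v \<ominus> n) < e) \<Longrightarrow> v \<in> N"
  shows "complex_normed_space Q"
proof -
  interpret Q: seminormed_module Q by (rule seminormed_Q)
  show ?thesis
  proof (intro complex_normed_space.intro complex_normed_space_axioms.intro)
    fix x assume x: "x \<in> carrier Q"
    then obtain v where v: "v \<in> carrier V" "x = q v" by (auto simp: carrier_Q)
    show "vnorm Q x = 0 \<longleftrightarrow> x = \<zero>\<^bsub>Q\<^esub>"
    proof
      assume 0: "vnorm Q x = 0"
      have "v \<in> N"
      proof (rule closed[OF v(1)])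
        fix e :: real assume "e > 0"
        then obtain a where a: "a \<in> q v" "vnorm V a < e"
          using norm_q_lessD[of v e] v 0 by auto
        then obtain n where n: "n \<in> N" "a = n \<oplus> v" by (auto simp: mem_q_iff)
        then have "v \<ominus> (\<ominus> n) = a"
          using v by (simp add: a_minus_def a_comm minus_minus)
        then show "\<exists>n\<in>N. vnorm V (v \<ominus> n) < e"
          using a n by (intro bexI[of _ "\<ominus> n"]) auto
      qed
      then show "x = \<zero>\<^bsub>Q\<^esub>" using v q_eq_iff[of v \<zero>] by (simp add: zero_Q del: a_coset_add_zero)
    qed auto
  qed (auto simp: Q.norm_nonneg Q.norm_triangle Q.norm_smult Q.module_axioms)
qed

text \<open>When only null vectors are divided out, the infimum is attained at every representative.\<close>

lemma norm_q_eq: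
  assumes "\<And>n. n \<in> N \<Longrightarrow> vnorm V n = 0" "v \<in> carrier V"
  shows "vnorm Q (q v) = vnorm V v"
proof (rule antisym[OF norm_q_le_norm[OF assms(2)]])
  show "vnorm V v \<le> vnorm Q (q v)"
    unfolding norm_q
  proof (rule cINF_greatest)
    fix a assume a: "a \<in> q v"
    have "a \<in> carrier V" "a \<ominus> v \<in> N" using a assms(2) by (auto simp: mem_q_iff_diff)
    then show "vnorm V v \<le> vnorm V a"
      using norm_le_add_diff[of v a] assms norm_diff_commute[of v a] by simp
  qed (use N.a_rcos_self[OF assms(2)] in auto)
qed

text \<open>
  The differences of consecutive terms lift to vectors of almost the same seminorm. Adding them up,
  starting with a lift of one term, gives a convergent lift of the sequence.
\<close>

lemma fast_complete_Q:
  assumes "fast_complete V"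
  shows "fast_complete Q"
  unfolding fast_complete_def
proof (intro allI impI, elim conjE)
  interpret q: linear_pair V Q q by (rule linear_pair_q)
  fix s assume s: "\<forall>n. s n \<in> carrier Q" and step: "\<forall>n. vnorm Q (s (Suc n) \<ominus>\<^bsub>Q\<^esub> s n) \<le> (1/2) ^ n"
  have s': "s n \<in> carrier Q" for n using s by simp
  \<comment> \<open>The shift of the index by one leaves room between the infimum and the bound \<open>(1/2) ^ n\<close>.\<close>
  have "\<exists>d\<in>carrier V. q d = s (Suc (Suc n)) \<ominus>\<^bsub>Q\<^esub> s (Suc n) \<and> vnorm V d \<le> (1/2) ^ n" for n
  proof -
    have "s (Suc (Suc n)) \<ominus>\<^bsub>Q\<^esub> s (Suc n) \<in> carrier Q" using s' by simp
    then obtain v where v: "v \<in> carrier V" "s (Suc (Suc n)) \<ominus>\<^bsub>Q\<^esub> s (Suc n) = q v"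
      unfolding carrier_Q by blast
    have "vnorm Q (q v) < (1/2) ^ n"
    proof -
      have "vnorm Q (q v) \<le> (1/2) ^ Suc n" using step[rule_format, of "Suc n"] v(2) by simp
      also have "\<dots> < (1/2) ^ n" by simp
      finally show ?thesis .
    qed
    then obtain a where "a \<in> q v" "vnorm V a < (1/2) ^ n" using norm_q_lessD v by blast
    then show ?thesis using q_rep[OF v(1)] q_subset[OF v(1)] v by (intro bexI[of _ a]) auto
  qed
  then obtain d where d: "\<And>n. d n \<in> carrier V" "\<And>n. q (d n) = s (Suc (Suc n)) \<ominus>\<^bsub>Q\<^esub> s (Suc n)"
    "\<And>n. vnorm V (d n) \<le> (1/2) ^ n" by metis
  obtain v where v: "v \<in> carrier V" "s (Suc 0) = q v" using s'[of "Suc 0"] by (auto simp: carrier_Q)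
  define t where "t = rec_nat v (\<lambda>n x. d n \<oplus> x)"
  have t: "t 0 = v" "\<And>n. t (Suc n) = d n \<oplus> t n" by (auto simp: t_def)
  have tV: "t n \<in> carrier V" for n by (induction n) (auto simp: t v d)
  have qt: "q (t n) = s (Suc n)" for n
  proof (induction n)
    case (Suc n)
    have "q (t (Suc n)) = q (d n) \<oplus>\<^bsub>Q\<^esub> q (t n)" using q_add[OF d(1) tV, of n n] by (simp only: t)
    then show ?case using Suc d(2)[of n] q.W.diff_add_cancel[OF s' s', of "Suc (Suc n)" "Suc n"] by simp
  qed (simp add: t v)
  have "vnorm V (t (Suc n) \<ominus> t n) \<le> (1/2) ^ n" for n
    using d tV by (simp add: t add_diff_cancel)
  then obtain l where l: "l \<in> carrier V" "(\<lambda>n. vnorm V (t n \<ominus> l)) \<longlonglongrightarrow> 0"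
    using assms tV unfolding fast_complete_def by blast
  have "(\<lambda>n. vnorm Q (s (Suc n) \<ominus>\<^bsub>Q\<^esub> q l)) \<longlonglongrightarrow> 0"
  proof (rule tendsto_sandwich[OF _ _ tendsto_const l(2)])
    show "\<forall>\<^sub>F n in sequentially. 0 \<le> vnorm Q (s (Suc n) \<ominus>\<^bsub>Q\<^esub> q l)"
      using s' l by (auto intro!: always_eventually q.W.norm_nonneg)
    have "vnorm Q (s (Suc n) \<ominus>\<^bsub>Q\<^esub> q l) \<le> vnorm V (t n \<ominus> l)" for n
      using norm_q_le_norm[of "t n \<ominus> l"] tV l by (simp add: q.hom_diff qt)
    then show "\<forall>\<^sub>F n in sequentially. vnorm Q (s (Suc n) \<ominus>\<^bsub>Q\<^esub> q l) \<le> vnorm V (t n \<ominus> l)" by simp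
  qed
  then have "(\<lambda>n. vnorm Q (s n \<ominus>\<^bsub>Q\<^esub> q l)) \<longlonglongrightarrow> 0"
    by (rule LIMSEQ_imp_Suc)
  then show "\<exists>l\<in>carrier Q. (\<lambda>n. vnorm Q (s n \<ominus>\<^bsub>Q\<^esub> l)) \<longlonglongrightarrow> 0"
    using l by (intro bexI[of _ "q l"]) auto
qed

end


section \<open>Integrable functions with values in a normed space\<close>

lemma L1_functions_simps:
  "carrier (L1_functions M X) =
     {f. (\<forall>z. f z \<in> carrier X) \<and> strongly_measurable M X f \<and> integrable M (\<lambda>z. vnorm X (f z))}"
  "\<zero>\<^bsub>L1_functions M X\<^esub> = (\<lambda>z. \<zero>\<^bsub>X\<^esub>)"
  "f \<oplus>\<^bsub>L1_functions M X\<^esub> g = (\<lambda>z. f z \<oplus>\<^bsub>X\<^esub> g z)"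
  "c \<odot>\<^bsub>L1_functions M X\<^esub> f = (\<lambda>z. c \<odot>\<^bsub>X\<^esub> f z)"
  "vnorm (L1_functions M X) f = (\<integral>z. vnorm X (f z) \<partial>M)"
  by (auto simp: L1_functions_def)

context complex_normed_space
begin

lemma strongly_measurable_simple:
  assumes "simple_function M f" "\<And>z. f z \<in> carrier X"
  shows "strongly_measurable M X f"
  unfolding strongly_measurable_def
  by (rule exI[of _ "\<lambda>_. f"]) (use assms in auto)

lemma strongly_measurable_limit:
  assumes "\<And>n. simple_function M (s n)" "\<And>n z. s n z \<in> carrier X"
    and "\<And>z. z \<in> space M \<Longrightarrow> (\<lambda>n. vnorm X (s n z \<ominus> f z)) \<longlonglongrightarrow> 0"
  shows "strongly_measurable M X f"
  unfolding strongly_measurable_def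
  by (rule exI[of _ s]) (use assms in auto)

lemma borel_measurable_norm:
  assumes f: "strongly_measurable M X f" "\<And>z. f z \<in> carrier X"
  shows "(\<lambda>z. vnorm X (f z)) \<in> borel_measurable M"
proof -
  obtain s where s: "\<And>n. simple_function M (s n)" "\<And>n z. z \<in> space M \<Longrightarrow> s n z \<in> carrier X"
    "\<And>z. z \<in> space M \<Longrightarrow> (\<lambda>n. vnorm X (s n z \<ominus> f z)) \<longlonglongrightarrow> 0"
    using f(1) unfolding strongly_measurable_def by blast
  show ?thesis
  proof (rule borel_measurable_LIMSEQ_real)
    show "(\<lambda>z. vnorm X (s n z)) \<in> borel_measurable M" for n
      using simple_function_compose1[OF s(1), of "vnorm X"] by (rule borel_measurable_simple_function)
    fix z assume z: "z \<in> space M"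
    have "(\<lambda>n. vnorm X (s n z) - vnorm X (f z)) \<longlonglongrightarrow> 0"
    proof (rule Lim_null_comparison[OF _ s(3)[OF z]])
      show "\<forall>\<^sub>F n in sequentially. norm (vnorm X (s n z) - vnorm X (f z)) \<le> vnorm X (s n z \<ominus> f z)"
        using s(2)[OF z] f(2) by (auto simp: abs_norm_diff_le)
    qed
    then show "(\<lambda>n. vnorm X (s n z)) \<longlonglongrightarrow> vnorm X (f z)"
      by (rule LIM_zero_cancel)
  qed
qed

lemma strongly_measurable_add:
  assumes f: "strongly_measurable M X f" "\<And>z. f z \<in> carrier X"
    and g: "strongly_measurable M X g" "\<And>z. g z \<in> carrier X"
  shows "strongly_measurable M X (\<lambda>z. f z \<oplus> g z)"
proof -
  obtain s where s: "\<And>n. simple_function M (s n)" "\<And>n z. z \<in> space M \<Longrightarrow> s n z \<in> carrier X"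
    "\<And>z. z \<in> space M \<Longrightarrow> (\<lambda>n. vnorm X (s n z \<ominus> f z)) \<longlonglongrightarrow> 0"
    using f(1) unfolding strongly_measurable_def by blast
  obtain t where t: "\<And>n. simple_function M (t n)" "\<And>n z. z \<in> space M \<Longrightarrow> t n z \<in> carrier X"
    "\<And>z. z \<in> space M \<Longrightarrow> (\<lambda>n. vnorm X (t n z \<ominus> g z)) \<longlonglongrightarrow> 0"
    using g(1) unfolding strongly_measurable_def by blast
  show ?thesis
    unfolding strongly_measurable_def
  proof (intro exI conjI allI ballI)
    show "simple_function M (\<lambda>z. s n z \<oplus> t n z)" for n
      using simple_function_compose2[OF s(1) t(1)] .
    show "(\<lambda>z. s n z \<oplus> t n z) ` space M \<subseteq> carrier X" for n
      using s(2) t(2) by auto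
    fix z assume z: "z \<in> space M"
    show "(\<lambda>n. vnorm X ((s n z \<oplus> t n z) \<ominus> (f z \<oplus> g z))) \<longlonglongrightarrow> 0"
    proof (rule Lim_null_comparison)
      show "(\<lambda>n. vnorm X (s n z \<ominus> f z) + vnorm X (t n z \<ominus> g z)) \<longlonglongrightarrow> 0"
        using tendsto_add[OF s(3)[OF z] t(3)[OF z]] by simp
      show "\<forall>\<^sub>F n in sequentially. norm (vnorm X ((s n z \<oplus> t n z) \<ominus> (f z \<oplus> g z)))
              \<le> vnorm X (s n z \<ominus> f z) + vnorm X (t n z \<ominus> g z)"
        using s(2)[OF z] t(2)[OF z] f(2) g(2) by (auto simp: norm_add_diff_add norm_nonneg)
    qed
  qed
qed

lemma strongly_measurable_smult_fun:
  assumes f: "f \<in> borel_measurable M" and x: "x \<in> carrier X"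
  shows "strongly_measurable M X (\<lambda>z. f z \<odot> x)"
proof -
  obtain s where s: "\<And>n. simple_function M (s n)" "\<And>z. z \<in> space M \<Longrightarrow> (\<lambda>n. s n z) \<longlonglongrightarrow> f z"
    using borel_measurable_implies_sequence_metric[OF f, of 0] by blast
  show ?thesis
  proof (rule strongly_measurable_limit)
    show "simple_function M (\<lambda>z. s n z \<odot> x)" for n
      using simple_function_compose1[OF s(1), of "\<lambda>c. c \<odot> x"] .
    show "s n z \<odot> x \<in> carrier X" for n z using x by auto
    fix z assume z: "z \<in> space M"
    have "(\<lambda>n. cmod (s n z - f z) * vnorm X x) \<longlonglongrightarrow> 0"
      using tendsto_norm_zero[OF LIM_zero[OF s(2)[OF z]]] by (rule tendsto_mult_left_zero)
    then show "(\<lambda>n. vnorm X (s n z \<odot> x \<ominus> f z \<odot> x)) \<longlonglongrightarrow> 0"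
      using x by (simp add: diff_smult[symmetric] norm_smult)
  qed
qed

lemma strongly_measurable_smult:
  assumes f: "strongly_measurable M X f" "\<And>z. f z \<in> carrier X"
  shows "strongly_measurable M X (\<lambda>z. c \<odot> f z)"
proof -
  obtain s where s: "\<And>n. simple_function M (s n)" "\<And>n z. z \<in> space M \<Longrightarrow> s n z \<in> carrier X"
    "\<And>z. z \<in> space M \<Longrightarrow> (\<lambda>n. vnorm X (s n z \<ominus> f z)) \<longlonglongrightarrow> 0"
    using f(1) unfolding strongly_measurable_def by blast
  show ?thesis
    unfolding strongly_measurable_def
  proof (intro exI conjI allI ballI)
    show "simple_function M (\<lambda>z. c \<odot> s n z)" for n
      using simple_function_compose1[OF s(1)] .
    show "(\<lambda>z. c \<odot> s n z) ` space M \<subseteq> carrier X" for n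
      using s(2) by auto
    fix z assume z: "z \<in> space M"
    show "(\<lambda>n. vnorm X (c \<odot> s n z \<ominus> c \<odot> f z)) \<longlonglongrightarrow> 0"
      using tendsto_mult_right_zero[OF s(3)[OF z], of "cmod c"] s(2)[OF z] f(2)
      by (simp add: norm_smult_diff)
  qed
qed

lemma integrable_norm_add:
  assumes f: "strongly_measurable M X f" "\<And>z. f z \<in> carrier X" "integrable M (\<lambda>z. vnorm X (f z))"
    and g: "strongly_measurable M X g" "\<And>z. g z \<in> carrier X" "integrable M (\<lambda>z. vnorm X (g z))"
  shows "integrable M (\<lambda>z. vnorm X (f z \<oplus> g z))"
proof (rule Bochner_Integration.integrable_bound[OF Bochner_Integration.integrable_add[OF f(3) g(3)]])
  show "(\<lambda>z. vnorm X (f z \<oplus> g z)) \<in> borel_measurable M"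
    using f g by (intro borel_measurable_norm strongly_measurable_add) auto
  show "AE z in M. norm (vnorm X (f z \<oplus> g z)) \<le> norm (vnorm X (f z) + vnorm X (g z))"
    using f(2) g(2) by (intro AE_I2) (auto simp: norm_nonneg norm_triangle)
qed

lemma seminormed_L1_functions: "seminormed_module (L1_functions M X)"
proof (rule seminormed_moduleI)
  fix f g assume "f \<in> carrier (L1_functions M X)" "g \<in> carrier (L1_functions M X)"
  then have f: "strongly_measurable M X f" "\<And>z. f z \<in> carrier X" "integrable M (\<lambda>z. vnorm X (f z))"
    and g: "strongly_measurable M X g" "\<And>z. g z \<in> carrier X" "integrable M (\<lambda>z. vnorm X (g z))"
    by (auto simp: L1_functions_simps)
  show "f \<oplus>\<^bsub>L1_functions M X\<^esub> g \<in> carrier (L1_functions M X)"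
    using strongly_measurable_add[OF f(1,2) g(1,2)] integrable_norm_add[OF f g] f g
    by (simp add: L1_functions_simps)
  have "(\<integral>z. vnorm X (f z \<oplus> g z) \<partial>M) \<le> (\<integral>z. vnorm X (f z) + vnorm X (g z) \<partial>M)"
    using integrable_norm_add[OF f g] f g by (intro integral_mono) (auto simp: norm_triangle)
  then show "vnorm (L1_functions M X) (f \<oplus>\<^bsub>L1_functions M X\<^esub> g)
      \<le> vnorm (L1_functions M X) f + vnorm (L1_functions M X) g"
    using f(3) g(3) by (simp add: L1_functions_simps)
  show "f \<oplus>\<^bsub>L1_functions M X\<^esub> g = g \<oplus>\<^bsub>L1_functions M X\<^esub> f"
    using f(2) g(2) by (auto simp: L1_functions_simps intro!: ext a_comm)
qed (auto simp: L1_functions_simps norm_smult strongly_measurable_smult a_assoc smult_add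
   add_smult smult_smult norm_nonneg intro!: strongly_measurable_simple)

lemma L1_eval: "linear_pair (L1_functions M X) X (\<lambda>f. f z)"
  by (intro linear_pair.intro linear_pair_axioms.intro seminormed_L1_functions
      seminormed_module_axioms linear_onI) (auto simp: L1_functions_simps)

lemma L1_diff_apply:
  assumes "f \<in> carrier (L1_functions M X)" "g \<in> carrier (L1_functions M X)"
  shows "(f \<ominus>\<^bsub>L1_functions M X\<^esub> g) z = f z \<ominus> g z"
  by (rule linear_pair.hom_diff[OF L1_eval assms])

text \<open>
  Setting the approximating simple functions to zero wherever they exceed twice the norm of \<open>f\<close>
  makes dominated convergence applicable.
\<close>

lemma simple_dense_L1:
  assumes f: "f \<in> carrier (L1_functions M X)" and e: "e > 0"
  obtains t where "t \<in> carrier (L1_functions M X)" "simple_function M t"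
    "vnorm (L1_functions M X) (t \<ominus>\<^bsub>L1_functions M X\<^esub> f) < e"
proof -
  interpret L: seminormed_module "L1_functions M X" by (rule seminormed_L1_functions)
  have f': "strongly_measurable M X f" "\<And>z. f z \<in> carrier X" "integrable M (\<lambda>z. vnorm X (f z))"
    using f by (auto simp: L1_functions_simps)
  obtain s where s: "\<And>n. simple_function M (s n)" "\<And>n z. z \<in> space M \<Longrightarrow> s n z \<in> carrier X"
    "\<And>z. z \<in> space M \<Longrightarrow> (\<lambda>n. vnorm X (s n z \<ominus> f z)) \<longlonglongrightarrow> 0"
    using f'(1) unfolding strongly_measurable_def by blast
  have fm: "(\<lambda>z. vnorm X (f z)) \<in> borel_measurable M"
    using f' by (simp add: borel_measurable_norm)
  define A where "A n = {z \<in> space M. vnorm X (s n z) \<le> 2 * vnorm X (f z)}" for n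
  have A: "A n \<in> sets M" for n
  proof -
    have "(\<lambda>z. vnorm X (s n z)) \<in> borel_measurable M"
      using simple_function_compose1[OF s(1), of "vnorm X"] by (rule borel_measurable_simple_function)
    then show ?thesis unfolding A_def using fm by measurable
  qed
  define t where "t n z = (if z \<in> A n then s n z else \<zero>)" for n z
  have tX: "t n z \<in> carrier X" for n z
    using s(2) by (auto simp: t_def A_def)
  have ts: "simple_function M (t n)" for n
    unfolding t_def using A s(1) sets.sets_into_space[OF A[of n]]
    by (intro simple_function_If_set) (auto simp: Int_absorb2)
  have t_le: "vnorm X (t n z) \<le> 2 * vnorm X (f z)" for n z
    using f'(2) by (auto simp: t_def A_def norm_nonneg)
  have tL: "t n \<in> carrier (L1_functions M X)" for n
  proof -
    have "integrable M (\<lambda>z. vnorm X (t n z))"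
    proof (rule Bochner_Integration.integrable_bound)
      show "integrable M (\<lambda>z. 2 * vnorm X (f z))" using f'(3) by simp
      show "(\<lambda>z. vnorm X (t n z)) \<in> borel_measurable M"
        using simple_function_compose1[OF ts, of "vnorm X"] by (rule borel_measurable_simple_function)
      show "AE z in M. norm (vnorm X (t n z)) \<le> norm (2 * vnorm X (f z))"
        using t_le tX f'(2) by (intro AE_I2) (auto simp: norm_nonneg)
    qed
    then show ?thesis
      using tX strongly_measurable_simple[OF ts tX] by (simp add: L1_functions_simps)
  qed
  have diffL: "t n \<ominus>\<^bsub>L1_functions M X\<^esub> f \<in> carrier (L1_functions M X)" for n
    using tL f by simp
  note diff_app = L1_diff_apply[OF tL f]
  have "(\<lambda>n. \<integral>z. vnorm X (t n z \<ominus> f z) \<partial>M) \<longlonglongrightarrow> (\<integral>z. 0 \<partial>M)"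
  proof (rule integral_dominated_convergence)
    show "integrable M (\<lambda>z. 3 * vnorm X (f z))" using f'(3) by simp
    show "(\<lambda>z. vnorm X (t n z \<ominus> f z)) \<in> borel_measurable M" for n
      using diffL[of n] borel_measurable_integrable by (auto simp: L1_functions_simps diff_app)
    show "AE z in M. norm (vnorm X (t n z \<ominus> f z)) \<le> 3 * vnorm X (f z)" for n
    proof (rule AE_I2)
      fix z
      show "norm (vnorm X (t n z \<ominus> f z)) \<le> 3 * vnorm X (f z)"
        using norm_diff_le[OF tX f'(2), of n z z] t_le[of n z] norm_nonneg[of "t n z \<ominus> f z"] tX f'(2)
        by simp
    qed
    show "AE z in M. (\<lambda>n. vnorm X (t n z \<ominus> f z)) \<longlonglongrightarrow> 0"
    proof (rule AE_I2)
      fix z assume z: "z \<in> space M"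
      show "(\<lambda>n. vnorm X (t n z \<ominus> f z)) \<longlonglongrightarrow> 0"
      proof (cases "vnorm X (f z) = 0")
        case True
        have "vnorm X (t n z \<ominus> f z) = 0" for n
          using norm_diff_le[OF tX f'(2), of n z z] t_le[of n z] norm_nonneg[of "t n z \<ominus> f z"]
            tX f'(2) True by simp
        then show ?thesis by simp
      next
        case False
        then have pos: "vnorm X (f z) > 0" using norm_nonneg[OF f'(2), of z] by simp
        have "eventually (\<lambda>n. vnorm X (s n z \<ominus> f z) < vnorm X (f z)) sequentially"
          using order_tendstoD(2)[OF s(3)[OF z] pos] .
        then have "eventually (\<lambda>n. vnorm X (s n z \<ominus> f z) = vnorm X (t n z \<ominus> f z)) sequentially"
        proof eventually_elim
          case (elim n)
          then have "z \<in> A n"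
            using norm_le_add_diff[OF s(2)[OF z] f'(2), of n z] z by (simp add: A_def)
          then show ?case by (simp add: t_def)
        qed
        then show ?thesis using s(3)[OF z] by (rule Lim_transform_eventually[rotated])
      qed
    qed
  qed simp_all
  then have "eventually (\<lambda>n. (\<integral>z. vnorm X (t n z \<ominus> f z) \<partial>M) < e) sequentially"
    using e by (intro order_tendstoD(2)) auto
  then obtain n where "(\<integral>z. vnorm X (t n z \<ominus> f z) \<partial>M) < e"
    by (auto simp: eventually_sequentially)
  then show ?thesis
    using that[OF tL ts, of n] diff_app by (simp add: L1_functions_simps)
qed

lemma L1_norm_ennreal:
  assumes "f \<in> carrier (L1_functions M X)"
  shows "(\<integral>\<^sup>+ z. ennreal (vnorm X (f z)) \<partial>M) = ennreal (vnorm (L1_functions M X) f)"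
  using assms by (auto simp: L1_functions_simps norm_nonneg intro!: nn_integral_eq_integral)

end

text \<open>
  The functions are first replaced by simple functions, which converge almost everywhere because
  the norms of their differences have integrable sum. The limit is set to zero on the exceptional
  set, so that it is a limit of simple functions at every point, hence strongly measurable.
\<close>

lemma (in complex_banach_space) fast_complete_L1_functions: "fast_complete (L1_functions M X)"
  unfolding fast_complete_def
proof (intro allI impI, elim conjE)
  interpret L: seminormed_module "L1_functions M X" by (rule seminormed_L1_functions)
  let ?L = "L1_functions M X"
  fix s assume s: "\<forall>n. s n \<in> carrier ?L" and step: "\<forall>n. vnorm ?L (s (Suc n) \<ominus>\<^bsub>?L\<^esub> s n) \<le> (1/2) ^ n"
  have "\<exists>t. t \<in> carrier ?L \<and> simple_function M t \<and> vnorm ?L (t \<ominus>\<^bsub>?L\<^esub> s n) < (1/2) ^ n" for n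
    using simple_dense_L1[of "s n" M "(1/2) ^ n"] s by (metis zero_less_power half_gt_zero_iff zero_less_one)
  then obtain t where t: "\<And>n. t n \<in> carrier ?L" "\<And>n. simple_function M (t n)"
    "\<And>n. vnorm ?L (t n \<ominus>\<^bsub>?L\<^esub> s n) < (1/2) ^ n" by metis
  have tX: "t n z \<in> carrier X" for n z using t(1)[of n] by (simp add: L1_functions_simps)
  define d where "d n z = vnorm X (t (Suc n) z \<ominus> t n z)" for n z
  have d0: "d n z \<ge> 0" for n z using tX by (simp add: d_def norm_nonneg)
  have dm [measurable]: "d n \<in> borel_measurable M" for n
  proof -
    have "(\<lambda>z. vnorm X ((t (Suc n) \<ominus>\<^bsub>?L\<^esub> t n) z)) \<in> borel_measurable M"
      using L.minus_closed[OF t(1) t(1), of "Suc n" n] by (intro borel_measurable_norm) (auto simp: L1_functions_simps)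
    then show ?thesis using t(1) by (simp add: d_def[abs_def] L1_diff_apply)
  qed
  have d_int: "(\<integral>\<^sup>+ z. ennreal (d n z) \<partial>M) \<le> ennreal (3 * (1/2) ^ n)" for n
  proof -
    have h1: "vnorm ?L (t (Suc n) \<ominus>\<^bsub>?L\<^esub> t n) \<le> vnorm ?L (t (Suc n) \<ominus>\<^bsub>?L\<^esub> s (Suc n))
        + vnorm ?L (s (Suc n) \<ominus>\<^bsub>?L\<^esub> t n)"
      using t(1) s by (intro L.norm_diff_triangle) auto
    have h2: "vnorm ?L (s (Suc n) \<ominus>\<^bsub>?L\<^esub> t n) \<le> vnorm ?L (s (Suc n) \<ominus>\<^bsub>?L\<^esub> s n) + vnorm ?L (s n \<ominus>\<^bsub>?L\<^esub> t n)"
      using t(1) s by (intro L.norm_diff_triangle) auto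
    have h3: "vnorm ?L (s n \<ominus>\<^bsub>?L\<^esub> t n) = vnorm ?L (t n \<ominus>\<^bsub>?L\<^esub> s n)"
      using t(1) s by (intro L.norm_diff_commute) auto
    have "vnorm ?L (t (Suc n) \<ominus>\<^bsub>?L\<^esub> t n) \<le> 3 * (1/2) ^ n"
      using h1 h2 h3 t(3)[of n] t(3)[of "Suc n"] step[rule_format, of n] 
      zero_le_power[of "1/2::real" n]
      unfolding power_Suc by linarith
    moreover have "(\<integral>\<^sup>+ z. ennreal (d n z) \<partial>M) = ennreal (vnorm ?L (t (Suc n) \<ominus>\<^bsub>?L\<^esub> t n))"
      using L1_norm_ennreal[OF L.minus_closed[OF t(1) t(1)], of "Suc n" n] t(1)
      by (simp add: d_def L1_diff_apply)
    ultimately show ?thesis by (simp add: ennreal_leI)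
  qed
  have tail: "(\<integral>\<^sup>+ z. (\<Sum>k. ennreal (d (k + m) z)) \<partial>M) \<le> ennreal (6 * (1/2) ^ m)" for m
  proof -
    have "(\<integral>\<^sup>+ z. (\<Sum>k. ennreal (d (k + m) z)) \<partial>M) = (\<Sum>k. \<integral>\<^sup>+ z. ennreal (d (k + m) z) \<partial>M)"
      by (rule nn_integral_suminf) simp
    also have "\<dots> \<le> (\<Sum>k. ennreal (3 * (1/2) ^ (k + m)))"
      by (intro suminf_le d_int) auto
    also have "\<dots> = ennreal (\<Sum>k. 3 * (1/2) ^ (k + m))"
      by (intro suminf_ennreal2) (auto intro!: summable_mult summable_mult2 simp: power_add)
    also have "(\<Sum>k. 3 * (1/2::real) ^ (k + m)) = 6 * (1/2) ^ m"
      using suminf_mult[of "\<lambda>k. (1/2::real)^k" "3 * (1/2) ^ m"] suminf_geometric[of "1/2::real"]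
      by (simp add: power_add ac_simps summable_geometric)
    finally show ?thesis .
  qed
  define G where "G = {z \<in> space M. (\<Sum>k. ennreal (d k z)) \<noteq> \<infinity>}"
  have G: "G \<in> sets M" unfolding G_def by measurable
  have AEG: "AE z in M. z \<in> G"
  proof -
    have "(\<integral>\<^sup>+ z. (\<Sum>k. ennreal (d k z)) \<partial>M) \<noteq> \<infinity>"
      using tail[of 0] by (auto simp: top_unique)
    then have "AE z in M. (\<Sum>k. ennreal (d k z)) \<noteq> \<infinity>"
      by (intro nn_integral_noteq_infinite) auto
    then show ?thesis by (auto simp: G_def)
  qed
  have summ: "summable (\<lambda>n. d n z)" if "z \<in> G" for z
    using that d0 by (intro summable_suminf_not_top) (auto simp: G_def)
  have "\<exists>l\<in>carrier X. (\<lambda>n. vnorm X (t n z \<ominus> l)) \<longlonglongrightarrow> 0" if "z \<in> G" for z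
    by (rule convergent_of_summable_steps(1)[OF tX _ summ[OF that]]) (simp add: d_def)
  then obtain l where l: "\<And>z. z \<in> G \<Longrightarrow> l z \<in> carrier X"
    "\<And>z. z \<in> G \<Longrightarrow> (\<lambda>n. vnorm X (t n z \<ominus> l z)) \<longlonglongrightarrow> 0" by metis
  have l_le: "vnorm X (t m z \<ominus> l z) \<le> (\<Sum>k. d (k + m) z)" if "z \<in> G" for m z
    by (rule convergent_of_summable_steps(2)[OF tX _ summ[OF that] l(1)[OF that] l(2)[OF that]])
       (simp add: d_def)
  define f where "f z = (if z \<in> G then l z else \<zero>)" for z
  have fX: "f z \<in> carrier X" for z using l by (simp add: f_def)
  have fm: "strongly_measurable M X f"
  proof (rule strongly_measurable_limit)
    show "simple_function M (\<lambda>z. if z \<in> G then t n z else \<zero>)" for n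
      using t(2) G sets.sets_into_space[OF G] by (intro simple_function_If_set) (auto simp: Int_absorb2)
    show "(if z \<in> G then t n z else \<zero>) \<in> carrier X" for n z using tX by simp
    show "(\<lambda>n. vnorm X ((if z \<in> G then t n z else \<zero>) \<ominus> f z)) \<longlonglongrightarrow> 0" for z
      using l(2) by (cases "z \<in> G") (auto simp: f_def)
  qed
  have dist_le: "(\<integral>\<^sup>+ z. ennreal (vnorm X (t m z \<ominus> f z)) \<partial>M) \<le> ennreal (6 * (1/2) ^ m)" for m
  proof -
    have "(\<integral>\<^sup>+ z. ennreal (vnorm X (t m z \<ominus> f z)) \<partial>M) \<le> (\<integral>\<^sup>+ z. (\<Sum>k. ennreal (d (k + m) z)) \<partial>M)"
    proof (rule nn_integral_mono_AE, use AEG in eventually_elim)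
      case (elim z)
      have "ennreal (vnorm X (t m z \<ominus> f z)) \<le> ennreal (\<Sum>k. d (k + m) z)"
        using l_le[OF elim] elim by (simp add: f_def ennreal_leI)
      also have "\<dots> = (\<Sum>k. ennreal (d (k + m) z))"
        using d0 summable_ignore_initial_segment[OF summ[OF elim], of m]
        by (intro suminf_ennreal2[symmetric]) auto
      finally show ?case .
    qed
    from order_trans[OF this tail] show ?thesis .
  qed
  have diff_meas: "(\<lambda>z. vnorm X (t m z \<ominus> f z)) \<in> borel_measurable M" for m
  proof -
    have "(\<lambda>z. vnorm X (t m z \<oplus> (- 1) \<odot> f z)) \<in> borel_measurable M"
      using t(1)[of m] fX fm tX
      by (intro borel_measurable_norm strongly_measurable_add strongly_measurable_smult)
         (auto simp: L1_functions_simps)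
    then show ?thesis using fX minus_smult[of _ 1] by (simp add: a_minus_def)
  qed
  have diff_int: "integrable M (\<lambda>z. vnorm X (t m z \<ominus> f z))" for m
    using dist_le[of m] fX tX diff_meas
    by (intro integrableI_nonneg) (auto simp: norm_nonneg less_top[symmetric] top_unique)
  have fL: "f \<in> carrier ?L"
  proof -
    have "integrable M (\<lambda>z. vnorm X (f z))"
    proof (rule Bochner_Integration.integrable_bound)
      show "integrable M (\<lambda>z. vnorm X (t 0 z) + vnorm X (t 0 z \<ominus> f z))"
        using t(1)[of 0] diff_int[of 0] by (simp add: L1_functions_simps)
      show "(\<lambda>z. vnorm X (f z)) \<in> borel_measurable M" using fm fX by (simp add: borel_measurable_norm)
      show "AE z in M. norm (vnorm X (f z)) \<le> norm (vnorm X (t 0 z) + vnorm X (t 0 z \<ominus> f z))"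
      proof (rule AE_I2)
        fix z
        show "norm (vnorm X (f z)) \<le> norm (vnorm X (t 0 z) + vnorm X (t 0 z \<ominus> f z))"
          using norm_le_add_diff[OF fX tX, of z 0 z] norm_diff_commute[OF fX tX, of z 0 z] fX[of z]
            norm_nonneg by simp
      qed
    qed
    then show ?thesis using fm fX by (simp add: L1_functions_simps)
  qed
  have bound: "vnorm ?L (s m \<ominus>\<^bsub>?L\<^esub> f) \<le> 7 * (1/2) ^ m" for m
  proof -
    have "ennreal (vnorm ?L (t m \<ominus>\<^bsub>?L\<^esub> f)) \<le> ennreal (6 * (1/2) ^ m)"
      using L1_norm_ennreal[OF L.minus_closed[OF t(1) fL], of m] dist_le[of m] t(1) fL
      by (simp add: L1_diff_apply)
    then have "vnorm ?L (t m \<ominus>\<^bsub>?L\<^esub> f) \<le> 6 * (1/2) ^ m"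
      by (simp add: ennreal_le_iff)
    moreover have "vnorm ?L (s m \<ominus>\<^bsub>?L\<^esub> f) \<le> vnorm ?L (s m \<ominus>\<^bsub>?L\<^esub> t m) + vnorm ?L (t m \<ominus>\<^bsub>?L\<^esub> f)"
      using t(1) s fL by (intro L.norm_diff_triangle) auto
    ultimately show ?thesis
      using t(3)[of m] L.norm_diff_commute[of "s m" "t m"] t(1) s by simp
  qed
  have "(\<lambda>m. vnorm ?L (s m \<ominus>\<^bsub>?L\<^esub> f)) \<longlonglongrightarrow> 0"
  proof (rule Lim_null_comparison)
    show "(\<lambda>m. 7 * (1/2::real) ^ m) \<longlonglongrightarrow> 0"
      by (intro tendsto_mult_right_zero LIMSEQ_power_zero) simp
    show "\<forall>\<^sub>F m in sequentially. norm (vnorm ?L (s m \<ominus>\<^bsub>?L\<^esub> f)) \<le> 7 * (1/2) ^ m"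
      using bound s fL by (auto simp: L.norm_nonneg)
  qed
  with fL show "\<exists>l\<in>carrier ?L. (\<lambda>n. vnorm ?L (s n \<ominus>\<^bsub>?L\<^esub> l)) \<longlonglongrightarrow> 0" by blast
qed

section \<open>The normed space of integrable functions\<close>

context complex_normed_space
begin

lemma L1_null_norm: "n \<in> L1_null M X \<Longrightarrow> vnorm (L1_functions M X) n = 0"
  by (auto simp: L1_null_def L1_functions_simps intro!: integral_eq_zero_AE)

lemma L1_null_iff: "f \<in> L1_null M X \<longleftrightarrow> f \<in> carrier (L1_functions M X) \<and> vnorm (L1_functions M X) f = 0"
proof
  assume f: "f \<in> carrier (L1_functions M X) \<and> vnorm (L1_functions M X) f = 0"
  then have "AE z in M. vnorm X (f z) = 0"
    by (subst (asm) L1_functions_simps(5), subst (asm) integral_nonneg_eq_0_iff_AE)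
       (auto simp: L1_functions_simps norm_nonneg)
  then show "f \<in> L1_null M X"
    using f by (auto simp: L1_null_def L1_functions_simps vnorm_eq_0_iff)
qed (auto simp: L1_null_norm, auto simp: L1_null_def)

lemma quotient_pair_L1: "quotient_pair (L1_functions M X) (L1_null M X)"
proof -
  interpret L: seminormed_module "L1_functions M X" by (rule seminormed_L1_functions)
  have "submodule (L1_null M X) complex_ring (L1_functions M X)"
  proof (rule L.submoduleI)
    fix a b assume "a \<in> L1_null M X" "b \<in> L1_null M X"
    then show "a \<oplus>\<^bsub>L1_functions M X\<^esub> b \<in> L1_null M X"
      using L.norm_triangle[of a b] L.norm_nonneg[of "a \<oplus>\<^bsub>L1_functions M X\<^esub> b"]
      by (auto simp: L1_null_iff)
  qed (auto simp: L1_null_iff L.norm_smult)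
  then show ?thesis
    by (intro quotient_pair.intro quotient_pair_axioms.intro seminormed_L1_functions)
qed

lemma normed_L1_space: "complex_normed_space (L1_space M X)"
proof -
  interpret L: quotient_pair "L1_functions M X" "L1_null M X" by (rule quotient_pair_L1)
  show ?thesis
    unfolding L1_space_def
  proof (rule L.normed_Q)
    fix v assume v: "v \<in> carrier (L1_functions M X)"
      and *: "\<And>e. e > 0 \<Longrightarrow> \<exists>n\<in>L1_null M X. vnorm (L1_functions M X) (v \<ominus>\<^bsub>L1_functions M X\<^esub> n) < e"
    have "vnorm (L1_functions M X) v \<le> 0"
    proof (rule field_le_epsilon)
      fix e :: real assume "e > 0"
      then obtain n where "n \<in> L1_null M X" "vnorm (L1_functions M X) (v \<ominus>\<^bsub>L1_functions M X\<^esub> n) < e"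
        using * by blast
      then show "vnorm (L1_functions M X) v \<le> 0 + e"
        using L.norm_le_add_diff[OF v, of n] by (auto simp: L1_null_iff)
    qed
    then show "v \<in> L1_null M X"
      using L.norm_nonneg[OF v] v by (simp add: L1_null_iff)
  qed
qed

end


section \<open>Bounded families and ultraproducts\<close>

lemma linf_simps:
  "carrier (linf_space E) = {x. (\<forall>i. x i \<in> carrier (E i)) \<and> bdd_above (range (\<lambda>i. vnorm (E i) (x i)))}"
  "\<zero>\<^bsub>linf_space E\<^esub> = (\<lambda>i. \<zero>\<^bsub>E i\<^esub>)"
  "x \<oplus>\<^bsub>linf_space E\<^esub> y = (\<lambda>i. x i \<oplus>\<^bsub>E i\<^esub> y i)"
  "c \<odot>\<^bsub>linf_space E\<^esub> x = (\<lambda>i. c \<odot>\<^bsub>E i\<^esub> x i)"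
  "vnorm (linf_space E) x = (SUP i. vnorm (E i) (x i))"
  by (auto simp: linf_space_def)

lemma linf_carrierI:
  assumes "\<And>i. x i \<in> carrier (E i)" "\<And>i. vnorm (E i) (x i) \<le> B"
  shows "x \<in> carrier (linf_space E)"
  using assms by (auto simp: linf_simps intro!: bdd_aboveI[of _ B])

lemma norm_linf_le: "(\<And>i. vnorm (E i) (x i) \<le> B) \<Longrightarrow> vnorm (linf_space E) x \<le> B"
  unfolding linf_simps by (rule cSUP_least) auto

lemma norm_le_norm_linf: "x \<in> carrier (linf_space E) \<Longrightarrow> vnorm (E i) (x i) \<le> vnorm (linf_space E) x"
  unfolding linf_simps by (rule cSUP_upper) auto

lemma seminormed_linf:
  assumes "\<And>i. seminormed_module (E i)"
  shows "seminormed_module (linf_space E)"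
proof (rule seminormed_moduleI)
  fix x y assume x: "x \<in> carrier (linf_space E)" and y: "y \<in> carrier (linf_space E)"
  have *: "x i \<oplus>\<^bsub>E i\<^esub> y i \<in> carrier (E i)"
    "vnorm (E i) (x i \<oplus>\<^bsub>E i\<^esub> y i) \<le> vnorm (linf_space E) x + vnorm (linf_space E) y" for i
  proof -
    interpret seminormed_module "E i" by fact
    have xy: "x i \<in> carrier (E i)" "y i \<in> carrier (E i)"
      using x y by (auto simp: linf_simps(1))
    show "x i \<oplus>\<^bsub>E i\<^esub> y i \<in> carrier (E i)"
      "vnorm (E i) (x i \<oplus>\<^bsub>E i\<^esub> y i) \<le> vnorm (linf_space E) x + vnorm (linf_space E) y"
      using norm_triangle[OF xy] norm_le_norm_linf[OF x, of i] norm_le_norm_linf[OF y, of i] xy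
      by (auto intro: order_trans[OF _ add_mono])
  qed
  show "x \<oplus>\<^bsub>linf_space E\<^esub> y \<in> carrier (linf_space E)"
    using * by (intro linf_carrierI[of _ _ "vnorm (linf_space E) x + vnorm (linf_space E) y"])
       (auto simp: linf_simps(3))
  show "vnorm (linf_space E) (x \<oplus>\<^bsub>linf_space E\<^esub> y) \<le> vnorm (linf_space E) x + vnorm (linf_space E) y"
    using * by (intro norm_linf_le) (simp add: linf_simps(3))
  have **: "vnorm (E i) (c \<odot>\<^bsub>E i\<^esub> x i) \<le> cmod c * vnorm (linf_space E) x" for i c
    using norm_le_norm_linf[OF x, of i] x
    by (simp add: linf_simps(1) seminormed_module.norm_smult[OF assms] mult_left_mono)
  show "c \<odot>\<^bsub>linf_space E\<^esub> x \<in> carrier (linf_space E)" for c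
    using x **[of _ c] seminormed_module.smult_carrier[OF assms]
    by (intro linf_carrierI) (auto simp: linf_simps(1,4))
  show "vnorm (linf_space E) (c \<odot>\<^bsub>linf_space E\<^esub> x) \<le> cmod c * vnorm (linf_space E) x" for c
    using ** by (intro norm_linf_le) (simp add: linf_simps(4))
  \<comment> \<open>The index type is not empty, so the supremum dominates some norm.\<close>
  show "0 \<le> vnorm (linf_space E) x"
    using norm_le_norm_linf[OF x, of undefined] seminormed_module.norm_nonneg[OF assms, of "x undefined" undefined] x
    by (simp add: linf_simps(1))
  show "x \<oplus>\<^bsub>linf_space E\<^esub> y = y \<oplus>\<^bsub>linf_space E\<^esub> x"
    unfolding linf_simps(3)
  proof
    fix i
    interpret seminormed_module "E i" by fact
    show "x i \<oplus>\<^bsub>E i\<^esub> y i = y i \<oplus>\<^bsub>E i\<^esub> x i" using x y by (simp add: linf_simps(1) a_comm)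
  qed
  show "c \<odot>\<^bsub>linf_space E\<^esub> (x \<oplus>\<^bsub>linf_space E\<^esub> y) = c \<odot>\<^bsub>linf_space E\<^esub> x \<oplus>\<^bsub>linf_space E\<^esub> c \<odot>\<^bsub>linf_space E\<^esub> y" for c
    using x y by (simp add: linf_simps seminormed_module.smult_add[OF assms])
  show "(x \<oplus>\<^bsub>linf_space E\<^esub> y) \<oplus>\<^bsub>linf_space E\<^esub> z = x \<oplus>\<^bsub>linf_space E\<^esub> (y \<oplus>\<^bsub>linf_space E\<^esub> z)"
    if z: "z \<in> carrier (linf_space E)" for z
    unfolding linf_simps(3)
  proof
    fix i
    interpret seminormed_module "E i" by fact
    show "x i \<oplus>\<^bsub>E i\<^esub> y i \<oplus>\<^bsub>E i\<^esub> z i = x i \<oplus>\<^bsub>E i\<^esub> (y i \<oplus>\<^bsub>E i\<^esub> z i)"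
      using x y z by (simp add: linf_simps(1) a_assoc)
  qed
  show "\<zero>\<^bsub>linf_space E\<^esub> \<oplus>\<^bsub>linf_space E\<^esub> x = x"
    unfolding linf_simps(2,3)
  proof
    fix i
    interpret seminormed_module "E i" by fact
    show "\<zero>\<^bsub>E i\<^esub> \<oplus>\<^bsub>E i\<^esub> x i = x i"
      using x by (simp add: linf_simps(1))
  qed
next
  have "\<zero>\<^bsub>E i\<^esub> \<in> carrier (E i)" "vnorm (E i) \<zero>\<^bsub>E i\<^esub> = 0" for i
  proof -
    interpret seminormed_module "E i" by fact
    show "\<zero>\<^bsub>E i\<^esub> \<in> carrier (E i)" "vnorm (E i) \<zero>\<^bsub>E i\<^esub> = 0" by auto
  qed
  then show "\<zero>\<^bsub>linf_space E\<^esub> \<in> carrier (linf_space E)"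
    by (intro linf_carrierI[of _ _ 0]) (auto simp: linf_simps(2))
qed (auto simp: linf_simps seminormed_module.add_smult[OF assms] seminormed_module.smult_smult[OF assms]
      seminormed_module.one_smult[OF assms] seminormed_module.zero_smult[OF assms])

lemma linf_eval:
  assumes "\<And>i. seminormed_module (E i)"
  shows "linear_pair (linf_space E) (E i) (\<lambda>x. x i)"
  by (intro linear_pair.intro linear_pair_axioms.intro seminormed_linf assms linear_onI)
     (auto simp: linf_simps)

lemma fast_complete_linf:
  assumes E: "\<And>i. complex_banach_space (E i)"
  shows "fast_complete (linf_space E)"
  unfolding fast_complete_def
proof (intro allI impI, elim conjE)
  have sn: "seminormed_module (E i)" for i
  proof -
    interpret complex_banach_space "E i" by fact
    show ?thesis by (rule seminormed_module_axioms)
  qed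
  interpret L: seminormed_module "linf_space E" by (rule seminormed_linf[OF sn])
  fix s assume s: "\<forall>n. s n \<in> carrier (linf_space E)"
    and step: "\<forall>n. vnorm (linf_space E) (s (Suc n) \<ominus>\<^bsub>linf_space E\<^esub> s n) \<le> (1/2) ^ n"
  have "\<exists>l\<in>carrier (E i). \<forall>m. vnorm (E i) (s m i \<ominus>\<^bsub>E i\<^esub> l) \<le> 2 * (1/2) ^ m" for i
  proof -
    interpret complex_banach_space "E i" by fact
    interpret ev: linear_pair "linf_space E" "E i" "\<lambda>x. x i" by (rule linf_eval[OF sn])
    have si: "s n i \<in> carrier (E i)" for n using s by auto
    have st: "vnorm (E i) (s (Suc n) i \<ominus>\<^bsub>E i\<^esub> s n i) \<le> (1/2) ^ n" for n
      using norm_le_norm_linf[of "s (Suc n) \<ominus>\<^bsub>linf_space E\<^esub> s n" E i] step[rule_format, of n] s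
        ev.hom_diff[of "s (Suc n)" "s n"] by simp
    have sm: "summable (\<lambda>n. (1/2::real) ^ n)" by simp
    obtain l where l: "l \<in> carrier (E i)" "(\<lambda>n. vnorm (E i) (s n i \<ominus>\<^bsub>E i\<^esub> l)) \<longlonglongrightarrow> 0"
      using convergent_of_summable_steps(1)[of "\<lambda>n. s n i", OF si st sm] by blast
    have "vnorm (E i) (s m i \<ominus>\<^bsub>E i\<^esub> l) \<le> (\<Sum>k. (1/2) ^ (k + m))" for m
      by (rule convergent_of_summable_steps(2)[of "\<lambda>n. s n i", OF si st sm l])
    moreover have "(\<Sum>k. (1/2::real) ^ (k + m)) = 2 * (1/2) ^ m" for m
      using suminf_mult[of "\<lambda>k. (1/2::real)^k" "(1/2) ^ m"] suminf_geometric[of "1/2::real"]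
      by (simp add: power_add ac_simps summable_geometric)
    ultimately show ?thesis using l(1) by auto
  qed
  then obtain l where l: "\<And>i. l i \<in> carrier (E i)"
    "\<And>i m. vnorm (E i) (s m i \<ominus>\<^bsub>E i\<^esub> l i) \<le> 2 * (1/2) ^ m" by metis
  have lL: "l \<in> carrier (linf_space E)"
  proof (rule linf_carrierI[OF l(1)])
    fix i
    interpret seminormed_module "E i" by (rule sn)
    have si: "s 0 i \<in> carrier (E i)" using s by (auto simp: linf_simps(1))
    have "vnorm (E i) (l i) \<le> vnorm (E i) (s 0 i) + 2"
      using norm_le_add_diff[OF l(1) si] norm_diff_commute[OF l(1) si] l(2)[of i 0] by simp
    also have "vnorm (E i) (s 0 i) \<le> vnorm (linf_space E) (s 0)"
      by (rule norm_le_norm_linf) (use s in simp)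
    finally show "vnorm (E i) (l i) \<le> vnorm (linf_space E) (s 0) + 2" by simp
  qed
  have "vnorm (linf_space E) (s m \<ominus>\<^bsub>linf_space E\<^esub> l) \<le> 2 * (1/2) ^ m" for m
  proof (rule norm_linf_le)
    fix i
    interpret ev: linear_pair "linf_space E" "E i" "\<lambda>x. x i" by (rule linf_eval[OF sn])
    show "vnorm (E i) ((s m \<ominus>\<^bsub>linf_space E\<^esub> l) i) \<le> 2 * (1/2) ^ m"
      using ev.hom_diff[of "s m" l] s lL l(2)[of i m] by simp
  qed
  moreover have "(\<lambda>m. 2 * (1/2::real) ^ m) \<longlonglongrightarrow> 0"
    by (intro tendsto_mult_right_zero LIMSEQ_power_zero) simp
  ultimately have "(\<lambda>m. vnorm (linf_space E) (s m \<ominus>\<^bsub>linf_space E\<^esub> l)) \<longlonglongrightarrow> 0"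
    using s lL by (elim Lim_null_comparison[rotated]) (simp add: L.norm_nonneg)
  then show "\<exists>l\<in>carrier (linf_space E). (\<lambda>n. vnorm (linf_space E) (s n \<ominus>\<^bsub>linf_space E\<^esub> l)) \<longlonglongrightarrow> 0"
    using lL by blast
qed

text \<open>The families that are divided out in the ultraproduct.\<close>

definition linf_null :: "'i filter \<Rightarrow> ('i \<Rightarrow> 'a nspace) \<Rightarrow> ('i \<Rightarrow> 'a) set" where
  "linf_null U E = {x \<in> carrier (linf_space E). ((\<lambda>i. vnorm (E i) (x i)) \<longlongrightarrow> 0) U}"

lemma linf_nullD:
  assumes "x \<in> linf_null U E"
  shows "x \<in> carrier (linf_space E)" "0 < e \<Longrightarrow> eventually (\<lambda>i. vnorm (E i) (x i) < e) U"
  using assms order_tendstoD(2)[of "\<lambda>i. vnorm (E i) (x i)" 0 U e] by (auto simp: linf_null_def)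

lemma linf_nullI:
  "x \<in> carrier (linf_space E) \<Longrightarrow> ((\<lambda>i. vnorm (E i) (x i)) \<longlongrightarrow> 0) U \<Longrightarrow> x \<in> linf_null U E"
  by (simp add: linf_null_def)

lemma ultraproduct_eq: "ultraproduct U E = quotient_space (linf_space E) (linf_null U E)"
  by (simp add: ultraproduct_def linf_null_def)

text \<open>
  A family of Banach spaces with a filter, which is assumed to be an ultrafilter only where this
  is needed; \<open>cls\<close> is the class of a bounded family.
\<close>

locale ultraproduct_family =
  fixes E :: "'i \<Rightarrow> 'a nspace" and U :: "'i filter"
  assumes banach: "\<And>i. complex_banach_space (E i)"
begin

lemma semi: "seminormed_module (E i)"
proof -
  interpret complex_banach_space "E i" by (rule banach)
  show ?thesis by (rule seminormed_module_axioms)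
qed

lemma norm_nonneg_i: "x \<in> carrier (linf_space E) \<Longrightarrow> 0 \<le> vnorm (E i) (x i)"
  by (rule seminormed_module.norm_nonneg[OF semi]) (simp add: linf_simps(1))

lemma quotient_pair: "quotient_pair (linf_space E) (linf_null U E)"
proof -
  interpret L: seminormed_module "linf_space E" by (rule seminormed_linf[OF semi])
  have "submodule (linf_null U E) complex_ring (linf_space E)"
  proof (rule L.submoduleI)
    show add: "a \<oplus>\<^bsub>linf_space E\<^esub> b \<in> linf_null U E" if "a \<in> linf_null U E" "b \<in> linf_null U E" for a b
    proof -
      have ab: "a \<in> carrier (linf_space E)" "b \<in> carrier (linf_space E)"
        "((\<lambda>i. vnorm (E i) (a i)) \<longlongrightarrow> 0) U" "((\<lambda>i. vnorm (E i) (b i)) \<longlongrightarrow> 0) U"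
        using that by (auto simp: linf_null_def)
      have cl: "a \<oplus>\<^bsub>linf_space E\<^esub> b \<in> carrier (linf_space E)" using ab by simp
      have "vnorm (E i) (a i \<oplus>\<^bsub>E i\<^esub> b i) \<le> vnorm (E i) (a i) + vnorm (E i) (b i)" for i
        using ab by (intro seminormed_module.norm_triangle[OF semi]) (auto simp: linf_simps(1))
      then have "((\<lambda>i. vnorm (E i) ((a \<oplus>\<^bsub>linf_space E\<^esub> b) i)) \<longlongrightarrow> 0) U"
        using tendsto_add[OF ab(3,4), unfolded add_0_left] norm_nonneg_i[OF cl]
        by (elim Lim_null_comparison[rotated]) (simp_all add: linf_simps(3))
      then show ?thesis using ab by (simp add: linf_null_def)
    qed
    show smult: "c \<odot>\<^bsub>linf_space E\<^esub> a \<in> linf_null U E" if "a \<in> linf_null U E" for c a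
    proof -
      have a: "a \<in> carrier (linf_space E)" "((\<lambda>i. vnorm (E i) (a i)) \<longlongrightarrow> 0) U"
        using that by (auto simp: linf_null_def)
      have "vnorm (E i) ((c \<odot>\<^bsub>linf_space E\<^esub> a) i) = cmod c * vnorm (E i) (a i)" for i
        using a(1) by (simp add: linf_simps(1,4) seminormed_module.norm_smult[OF semi])
      then show ?thesis
        using a tendsto_mult_right_zero[OF a(2), of "cmod c"] by (simp add: linf_null_def)
    qed
    show "\<ominus>\<^bsub>linf_space E\<^esub> a \<in> linf_null U E" if "a \<in> linf_null U E" for a
      using smult[OF that, of "- 1"] that L.minus_smult[of a 1] by (simp add: linf_null_def)
    show "\<zero>\<^bsub>linf_space E\<^esub> \<in> linf_null U E"
      unfolding linf_null_def using L.zero_closed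
      by (simp add: linf_simps(2) seminormed_module.norm_zero[OF semi])
  qed (auto simp: linf_null_def)
  then show ?thesis
    by (intro quotient_pair.intro quotient_pair_axioms.intro L.seminormed_module_axioms)
qed

abbreviation cls where "cls x \<equiv> linf_null U E +>\<^bsub>linf_space E\<^esub> x"

lemma diff_app: "x \<in> carrier (linf_space E) \<Longrightarrow> y \<in> carrier (linf_space E) \<Longrightarrow>
  (x \<ominus>\<^bsub>linf_space E\<^esub> y) i = x i \<ominus>\<^bsub>E i\<^esub> y i"
proof -
  interpret ev: linear_pair "linf_space E" "E i" "\<lambda>x. x i" by (rule linf_eval[OF semi])
  show "x \<in> carrier (linf_space E) \<Longrightarrow> y \<in> carrier (linf_space E) \<Longrightarrow> ?thesis" by (rule ev.hom_diff)
qed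

lemma eventually_norm_less:
  assumes x: "x \<in> carrier (linf_space E)" and less: "vnorm (ultraproduct U E) (cls x) < a"
  shows "eventually (\<lambda>i. vnorm (E i) (x i) < a) U"
proof -
  interpret L: quotient_pair "linf_space E" "linf_null U E" by (rule quotient_pair)
  obtain y where y: "y \<in> cls x" "vnorm (linf_space E) y < a"
    using L.norm_q_lessD[OF x] less by (auto simp: ultraproduct_eq)
  have yL: "y \<in> carrier (linf_space E)" and n: "y \<ominus>\<^bsub>linf_space E\<^esub> x \<in> linf_null U E"
    using y(1) x by (auto simp: L.mem_q_iff_diff)
  have "eventually (\<lambda>i. vnorm (E i) ((y \<ominus>\<^bsub>linf_space E\<^esub> x) i) < a - vnorm (linf_space E) y) U"
    using y(2) by (intro linf_nullD(2)[OF n]) simp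
  then show ?thesis
  proof eventually_elim
    case (elim i)
    interpret seminormed_module "E i" by (rule semi)
    have "x i \<in> carrier (E i)" "y i \<in> carrier (E i)" using x yL by (auto simp: linf_simps(1))
    then show ?case
      using elim norm_le_add_diff[of "x i" "y i"] norm_diff_commute[of "x i" "y i"]
        norm_le_norm_linf[OF yL, of i] by (simp add: diff_app x yL)
  qed
qed

text \<open>The members of the family that violate the bound can be replaced by zero.\<close>

lemma norm_cls_le:
  assumes x: "x \<in> carrier (linf_space E)" and ev: "eventually (\<lambda>i. vnorm (E i) (x i) \<le> a) U" and "0 \<le> a"
  shows "vnorm (ultraproduct U E) (cls x) \<le> a"
proof -
  interpret L: quotient_pair "linf_space E" "linf_null U E" by (rule quotient_pair)
  define y where "y i = (if vnorm (E i) (x i) \<le> a then x i else \<zero>\<^bsub>E i\<^esub>)" for i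
  have y: "y i \<in> carrier (E i)" "vnorm (E i) (y i) \<le> a" for i
  proof -
    interpret seminormed_module "E i" by (rule semi)
    show "y i \<in> carrier (E i)" "vnorm (E i) (y i) \<le> a"
      using x \<open>0 \<le> a\<close> by (auto simp: y_def linf_simps(1))
  qed
  have yL: "y \<in> carrier (linf_space E)" by (rule linf_carrierI[OF y])
  have "eventually (\<lambda>i. vnorm (E i) ((y \<ominus>\<^bsub>linf_space E\<^esub> x) i) = 0) U"
    using ev
  proof eventually_elim
    case (elim i)
    interpret seminormed_module "E i" by (rule semi)
    have "x i \<in> carrier (E i)" using x by (auto simp: linf_simps(1))
    then show ?case using elim by (simp add: diff_app x yL) (simp add: y_def)
  qed
  then have "y \<ominus>\<^bsub>linf_space E\<^esub> x \<in> linf_null U E"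
    using L.minus_closed[OF yL x] by (intro linf_nullI tendsto_eventually)
  then have "y \<in> cls x" using x yL by (simp add: L.mem_q_iff_diff)
  then have "vnorm (ultraproduct U E) (cls x) \<le> vnorm (linf_space E) y"
    unfolding ultraproduct_eq by (rule L.norm_q_le[OF x])
  also have "\<dots> \<le> a" by (rule norm_linf_le[OF y(2)])
  finally show ?thesis .
qed

lemma banach_ultraproduct: "complex_banach_space (ultraproduct U E)"
proof -
  interpret L: quotient_pair "linf_space E" "linf_null U E" by (rule quotient_pair)
  interpret N: complex_normed_space "ultraproduct U E"
    unfolding ultraproduct_eq
  proof (rule L.normed_Q)
    fix v assume v: "v \<in> carrier (linf_space E)"
      and *: "\<And>e. e > 0 \<Longrightarrow> \<exists>n\<in>linf_null U E. vnorm (linf_space E) (v \<ominus>\<^bsub>linf_space E\<^esub> n) < e"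
    have "((\<lambda>i. vnorm (E i) (v i)) \<longlongrightarrow> 0) U"
    proof (rule order_tendstoI)
      fix e :: real assume "e > 0"
      then obtain n where n: "n \<in> linf_null U E" "vnorm (linf_space E) (v \<ominus>\<^bsub>linf_space E\<^esub> n) < e"
        using * by blast
      have nL: "n \<in> carrier (linf_space E)" using n(1) by (rule linf_nullD(1))
      have "eventually (\<lambda>i. vnorm (E i) (n i) < e - vnorm (linf_space E) (v \<ominus>\<^bsub>linf_space E\<^esub> n)) U"
        using n(2) by (intro linf_nullD(2)[OF n(1)]) simp
      then show "eventually (\<lambda>i. vnorm (E i) (v i) < e) U"
      proof eventually_elim
        case (elim i)
        interpret seminormed_module "E i" by (rule semi)
        have "v i \<in> carrier (E i)" "n i \<in> carrier (E i)" using v nL by (auto simp: linf_simps(1))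
        then show ?case
          using elim norm_le_add_diff[of "v i" "n i"]
            norm_le_norm_linf[OF L.minus_closed[OF v nL], of i] by (simp add: diff_app v nL)
      qed
    next
      fix e :: real assume "e < 0"
      then show "eventually (\<lambda>i. e < vnorm (E i) (v i)) U"
        using norm_nonneg_i[OF v] by (intro always_eventually allI) (meson less_le_trans)
    qed
    with v show "v \<in> linf_null U E" by (rule linf_nullI)
  qed
  have "fast_complete (ultraproduct U E)"
    unfolding ultraproduct_eq by (rule L.fast_complete_Q[OF fast_complete_linf[OF banach]])
  then show ?thesis
    by (intro complex_banach_space.intro complex_banach_space_axioms.intro N.complex_normed_space_axioms
        N.fast_complete_imp_mcomplete)
qed

end


section \<open>Fourier coefficients and Fejer means on the circle\<close>

lemma cis_measurable:
  "cis \<in> uniform_measure lborel {0..2 * pi} \<rightarrow>\<^sub>M restrict_space borel (sphere 0 1)"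
proof (rule measurable_restrict_space2)
  have "continuous_on UNIV cis"
    unfolding cis_conv_exp by (intro continuous_intros)
  then show "cis \<in> uniform_measure lborel {0..2 * pi} \<rightarrow>\<^sub>M borel"
    using borel_measurable_continuous_onI[of cis] by (simp add: measurable_def)
qed simp

lemma space_circle [simp]: "space circle_measure = sphere 0 1"
  by (simp add: circle_measure_def space_restrict_space)

lemma sets_circle: "sets circle_measure = sets (restrict_space borel (sphere 0 1))"
  by (simp add: circle_measure_def)

lemma finite_measure_circle: "finite_measure circle_measure"
  by (rule finite_measureI) (simp add: emeasure_circle_measure)

lemma measure_circle [simp]: "measure circle_measure (sphere 0 1) = 1"
  by (simp add: measure_def emeasure_circle_measure)

lemma borel_measurable_circle:
  "f \<in> borel_measurable borel \<Longrightarrow> f \<in> borel_measurable circle_measure"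
  unfolding measurable_cong_sets[OF sets_circle refl] by (rule measurable_restrict_space1)

lemma integrable_circle:
  fixes f :: "complex \<Rightarrow> 'b::{banach, second_countable_topology}"
  assumes "f \<in> borel_measurable circle_measure" "\<And>z. cmod z = 1 \<Longrightarrow> norm (f z) \<le> B"
  shows "integrable circle_measure f"
proof -
  interpret finite_measure circle_measure by (rule finite_measure_circle)
  show ?thesis
    by (rule integrable_const_bound[where B = B]) (use assms in \<open>auto intro!: AE_I2\<close>)
qed

lemma cnj_circle: "cmod z = 1 \<Longrightarrow> z * cnj z = 1"
  by (metis complex_norm_square norm_one of_real_1 one_power2 power2_eq_square)

lemma circle_power_diff: "cmod z = 1 \<Longrightarrow> k \<le> j \<Longrightarrow> z ^ j * cnj z ^ k = z ^ (j - k)"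
proof -
  assume z: "cmod z = 1" and "k \<le> j"
  then have "z ^ j * cnj z ^ k = z ^ (j - k) * (z * cnj z) ^ k"
    by (simp add: power_mult_distrib power_add[symmetric] mult.assoc[symmetric])
  then show ?thesis using z by (simp add: cnj_circle)
qed

lemma circle_power_diff': "cmod z = 1 \<Longrightarrow> k \<le> j \<Longrightarrow> cnj z ^ j * z ^ k = cnj z ^ (j - k)"
  using circle_power_diff[of "cnj z" k j] by (simp add: complex_cnj_cnj)

lemma integral_circle_power:
  "(\<integral>z. z ^ n \<partial>circle_measure) = (if n = 0 then 1 else 0)"
proof (cases "n = 0")
  case False
  have dens: "uniform_measure lborel {0..2 * pi} =
      density lborel (\<lambda>x. ennreal (indicator {0..2 * pi} x / (2 * pi)))"
    unfolding uniform_measure_def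
    by (intro arg_cong2[where f = density] ext refl)
       (auto simp: indicator_def divide_ennreal[symmetric] ennreal_mult'')
  have "(\<integral>z. z ^ n \<partial>circle_measure) = (\<integral>\<theta>. cis \<theta> ^ n \<partial>uniform_measure lborel {0..2 * pi})"
    unfolding circle_measure_def
    by (rule integral_distr[OF cis_measurable]) (auto intro!: measurable_restrict_space1)
  also have "\<dots> = (\<integral>\<theta>. (indicator {0..2 * pi} \<theta> / (2 * pi)) *\<^sub>R cis \<theta> ^ n \<partial>lborel)"
    unfolding dens
    by (rule integral_density)
       (auto simp: cis_conv_exp intro!: borel_measurable_continuous_onI continuous_intros)
  also have "\<dots> = (\<integral>\<theta>. indicator {0..2 * pi} \<theta> *\<^sub>R (cis (real n * \<theta>) / (2 * pi)) \<partial>lborel)"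
    unfolding Complex.DeMoivre
    by (intro Bochner_Integration.integral_cong)
       (simp_all add: scaleR_conv_of_real indicator_def)
  also have "\<dots> = cis (real n * (2 * pi)) / (2 * pi * \<i> * n) - cis (real n * 0) / (2 * pi * \<i> * n)"
  proof (rule integral_FTC_Icc)
    fix x :: real
    have "((\<lambda>w. exp (\<i> * (of_nat n * w)) / (2 * pi * \<i> * n)) has_field_derivative
        exp (\<i> * (of_nat n * of_real x)) / (2 * pi)) (at (of_real x))"
      using False by (auto intro!: derivative_eq_intros)
    from has_vector_derivative_real_field[OF this]
    show "((\<lambda>x. cis (real n * x) / (2 * pi * \<i> * n)) has_vector_derivative
        cis (real n * x) / (2 * pi)) (at x within {0..2 * pi})"
      by (simp add: cis_conv_exp)
  next
    show "continuous_on {0..2 * pi} (\<lambda>x. cis (real n * x) / complex_of_real (2 * pi))"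
      unfolding cis_conv_exp by (intro continuous_intros) auto
  qed simp
  also have "cis (real n * (2 * pi)) = 1"
    using cis_multiple_2pi[of "real n"] by (simp add: mult.commute)
  finally show ?thesis using False by simp
qed simp

lemma integral_circle_power_cnj:
  "(\<integral>z. z ^ j * cnj z ^ k \<partial>circle_measure) = (if j = k then 1 else 0)"
proof (cases "k \<le> j")
  case True
  then have "(\<integral>z. z ^ j * cnj z ^ k \<partial>circle_measure) = (\<integral>z. z ^ (j - k) \<partial>circle_measure)"
    by (intro Bochner_Integration.integral_cong) (auto simp: circle_power_diff)
  then show ?thesis using True by (simp add: integral_circle_power)
next
  case False
  then have "(\<integral>z. z ^ j * cnj z ^ k \<partial>circle_measure) = (\<integral>z. cnj (z ^ (k - j)) \<partial>circle_measure)"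
    by (intro Bochner_Integration.integral_cong)
       (auto simp: circle_power_diff' mult.commute[of "_ ^ j"])
  also have "\<dots> = cnj (\<integral>z. z ^ (k - j) \<partial>circle_measure)"
  proof (rule integral_bounded_linear[OF bounded_linear_cnj])
    show "integrable circle_measure (\<lambda>z. z ^ (k - j))"
      by (rule integrable_circle[where B = 1])
         (auto simp: norm_power
           intro!: borel_measurable_circle borel_measurable_continuous_onI continuous_intros)
  qed
  finally show ?thesis using False by (simp add: integral_circle_power)
qed

text \<open>
  The Fourier coefficient of index \<open>j - k\<close>. Two natural indices cover negative coefficients as
  well, and they match the terms of the Fejer kernel.
\<close>

definition fourier :: "nat \<Rightarrow> nat \<Rightarrow> (complex \<Rightarrow> complex) \<Rightarrow> complex" where
  "fourier j k f = (\<integral>w. f w * (cnj w ^ j * w ^ k) \<partial>circle_measure)"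

lemma integrable_mult_character:
  fixes f :: "complex \<Rightarrow> complex"
  assumes "integrable circle_measure f"
  shows "integrable circle_measure (\<lambda>w. f w * (cnj w ^ j * w ^ k))"
proof (rule Bochner_Integration.integrable_bound[OF assms])
  have [measurable]: "(\<lambda>w. cnj w ^ j * w ^ k) \<in> borel_measurable circle_measure"
    by (intro borel_measurable_circle borel_measurable_continuous_onI continuous_intros)
  show "(\<lambda>w. f w * (cnj w ^ j * w ^ k)) \<in> borel_measurable circle_measure"
    using assms by measurable
  show "AE w in circle_measure. norm (f w * (cnj w ^ j * w ^ k)) \<le> norm (f w)"
    by (rule AE_I2) (simp add: norm_mult norm_power)
qed

lemma norm_fourier_le:
  assumes "integrable circle_measure f"
  shows "cmod (fourier j k f) \<le> (\<integral>w. cmod (f w) \<partial>circle_measure)"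
proof -
  have "cmod (fourier j k f) \<le> (\<integral>w. cmod (f w * (cnj w ^ j * w ^ k)) \<partial>circle_measure)"
    unfolding fourier_def by (rule integral_norm_bound)
  also have "\<dots> = (\<integral>w. cmod (f w) \<partial>circle_measure)"
    by (intro Bochner_Integration.integral_cong) (auto simp: norm_mult norm_power)
  finally show ?thesis .
qed

lemma fourier_poly:
  "fourier j k (\<lambda>w. \<Sum>d\<le>n. a d * w ^ d) = (\<Sum>d\<le>n. if d + k = j then a d else 0)"
proof -
  have "fourier j k (\<lambda>w. \<Sum>d\<le>n. a d * w ^ d) =
      (\<integral>w. (\<Sum>d\<le>n. a d * (w ^ (d + k) * cnj w ^ j)) \<partial>circle_measure)"
    unfolding fourier_def
    by (intro Bochner_Integration.integral_cong) (simp_all add: sum_distrib_right sum_distrib_left power_add mult_ac)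
  also have "\<dots> = (\<Sum>d\<le>n. \<integral>w. a d * (w ^ (d + k) * cnj w ^ j) \<partial>circle_measure)"
  proof (rule Bochner_Integration.integral_sum)
    fix d
    show "integrable circle_measure (\<lambda>w. a d * (w ^ (d + k) * cnj w ^ j))"
      by (rule integrable_circle[where B = "cmod (a d)"])
         (auto simp: norm_mult norm_power
           intro!: borel_measurable_circle borel_measurable_continuous_onI continuous_intros)
  qed
  also have "\<dots> = (\<Sum>d\<le>n. if d + k = j then a d else 0)"
    by (intro sum.cong refl) (simp add: integral_circle_power_cnj)
  finally show ?thesis .
qed

text \<open>
  Up to the factor \<open>N + 1\<close>, this is the Fejer kernel of order \<open>N\<close> at \<open>z / w\<close>. The square shows that
  it is nonnegative, and the double sum separates the variables, so that the interchange of
  integrals below is an interchange of an integral with a finite sum.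
\<close>

lemma fejer_kernel:
  "(\<Sum>j\<le>N. \<Sum>k\<le>N. (z ^ j * cnj z ^ k) * (cnj w ^ j * w ^ k)) = of_real ((cmod (\<Sum>j\<le>N. (z * cnj w) ^ j))\<^sup>2)"
proof -
  have "of_real ((cmod (\<Sum>j\<le>N. (z * cnj w) ^ j))\<^sup>2)
      = (\<Sum>j\<le>N. (z * cnj w) ^ j) * (\<Sum>k\<le>N. (cnj z * w) ^ k)"
    unfolding complex_norm_square by simp
  also have "\<dots> = (\<Sum>j\<le>N. \<Sum>k\<le>N. (z ^ j * cnj z ^ k) * (cnj w ^ j * w ^ k))"
    unfolding sum_product by (intro sum.cong refl) (simp add: power_mult_distrib mult_ac)
  finally show ?thesis by (rule sym)
qed

lemma fejer_integral:
  fixes f :: "complex \<Rightarrow> complex"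
  assumes f: "integrable circle_measure f"
  shows "(\<Sum>j\<le>N. \<Sum>k\<le>N. (z ^ j * cnj z ^ k) * fourier j k f)
       = (\<integral>w. f w * of_real ((cmod (\<Sum>j\<le>N. (z * cnj w) ^ j))\<^sup>2) \<partial>circle_measure)"
proof -
  have "(\<Sum>j\<le>N. \<Sum>k\<le>N. (z ^ j * cnj z ^ k) * fourier j k f)
      = (\<Sum>j\<le>N. \<Sum>k\<le>N. \<integral>w. (z ^ j * cnj z ^ k) * (f w * (cnj w ^ j * w ^ k)) \<partial>circle_measure)"
    by (simp add: fourier_def)
  also have "\<dots> = (\<integral>w. (\<Sum>j\<le>N. \<Sum>k\<le>N. (z ^ j * cnj z ^ k) * (f w * (cnj w ^ j * w ^ k))) \<partial>circle_measure)"
    using integrable_mult_character[OF f]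
    by (subst Bochner_Integration.integral_sum, simp)
       (intro sum.cong refl Bochner_Integration.integral_sum[symmetric], simp)
  also have "\<dots> = (\<integral>w. f w * of_real ((cmod (\<Sum>j\<le>N. (z * cnj w) ^ j))\<^sup>2) \<partial>circle_measure)"
    unfolding fejer_kernel[symmetric]
    by (intro Bochner_Integration.integral_cong) (simp_all add: sum_distrib_left mult_ac)
  finally show ?thesis .
qed

text \<open>
  By positivity of the kernel, the left-hand integrand is at most the same expression for \<open>\<bar>f\<bar>\<close>, whose
  integral involves only the diagonal terms \<open>j = k\<close>.
\<close>

lemma fejer_bound_aux:
  fixes f :: "complex \<Rightarrow> complex"
  assumes f: "integrable circle_measure f"
  shows "(\<integral>z. cmod (\<Sum>j\<le>N. \<Sum>k\<le>N. (z ^ j * cnj z ^ k) * fourier j k f) \<partial>circle_measure)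
       \<le> real (N + 1) * (\<integral>w. cmod (f w) \<partial>circle_measure)"
proof -
  let ?g = "\<lambda>w. of_real (cmod (f w)) :: complex"
  let ?S = "\<lambda>f z. \<Sum>j\<le>N. \<Sum>k\<le>N. (z ^ j * cnj z ^ k) * fourier j k f"
  have g: "integrable circle_measure ?g" using f by simp
  have K: "integrable circle_measure (\<lambda>w. h w * of_real ((cmod (\<Sum>j\<le>N. (z * cnj w) ^ j))\<^sup>2))"
    if h: "integrable circle_measure h" for h :: "complex \<Rightarrow> complex" and z
    unfolding fejer_kernel[symmetric] sum_distrib_left
  proof (intro Bochner_Integration.integrable_sum)
    fix j k
    show "integrable circle_measure (\<lambda>w. h w * (z ^ j * cnj z ^ k * (cnj w ^ j * w ^ k)))"
      using integrable_mult_right[OF integrable_mult_character[OF h, of j k], of "z ^ j * cnj z ^ k"]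
      by (simp add: mult_ac)
  qed
  have le: "cmod (?S f z) \<le> Re (?S ?g z)" for z
  proof -
    have "cmod (?S f z) \<le> (\<integral>w. cmod (f w * of_real ((cmod (\<Sum>j\<le>N. (z * cnj w) ^ j))\<^sup>2)) \<partial>circle_measure)"
      unfolding fejer_integral[OF f] by (rule integral_norm_bound)
    also have "\<dots> = (\<integral>w. Re (?g w * of_real ((cmod (\<Sum>j\<le>N. (z * cnj w) ^ j))\<^sup>2)) \<partial>circle_measure)"
      by (intro Bochner_Integration.integral_cong) (simp_all add: norm_mult norm_power)
    also have "\<dots> = Re (?S ?g z)"
      unfolding fejer_integral[OF g] by (rule integral_Re[OF K[OF g]])
    finally show ?thesis .
  qed
  have int: "integrable circle_measure (\<lambda>z. ?S h z)" for h
    by (intro Bochner_Integration.integrable_sum integrable_mult_left integrable_circle[where B = 1])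
       (auto simp: norm_mult norm_power
           intro!: borel_measurable_circle borel_measurable_continuous_onI continuous_intros)
  have "(\<integral>z. cmod (?S f z) \<partial>circle_measure) \<le> (\<integral>z. Re (?S ?g z) \<partial>circle_measure)"
    using int by (intro integral_mono le integrable_norm integrable_Re) auto
  also have "\<dots> = Re (\<integral>z. ?S ?g z \<partial>circle_measure)" by (rule integral_Re[OF int])
  also have "(\<integral>z. ?S ?g z \<partial>circle_measure)
      = (\<Sum>j\<le>N. \<Sum>k\<le>N. \<integral>z. (z ^ j * cnj z ^ k) * fourier j k ?g \<partial>circle_measure)"
  proof -
    have i: "integrable circle_measure (\<lambda>z. (z ^ j * cnj z ^ k) * fourier j k ?g)" for j k
      by (intro integrable_mult_left integrable_circle[where B = 1])
         (auto simp: norm_mult norm_power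
           intro!: borel_measurable_circle borel_measurable_continuous_onI continuous_intros)
    show ?thesis
      using i by (subst Bochner_Integration.integral_sum, simp)
         (intro sum.cong refl Bochner_Integration.integral_sum, simp)
  qed
  also have "\<dots> = (\<Sum>j\<le>N. \<Sum>k\<le>N. if j = k then fourier j k ?g else 0)"
    by (intro sum.cong refl) (simp add: integral_circle_power_cnj)
  also have "\<dots> = (\<Sum>j\<le>N. fourier j j ?g)"
    by (simp add: sum.delta)
  also have "\<dots> = (\<Sum>j\<le>N. of_real (\<integral>w. cmod (f w) \<partial>circle_measure))"
  proof (rule sum.cong[OF refl])
    fix j
    have "fourier j j ?g = (\<integral>w. ?g w \<partial>circle_measure)"
      unfolding fourier_def
      by (intro Bochner_Integration.integral_cong) (auto simp: circle_power_diff')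
    then show "fourier j j ?g = of_real (\<integral>w. cmod (f w) \<partial>circle_measure)" by simp
  qed
  finally show ?thesis by simp
qed

text \<open>
  The Fejer means contract the \<open>L\<^sup>1\<close> norm. They are stated for functions without negative Fourier
  coefficients, for which they are analytic polynomials.
\<close>

lemma fejer_bound:
  fixes f :: "complex \<Rightarrow> complex"
  assumes f: "integrable circle_measure f" and neg: "\<And>d. d > 0 \<Longrightarrow> fourier 0 d f = 0"
  shows "(\<integral>z. cmod (\<Sum>d\<le>N. of_real (1 - real d / real (N + 1)) * fourier d 0 f * z ^ d) \<partial>circle_measure)
       \<le> (\<integral>w. cmod (f w) \<partial>circle_measure)"
proof -
  have coef: "fourier j k f = fourier (j - k) 0 f" if "k \<le> j" for j k
    using that unfolding fourier_def
    by (intro Bochner_Integration.integral_cong) (auto simp: circle_power_diff')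
  have coef0: "fourier j k f = 0" if "j < k" for j k
  proof -
    have "fourier j k f = fourier 0 (k - j) f"
      using that unfolding fourier_def
      by (intro Bochner_Integration.integral_cong) (auto simp: circle_power_diff mult.commute[of "cnj _ ^ j"])
    then show ?thesis using neg that by simp
  qed
  have eq: "(\<Sum>j\<le>N. \<Sum>k\<le>N. (z ^ j * cnj z ^ k) * fourier j k f)
      = of_real (real (N + 1)) * (\<Sum>d\<le>N. of_real (1 - real d / real (N + 1)) * fourier d 0 f * z ^ d)"
    if z: "cmod z = 1" for z
  proof -
    have "(\<Sum>j\<le>N. \<Sum>k\<le>N. (z ^ j * cnj z ^ k) * fourier j k f)
        = (\<Sum>j\<le>N. \<Sum>k\<le>j. z ^ (j - k) * fourier (j - k) 0 f)"
    proof (rule sum.cong[OF refl])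
      fix j assume "j \<in> {..N}"
      then have "(\<Sum>k\<le>N. (z ^ j * cnj z ^ k) * fourier j k f)
          = (\<Sum>k\<in>{..j}. (z ^ j * cnj z ^ k) * fourier j k f)"
        by (intro sum.mono_neutral_right) (auto simp: coef0)
      also have "\<dots> = (\<Sum>k\<le>j. z ^ (j - k) * fourier (j - k) 0 f)"
      proof (rule sum.cong[OF refl])
        fix k assume "k \<in> {..j}"
        then show "(z ^ j * cnj z ^ k) * fourier j k f = z ^ (j - k) * fourier (j - k) 0 f"
          using coef[of k j] circle_power_diff[OF z, of k j] by simp
      qed
      finally show "(\<Sum>k\<le>N. (z ^ j * cnj z ^ k) * fourier j k f)
          = (\<Sum>k\<le>j. z ^ (j - k) * fourier (j - k) 0 f)" .
    qed
    also have "\<dots> = (\<Sum>j\<le>N. \<Sum>d\<le>j. z ^ d * fourier d 0 f)"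
    proof (rule sum.cong[OF refl])
      fix j
      show "(\<Sum>k\<le>j. z ^ (j - k) * fourier (j - k) 0 f) = (\<Sum>d\<le>j. z ^ d * fourier d 0 f)"
        by (rule sum.reindex_bij_witness[of _ "\<lambda>k. j - k" "\<lambda>k. j - k"]) auto
    qed
    also have "\<dots> = (\<Sum>d\<le>N. of_nat (N + 1 - d) * (z ^ d * fourier d 0 f))"
      by (induction N) (simp_all add: sum.distrib[symmetric] algebra_simps Suc_diff_le)
    also have "\<dots> = of_real (real (N + 1)) * (\<Sum>d\<le>N. of_real (1 - real d / real (N + 1)) * fourier d 0 f * z ^ d)"
      unfolding sum_distrib_left
    proof (rule sum.cong[OF refl])
      fix d assume "d \<in> {..N}"
      then have "real (N + 1 - d) = real (N + 1) * (1 - real d / real (N + 1))"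
        by (simp add: of_nat_diff field_simps)
      then have "of_nat (N + 1 - d) = of_real (real (N + 1)) * complex_of_real (1 - real d / real (N + 1))"
        by (metis of_real_mult of_real_of_nat_eq)
      then show "of_nat (N + 1 - d) * (z ^ d * fourier d 0 f)
          = of_real (real (N + 1)) * (of_real (1 - real d / real (N + 1)) * fourier d 0 f * z ^ d)"
        by (simp add: mult_ac)
    qed
    finally show ?thesis .
  qed
  have "(\<integral>z. cmod (\<Sum>j\<le>N. \<Sum>k\<le>N. (z ^ j * cnj z ^ k) * fourier j k f) \<partial>circle_measure)
      = (\<integral>z. real (N + 1) * cmod (\<Sum>d\<le>N. of_real (1 - real d / real (N + 1)) * fourier d 0 f * z ^ d) \<partial>circle_measure)"
    by (intro Bochner_Integration.integral_cong refl)
       (simp only: space_circle mem_sphere_0 eq norm_mult norm_of_real abs_of_nat)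
  then have "real (N + 1) * (\<integral>z. cmod (\<Sum>d\<le>N. of_real (1 - real d / real (N + 1)) * fourier d 0 f * z ^ d) \<partial>circle_measure)
      \<le> real (N + 1) * (\<integral>w. cmod (f w) \<partial>circle_measure)"
    using fejer_bound_aux[OF f, of N] by simp
  then show ?thesis by (rule mult_left_le_imp_le) simp
qed


section \<open>Closures of subspaces\<close>

lemma submodule_mem:
  assumes "submodule S complex_ring V"
  shows "\<zero>\<^bsub>V\<^esub> \<in> S" "x \<in> S \<Longrightarrow> y \<in> S \<Longrightarrow> x \<oplus>\<^bsub>V\<^esub> y \<in> S" "x \<in> S \<Longrightarrow> c \<odot>\<^bsub>V\<^esub> x \<in> S"
    "S \<subseteq> carrier V"
proof -
  interpret submodule S complex_ring V by fact
  show "\<zero>\<^bsub>V\<^esub> \<in> S" "x \<in> S \<Longrightarrow> y \<in> S \<Longrightarrow> x \<oplus>\<^bsub>V\<^esub> y \<in> S" "x \<in> S \<Longrightarrow> c \<odot>\<^bsub>V\<^esub> x \<in> S"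
    "S \<subseteq> carrier V"
    using one_closed m_closed subset smult_closed by auto
qed

text \<open>The topological closure of a set of vectors, expressed by the norm.\<close>

definition norm_closure :: "'a nspace \<Rightarrow> 'a set \<Rightarrow> 'a set" where
  "norm_closure X S = {x \<in> carrier X. \<forall>e>0. \<exists>y\<in>S. vnorm X (x \<ominus>\<^bsub>X\<^esub> y) < e}"

context complex_normed_space
begin

lemma closure_of_eq: "S \<subseteq> carrier X \<Longrightarrow> Abstract_Topology.closure_of (norm_topology X) S = norm_closure X S"
  using closure_of_iff[of S] by (auto simp: norm_closure_def)

lemma norm_closureD:
  assumes "x \<in> norm_closure X S"
  shows "x \<in> carrier X" "0 < e \<Longrightarrow> \<exists>y\<in>S. vnorm X (x \<ominus> y) < e"
  using assms by (auto simp: norm_closure_def)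

lemma norm_closureI:
  assumes "x \<in> carrier X" "\<And>e. 0 < e \<Longrightarrow> \<exists>y\<in>S. vnorm X (x \<ominus> y) < e"
  shows "x \<in> norm_closure X S"
  using assms by (auto simp: norm_closure_def)

lemma submodule_closure:
  assumes S: "submodule S complex_ring X"
  shows "submodule (norm_closure X S) complex_ring X"
proof (rule submoduleI)
  note SX = submodule_mem(4)[OF S]
  let ?H = "norm_closure X S"
  show "?H \<subseteq> carrier X" using norm_closureD(1) by blast
  show "\<zero> \<in> ?H"
    using submodule_mem(1)[OF S] by (intro norm_closureI bexI[of _ \<zero>]) auto
  show smult: "c \<odot> a \<in> ?H" if a: "a \<in> ?H" for c a
  proof (rule norm_closureI)
    show "c \<odot> a \<in> carrier X" using norm_closureD(1)[OF a] by simp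
    fix e :: real assume "e > 0"
    then have e: "e / (cmod c + 1) > 0" by (simp add: add_nonneg_pos)
    obtain y where y: "y \<in> S" "vnorm X (a \<ominus> y) < e / (cmod c + 1)"
      using norm_closureD(2)[OF a e] by blast
    have yX: "y \<in> carrier X" using y SX by blast
    have "vnorm X (c \<odot> a \<ominus> c \<odot> y) \<le> (cmod c + 1) * vnorm X (a \<ominus> y)"
      using norm_closureD(1)[OF a] yX by (simp add: norm_smult_diff mult_right_mono norm_nonneg)
    also have "\<dots> < e" using y(2) by (simp add: pos_less_divide_eq add_nonneg_pos mult.commute)
    finally show "\<exists>y\<in>S. vnorm X (c \<odot> a \<ominus> y) < e" using submodule_mem(3)[OF S y(1)] by blast
  qed
  show "\<ominus> a \<in> ?H" if a: "a \<in> ?H" for a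
    using smult[OF a, of "- 1"] minus_smult[of a 1] norm_closureD(1)[OF a] by simp
  show "a \<oplus> b \<in> ?H" if a: "a \<in> ?H" and b: "b \<in> ?H" for a b
  proof (rule norm_closureI)
    show "a \<oplus> b \<in> carrier X" using norm_closureD(1)[OF a] norm_closureD(1)[OF b] by simp
    fix e :: real assume "e > 0"
    then have e: "e / 2 > 0" by simp
    obtain y where y: "y \<in> S" "vnorm X (a \<ominus> y) < e / 2"
      using norm_closureD(2)[OF a e] by blast
    obtain y' where y': "y' \<in> S" "vnorm X (b \<ominus> y') < e / 2"
      using norm_closureD(2)[OF b e] by blast
    have yX: "y \<in> carrier X" "y' \<in> carrier X" using y y' SX by blast+
    have "vnorm X ((a \<oplus> b) \<ominus> (y \<oplus> y')) < e"
      using norm_add_diff_add[OF norm_closureD(1)[OF a] norm_closureD(1)[OF b] yX] y(2) y'(2) by linarith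
    then show "\<exists>y\<in>S. vnorm X ((a \<oplus> b) \<ominus> y) < e" using submodule_mem(2)[OF S y(1) y'(1)] by blast
  qed
qed

lemma normed_subspace:
  assumes "submodule H complex_ring X"
  shows "complex_normed_space (X\<lparr>carrier := H\<rparr>)"
proof -
  interpret submodule H complex_ring X by fact
  have H: "x \<in> H \<Longrightarrow> x \<in> carrier X" for x using subset by auto
  show ?thesis
    using submodule_is_module[OF module_axioms]
    by (intro complex_normed_space.intro complex_normed_space_axioms.intro)
       (auto simp: H vnorm_nonneg vnorm_eq_0_iff vnorm_triangle vnorm_smult)
qed

lemma linear_pair_subspace:
  assumes "submodule H complex_ring X"
  shows "linear_pair (X\<lparr>carrier := H\<rparr>) X (\<lambda>x. x)"
proof -
  interpret H: complex_normed_space "X\<lparr>carrier := H\<rparr>" by (rule normed_subspace[OF assms])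
  show ?thesis
    using submodule_mem(4)[OF assms]
    by (intro linear_pair.intro linear_pair_axioms.intro H.seminormed_module_axioms
        seminormed_module_axioms linear_onI) auto
qed

lemma fast_complete_closure:
  assumes S: "submodule S complex_ring X" and "fast_complete X"
  shows "fast_complete (X\<lparr>carrier := norm_closure X S\<rparr>)"
  unfolding fast_complete_def
proof (intro allI impI, elim conjE)
  note SX = submodule_mem(4)[OF S]
  let ?H = "norm_closure X S"
  interpret H: linear_pair "X\<lparr>carrier := ?H\<rparr>" X "\<lambda>x. x"
    by (rule linear_pair_subspace[OF submodule_closure[OF S]])
  fix s assume s: "\<forall>n. s n \<in> carrier (X\<lparr>carrier := ?H\<rparr>)"
    and step: "\<forall>n. vnorm (X\<lparr>carrier := ?H\<rparr>) (s (Suc n) \<ominus>\<^bsub>X\<lparr>carrier := ?H\<rparr>\<^esub> s n) \<le> (1/2) ^ n"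
  have sX: "s n \<in> carrier X" for n using s by auto
  have "vnorm X (s (Suc n) \<ominus> s n) \<le> (1/2) ^ n" for n
    using step s by (simp add: H.hom_diff)
  then obtain l where l: "l \<in> carrier X" "(\<lambda>n. vnorm X (s n \<ominus> l)) \<longlonglongrightarrow> 0"
    using assms(2) sX unfolding fast_complete_def by blast
  have lH: "l \<in> ?H"
  proof (rule norm_closureI[OF l(1)])
    fix e :: real assume "e > 0"
    then have e: "e / 2 > 0" by simp
    obtain n where n: "vnorm X (s n \<ominus> l) < e / 2"
      using order_tendstoD(2)[OF l(2) e] by (auto simp: eventually_sequentially)
    have "s n \<in> ?H" using s by simp
    from norm_closureD(2)[OF this e] obtain y where y: "y \<in> S" "vnorm X (s n \<ominus> y) < e / 2"
      by blast
    have "vnorm X (l \<ominus> y) < e"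
      using norm_diff_triangle[OF l(1) sX, of y n] y n SX norm_diff_commute[OF l(1) sX, of n] by auto
    then show "\<exists>y\<in>S. vnorm X (l \<ominus> y) < e" using y(1) by blast
  qed
  have "(\<lambda>n. vnorm (X\<lparr>carrier := ?H\<rparr>) (s n \<ominus>\<^bsub>X\<lparr>carrier := ?H\<rparr>\<^esub> l)) \<longlonglongrightarrow> 0"
    using l(2) s lH by (simp add: H.hom_diff)
  then show "\<exists>l\<in>carrier (X\<lparr>carrier := ?H\<rparr>).
      (\<lambda>n. vnorm (X\<lparr>carrier := ?H\<rparr>) (s n \<ominus>\<^bsub>X\<lparr>carrier := ?H\<rparr>\<^esub> l)) \<longlonglongrightarrow> 0"
    using lH by auto
qed

end

section \<open>Analytic polynomials and Hardy spaces\<close>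

context complex_normed_space
begin

lemma L1_class_linear: "linear_pair (L1_functions M X) (L1_space M X) (L1_class M X)"
proof -
  interpret Q: quotient_pair "L1_functions M X" "L1_null M X" by (rule quotient_pair_L1)
  show ?thesis using Q.linear_pair_q by (simp add: L1_space_def L1_class_def[abs_def])
qed

lemma carrier_L1_space: "carrier (L1_space M X) = L1_class M X ` carrier (L1_functions M X)"
proof -
  interpret Q: quotient_pair "L1_functions M X" "L1_null M X" by (rule quotient_pair_L1)
  show ?thesis using Q.carrier_Q by (simp add: L1_space_def L1_class_def[abs_def])
qed

lemma norm_L1_class:
  "f \<in> carrier (L1_functions M X) \<Longrightarrow> vnorm (L1_space M X) (L1_class M X f) = (\<integral>z. vnorm X (f z) \<partial>M)"
proof -
  interpret Q: quotient_pair "L1_functions M X" "L1_null M X" by (rule quotient_pair_L1)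
  show "f \<in> carrier (L1_functions M X) \<Longrightarrow> ?thesis"
    using Q.norm_q_eq[OF L1_null_norm, of f] by (simp add: L1_space_def L1_class_def L1_functions_simps(5))
qed

lemma L1_diff_null_iff:
  assumes "f \<in> carrier (L1_functions M X)" "g \<in> carrier (L1_functions M X)"
  shows "g \<ominus>\<^bsub>L1_functions M X\<^esub> f \<in> L1_null M X \<longleftrightarrow> (AE z in M. g z = f z)"
proof -
  interpret L: seminormed_module "L1_functions M X" by (rule seminormed_L1_functions)
  have "g z \<ominus> f z = \<zero> \<longleftrightarrow> g z = f z" for z
    using norm_diff_eq_0_iff[of "g z" "f z"] vnorm_eq_0_iff[of "g z \<ominus> f z"] assms
    by (simp add: L1_functions_simps)
  then show ?thesis
    using L.minus_closed[OF assms(2,1)] assms by (simp add: L1_null_def L1_diff_apply)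
qed

lemma mem_L1_class_iff:
  "f \<in> carrier (L1_functions M X) \<Longrightarrow>
     g \<in> L1_class M X f \<longleftrightarrow> g \<in> carrier (L1_functions M X) \<and> (AE z in M. g z = f z)"
proof -
  interpret Q: quotient_pair "L1_functions M X" "L1_null M X" by (rule quotient_pair_L1)
  assume "f \<in> carrier (L1_functions M X)"
  then show ?thesis using Q.mem_q_iff_diff[of f g] L1_diff_null_iff[of f M g] by (auto simp: L1_class_def)
qed

lemma L1_class_eqI:
  assumes "f \<in> carrier (L1_functions M X)" "g \<in> carrier (L1_functions M X)" "AE z in M. f z = g z"
  shows "L1_class M X f = L1_class M X g"
proof -
  interpret Q: quotient_pair "L1_functions M X" "L1_null M X" by (rule quotient_pair_L1)
  show ?thesis
    using Q.q_eq_iff[OF assms(1,2)] L1_diff_null_iff[OF assms(2,1)] assms(3) by (simp add: L1_class_def)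
qed

lemma smult_fun_L1:
  assumes f: "integrable M f" and x: "x \<in> carrier X"
  shows "(\<lambda>z. f z \<odot> x) \<in> carrier (L1_functions M X)"
proof -
  have "integrable M (\<lambda>z. cmod (f z) * vnorm X x)"
    using f by (intro integrable_mult_left integrable_norm)
  then show ?thesis
    using strongly_measurable_smult_fun[OF borel_measurable_integrable[OF f] x] x
    by (simp add: L1_functions_simps norm_smult)
qed

lemma integrable_circle_power: "integrable circle_measure (\<lambda>z::complex. z ^ k)"
  by (rule integrable_circle[where B = 1])
     (auto simp: norm_power
       intro!: borel_measurable_circle borel_measurable_continuous_onI continuous_intros)

lemma L1_finsum_apply:
  assumes "finite S" "\<And>p. p \<in> S \<Longrightarrow> f p \<in> carrier (L1_functions M X)"
  shows "(\<Oplus>\<^bsub>L1_functions M X\<^esub>p\<in>S. f p) z = (\<Oplus>p\<in>S. f p z)"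
  by (rule linear_pair.hom_finsum[OF L1_eval assms])

lemma finsum_smult_fun_L1:
  assumes "finite S" "\<And>p. p \<in> S \<Longrightarrow> integrable M (f p)" "\<And>p. p \<in> S \<Longrightarrow> x p \<in> carrier X"
  shows "(\<lambda>z. \<Oplus>p\<in>S. f p z \<odot> x p) \<in> carrier (L1_functions M X)"
    and "L1_class M X (\<lambda>z. \<Oplus>p\<in>S. f p z \<odot> x p) = (\<Oplus>\<^bsub>L1_space M X\<^esub>p\<in>S. L1_class M X (\<lambda>z. f p z \<odot> x p))"
proof -
  interpret cl: linear_pair "L1_functions M X" "L1_space M X" "L1_class M X" by (rule L1_class_linear)
  have m: "(\<lambda>z. f p z \<odot> x p) \<in> carrier (L1_functions M X)" if "p \<in> S" for p
    using assms that by (intro smult_fun_L1) auto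
  have eq: "(\<lambda>z. \<Oplus>p\<in>S. f p z \<odot> x p) = (\<Oplus>\<^bsub>L1_functions M X\<^esub>p\<in>S. (\<lambda>z. f p z \<odot> x p))"
    using L1_finsum_apply[OF assms(1) m] by auto
  show "(\<lambda>z. \<Oplus>p\<in>S. f p z \<odot> x p) \<in> carrier (L1_functions M X)"
    unfolding eq using m by (intro cl.V.finsum_closed) auto
  show "L1_class M X (\<lambda>z. \<Oplus>p\<in>S. f p z \<odot> x p) = (\<Oplus>\<^bsub>L1_space M X\<^esub>p\<in>S. L1_class M X (\<lambda>z. f p z \<odot> x p))"
    unfolding eq by (rule cl.hom_finsum[OF assms(1) m])
qed

lemma analytic_polynomial_L1:
  assumes "\<And>k. k \<le> n \<Longrightarrow> x k \<in> carrier X"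
  shows "analytic_polynomial X n x \<in> carrier (L1F X)"
  using finsum_smult_fun_L1(1)[of "{..n}" circle_measure "\<lambda>k z. z ^ k" x] assms integrable_circle_power
  by (simp add: analytic_polynomial_def[abs_def])

lemma analytic_polynomial_pad:
  assumes "\<And>k. k \<le> n \<Longrightarrow> x k \<in> carrier X" "n \<le> m"
  shows "analytic_polynomial X n x = analytic_polynomial X m (\<lambda>k. if k \<le> n then x k else \<zero>)"
proof
  fix z
  have "(\<Oplus>k\<in>{..m}. z ^ k \<odot> (if k \<le> n then x k else \<zero>)) = (\<Oplus>k\<in>{..n}. z ^ k \<odot> (if k \<le> n then x k else \<zero>))"
    using assms by (intro finsum_mono_neutral) auto
  also have "\<dots> = (\<Oplus>k\<in>{..n}. z ^ k \<odot> x k)"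
    using assms by (intro finsum_cong') auto
  finally show "analytic_polynomial X n x z = analytic_polynomial X m (\<lambda>k. if k \<le> n then x k else \<zero>) z"
    by (simp add: analytic_polynomial_def)
qed

lemma analytic_polynomial_add:
  assumes "\<And>k. k \<le> n \<Longrightarrow> x k \<in> carrier X" "\<And>k. k \<le> n \<Longrightarrow> y k \<in> carrier X"
  shows "analytic_polynomial X n (\<lambda>k. x k \<oplus> y k) z = analytic_polynomial X n x z \<oplus> analytic_polynomial X n y z"
proof -
  have "(\<Oplus>k\<in>{..n}. z ^ k \<odot> (x k \<oplus> y k)) = (\<Oplus>k\<in>{..n}. z ^ k \<odot> x k \<oplus> z ^ k \<odot> y k)"
    using assms by (intro finsum_cong') (auto simp: smult_add)
  also have "\<dots> = (\<Oplus>k\<in>{..n}. z ^ k \<odot> x k) \<oplus> (\<Oplus>k\<in>{..n}. z ^ k \<odot> y k)"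
    using assms by (intro finsum_addf) auto
  finally show ?thesis by (simp add: analytic_polynomial_def)
qed

lemma analytic_polynomial_smult:
  assumes "\<And>k. k \<le> n \<Longrightarrow> x k \<in> carrier X"
  shows "analytic_polynomial X n (\<lambda>k. c \<odot> x k) z = c \<odot> analytic_polynomial X n x z"
proof -
  have "(\<Oplus>k\<in>{..n}. z ^ k \<odot> (c \<odot> x k)) = (\<Oplus>k\<in>{..n}. c \<odot> (z ^ k \<odot> x k))"
    using assms by (intro finsum_cong') (auto simp: smult_smult mult.commute)
  also have "\<dots> = c \<odot> (\<Oplus>k\<in>{..n}. z ^ k \<odot> x k)"
    using assms by (intro finsum_smult[symmetric]) auto
  finally show ?thesis by (simp add: analytic_polynomial_def)
qed

text \<open>The dense subspace of \<open>hardy_space X\<close> consisting of the classes of analytic polynomials.\<close>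

definition polynomial_classes :: "(complex \<Rightarrow> 'a) set set" where
  "polynomial_classes =
     {L1cl X (analytic_polynomial X n x) | n x. \<forall>k\<le>n. x k \<in> carrier X}"

lemma submodule_polynomial_classes:
  "submodule polynomial_classes complex_ring (L1T X)"
proof -
  interpret cl: linear_pair "L1F X" "L1T X" "L1cl X"
    by (rule L1_class_linear)
  have sm: "c \<odot>\<^bsub>L1T X\<^esub> a \<in> polynomial_classes" if a: "a \<in> polynomial_classes" for c a
  proof -
    obtain n x where x: "\<forall>k\<le>n. x k \<in> carrier X" "a = L1cl X (analytic_polynomial X n x)"
      using a by (auto simp: polynomial_classes_def)
    have "analytic_polynomial X n (\<lambda>k. c \<odot> x k) = c \<odot>\<^bsub>L1F X\<^esub> analytic_polynomial X n x"
      using x by (intro ext) (simp add: analytic_polynomial_smult L1_functions_simps)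
    then have "c \<odot>\<^bsub>L1T X\<^esub> a = L1cl X (analytic_polynomial X n (\<lambda>k. c \<odot> x k))"
      using x cl.hom_smult[OF analytic_polynomial_L1, of n x c] by simp
    moreover have "\<forall>k\<le>n. c \<odot> x k \<in> carrier X" using x by auto
    ultimately show ?thesis unfolding polynomial_classes_def by blast
  qed
  have sub: "polynomial_classes \<subseteq> carrier (L1T X)"
    by (auto simp: polynomial_classes_def analytic_polynomial_L1)
  show ?thesis
  proof (rule cl.W.submoduleI)
    show "polynomial_classes \<subseteq> carrier (L1T X)" by (rule sub)
    have P: "L1cl X (analytic_polynomial X 0 (\<lambda>_. \<zero>)) \<in> polynomial_classes" (is "?P \<in> _")
      unfolding polynomial_classes_def by auto
    have "0 \<odot>\<^bsub>L1T X\<^esub> ?P = \<zero>\<^bsub>L1T X\<^esub>"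
      using P sub by (intro cl.W.zero_smult) blast
    then show "\<zero>\<^bsub>L1T X\<^esub> \<in> polynomial_classes"
      using sm[OF P, of 0] by simp
    show "c \<odot>\<^bsub>L1T X\<^esub> a \<in> polynomial_classes" if "a \<in> polynomial_classes" for c a
      by (rule sm[OF that])
    show "\<ominus>\<^bsub>L1T X\<^esub> a \<in> polynomial_classes" if "a \<in> polynomial_classes" for a
    proof -
      have "a \<in> carrier (L1T X)" using that sub by blast
      then show ?thesis using sm[OF that, of "- 1"] cl.W.minus_smult[of a 1] by simp
    qed
    fix a b assume "a \<in> polynomial_classes" "b \<in> polynomial_classes"
    then obtain n x m y where x: "\<forall>k\<le>n. x k \<in> carrier X" "a = L1cl X (analytic_polynomial X n x)"
      and y: "\<forall>k\<le>m. y k \<in> carrier X" "b = L1cl X (analytic_polynomial X m y)"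
      by (auto simp: polynomial_classes_def)
    define N where "N = max n m"
    define x' where "x' k = (if k \<le> n then x k else \<zero>)" for k
    define y' where "y' k = (if k \<le> m then y k else \<zero>)" for k
    have x'y': "x' k \<in> carrier X" "y' k \<in> carrier X" for k
      using x y by (auto simp: x'_def y'_def)
    have "analytic_polynomial X n x = analytic_polynomial X N x'"
      "analytic_polynomial X m y = analytic_polynomial X N y'"
      unfolding x'_def[abs_def] y'_def[abs_def] using x y by (auto intro!: analytic_polynomial_pad simp: N_def)
    moreover have "analytic_polynomial X N (\<lambda>k. x' k \<oplus> y' k)
        = analytic_polynomial X N x' \<oplus>\<^bsub>L1F X\<^esub> analytic_polynomial X N y'"
      using x'y' by (intro ext) (simp add: analytic_polynomial_add L1_functions_simps)
    ultimately have "a \<oplus>\<^bsub>L1T X\<^esub> b = L1cl X (analytic_polynomial X N (\<lambda>k. x' k \<oplus> y' k))"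
      using cl.hom_add[OF analytic_polynomial_L1 analytic_polynomial_L1, of N x' N y'] x'y' x(2) y(2) by simp
    moreover have "\<forall>k\<le>N. x' k \<oplus> y' k \<in> carrier X" using x'y' by simp
    ultimately show "a \<oplus>\<^bsub>L1T X\<^esub> b \<in> polynomial_classes"
      unfolding polynomial_classes_def by blast
  qed
qed

lemma hardy_space_eq:
  "hardy_space X = (L1T X)
     \<lparr>carrier := norm_closure (L1T X) polynomial_classes\<rparr>"
proof -
  interpret L: complex_normed_space "L1T X" by (rule normed_L1_space)
  show ?thesis
    using L.closure_of_eq[OF submodule_mem(4)[OF submodule_polynomial_classes]]
    by (simp add: hardy_space_def polynomial_classes_def)
qed

lemma normed_hardy_space: "complex_normed_space (hardy_space X)"
proof -
  interpret L: complex_normed_space "L1T X" by (rule normed_L1_space)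
  show ?thesis
    unfolding hardy_space_eq by (intro L.normed_subspace L.submodule_closure submodule_polynomial_classes)
qed

lemma hardy_linear: "linear_pair (hardy_space X) (L1T X) (\<lambda>F. F)"
proof -
  interpret L: complex_normed_space "L1T X" by (rule normed_L1_space)
  show ?thesis
    unfolding hardy_space_eq by (intro L.linear_pair_subspace L.submodule_closure submodule_polynomial_classes)
qed

lemma hardy_space_simps:
  "\<zero>\<^bsub>hardy_space X\<^esub> = \<zero>\<^bsub>L1T X\<^esub>"
  "F \<oplus>\<^bsub>hardy_space X\<^esub> G = F \<oplus>\<^bsub>L1T X\<^esub> G"
  "c \<odot>\<^bsub>hardy_space X\<^esub> F = c \<odot>\<^bsub>L1T X\<^esub> F"
  "vnorm (hardy_space X) F = vnorm (L1T X) F"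
  by (auto simp: hardy_space_eq)

lemma mem_hardy_iff:
  "F \<in> carrier (hardy_space X) \<longleftrightarrow> F \<in> carrier (L1T X) \<and>
     (\<forall>e>0. \<exists>P\<in>polynomial_classes. vnorm (L1T X) (F \<ominus>\<^bsub>L1T X\<^esub> P) < e)"
proof -
  interpret L: complex_normed_space "L1T X" by (rule normed_L1_space)
  show ?thesis
    by (simp add: hardy_space_eq norm_closure_def)
qed

lemma polynomial_class_hardy:
  assumes "P \<in> polynomial_classes"
  shows "P \<in> carrier (hardy_space X)"
proof -
  interpret L: complex_normed_space "L1T X" by (rule normed_L1_space)
  show ?thesis
    using submodule_mem(4)[OF submodule_polynomial_classes] assms
    unfolding mem_hardy_iff by (intro conjI allI impI bexI[of _ P]) auto
qed

end

lemma (in complex_banach_space) banach_hardy_space: "complex_banach_space (hardy_space X)"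
proof -
  interpret L: complex_normed_space "L1T X" by (rule normed_L1_space)
  interpret H: complex_normed_space "hardy_space X" by (rule normed_hardy_space)
  interpret Q: quotient_pair "L1F X" "L1_null circle_measure X" by (rule quotient_pair_L1)
  have "fast_complete (hardy_space X)"
    unfolding hardy_space_eq
    by (rule L.fast_complete_closure[OF submodule_polynomial_classes])
       (unfold L1_space_def, rule Q.fast_complete_Q[OF fast_complete_L1_functions])
  then show ?thesis
    by (intro complex_banach_space.intro complex_banach_space_axioms.intro H.complex_normed_space_axioms
        H.fast_complete_imp_mcomplete)
qed


section \<open>Coefficients of scalar Hardy functions\<close>

lemma complex_space_simps [simp]:
  "carrier complex_space = UNIV" "\<zero>\<^bsub>complex_space\<^esub> = 0" "a \<oplus>\<^bsub>complex_space\<^esub> b = a + b"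
  "a \<odot>\<^bsub>complex_space\<^esub> b = a * b" "vnorm complex_space a = cmod a"
  by (auto simp: complex_space_def)

lemma normed_complex_space: "complex_normed_space complex_space"
  by (rule complex_banach_space.axioms(1)[OF complex_banach_space_complex])

lemma complex_space_diff [simp]: "a \<ominus>\<^bsub>complex_space\<^esub> b = a - b"
proof -
  interpret complex_normed_space complex_space by (rule normed_complex_space)
  show ?thesis using minus_smult[of b 1] by (simp add: a_minus_def)
qed

lemma complex_space_finsum: "finite S \<Longrightarrow> (\<Oplus>\<^bsub>complex_space\<^esub>p\<in>S. g p) = (\<Sum>p\<in>S. g p)"
proof (induction S rule: finite_induct)
  interpret complex_normed_space complex_space by (rule normed_complex_space)
  case empty
  show ?case by simp
next
  interpret complex_normed_space complex_space by (rule normed_complex_space)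
  case (insert p S)
  then show ?case by (subst finsum_insert) auto
qed

lemma analytic_polynomial_complex: "analytic_polynomial complex_space n a = (\<lambda>z. \<Sum>k\<le>n. a k * z ^ k)"
  by (intro ext) (simp add: analytic_polynomial_def complex_space_finsum mult.commute)

lemma L1_complex_integrable:
  assumes "f \<in> carrier (L1_functions M complex_space)"
  shows "integrable M f"
proof -
  obtain s where s: "\<And>n. simple_function M (s n)" "\<And>z. z \<in> space M \<Longrightarrow> (\<lambda>n. cmod (s n z - f z)) \<longlonglongrightarrow> 0"
    and int: "integrable M (\<lambda>z. cmod (f z))"
    using assms by (auto simp: L1_functions_simps strongly_measurable_def)
  have "f \<in> borel_measurable M"
  proof (rule borel_measurable_LIMSEQ_metric)
    show "s n \<in> borel_measurable M" for n by (rule borel_measurable_simple_function[OF s(1)])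
    show "(\<lambda>n. s n z) \<longlonglongrightarrow> f z" if "z \<in> space M" for z
      using tendsto_norm_zero_cancel[OF s(2)[OF that]] by (rule LIM_zero_cancel)
  qed
  then show ?thesis using int by (simp add: integrable_norm_iff)
qed

lemma integrable_L1_complex:
  assumes "integrable M f"
  shows "f \<in> carrier (L1_functions M complex_space)"
proof -
  interpret complex_normed_space complex_space by (rule normed_complex_space)
  show ?thesis using smult_fun_L1[OF assms, of 1] by simp
qed

lemma fourier_diff:
  assumes "integrable circle_measure f" "integrable circle_measure g"
  shows "fourier j k (\<lambda>z. f z - g z) = fourier j k f - fourier j k g"
  using integrable_mult_character[OF assms(1), of j k] integrable_mult_character[OF assms(2), of j k]
  by (simp add: fourier_def left_diff_distrib)

lemma fourier_add:
  assumes "integrable circle_measure f" "integrable circle_measure g"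
  shows "fourier j k (\<lambda>z. f z + g z) = fourier j k f + fourier j k g"
  using integrable_mult_character[OF assms(1), of j k] integrable_mult_character[OF assms(2), of j k]
  by (simp add: fourier_def distrib_right)

lemma fourier_cmult:
  assumes "integrable circle_measure f"
  shows "fourier j k (\<lambda>z. c * f z) = c * fourier j k f"
  using integrable_mult_character[OF assms, of j k] by (simp add: fourier_def mult.assoc)

lemma fourier_cong_AE:
  assumes "AE z in circle_measure. f z = g z" "integrable circle_measure f" "integrable circle_measure g"
  shows "fourier j k f = fourier j k g"
  unfolding fourier_def
proof (rule integral_cong_AE)
  show "AE z in circle_measure. f z * (cnj z ^ j * z ^ k) = g z * (cnj z ^ j * z ^ k)"
    using assms(1) by eventually_elim simp
qed (use assms integrable_mult_character borel_measurable_integrable in blast)+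

text \<open>The coefficient of \<open>z\<^sup>k\<close>; it does not depend on the representative (\<open>hardy_coeff_class\<close>).\<close>

definition hardy_coeff :: "nat \<Rightarrow> (complex \<Rightarrow> complex) set \<Rightarrow> complex" where
  "hardy_coeff k h = fourier k 0 (SOME f. f \<in> h)"

lemma hardy_coeff_class:
  assumes f: "integrable circle_measure f"
  shows "hardy_coeff k (L1cl complex_space f) = fourier k 0 f"
proof -
  interpret complex_normed_space complex_space by (rule normed_complex_space)
  let ?g = "SOME g. g \<in> L1cl complex_space f"
  have "f \<in> L1cl complex_space f"
    by (simp add: mem_L1_class_iff integrable_L1_complex f)
  then have "?g \<in> L1cl complex_space f" by (metis someI_ex)
  then have "?g \<in> carrier (L1F complex_space)" "AE z in circle_measure. ?g z = f z"
    by (simp_all add: mem_L1_class_iff integrable_L1_complex f)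
  then show ?thesis
    unfolding hardy_coeff_def using fourier_cong_AE[OF _ L1_complex_integrable f] by blast
qed

text \<open>
  The negative Fourier coefficients vanish for polynomials and are continuous for the \<open>L\<^sup>1\<close> norm,
  so they vanish on the whole Hardy space.
\<close>

lemma scalar_hardyE:
  assumes "h \<in> carrier H1"
  obtains f where "integrable circle_measure f" "h = L1cl complex_space f"
    "vnorm H1 h = (\<integral>z. cmod (f z) \<partial>circle_measure)"
    "\<And>d. d > 0 \<Longrightarrow> fourier 0 d f = 0" "\<And>k. hardy_coeff k h = fourier k 0 f"
proof -
  interpret complex_normed_space complex_space by (rule normed_complex_space)
  interpret cl: linear_pair "L1F complex_space" "L1T complex_space"
    "L1cl complex_space" by (rule L1_class_linear)
  obtain f where f: "f \<in> carrier (L1F complex_space)"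
    "h = L1cl complex_space f"
    using assms by (auto simp: mem_hardy_iff carrier_L1_space)
  have fi: "integrable circle_measure f" by (rule L1_complex_integrable[OF f(1)])
  have neg: "fourier 0 d f = 0" if d: "d > 0" for d
  proof -
    have "cmod (fourier 0 d f) \<le> 0"
    proof (rule field_le_epsilon)
      fix e :: real assume "e > 0"
      then obtain P where P: "P \<in> polynomial_classes"
        "vnorm (L1T complex_space) (h \<ominus>\<^bsub>L1T complex_space\<^esub> P) < e"
        using assms by (auto simp: mem_hardy_iff)
      then obtain n a where a: "P = L1cl complex_space (analytic_polynomial complex_space n a)"
        by (auto simp: polynomial_classes_def)
      let ?p = "analytic_polynomial complex_space n a"
      have p: "?p \<in> carrier (L1F complex_space)" by (rule analytic_polynomial_L1) simp
      have fp: "f \<ominus>\<^bsub>L1F complex_space\<^esub> ?p = (\<lambda>z. f z - ?p z)"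
        by (intro ext) (simp add: L1_diff_apply[OF f(1) p])
      have "h \<ominus>\<^bsub>L1T complex_space\<^esub> P = L1cl complex_space (\<lambda>z. f z - ?p z)"
        using cl.hom_diff[OF f(1) p] by (simp add: f(2) a fp)
      moreover have "(\<lambda>z. f z - ?p z) \<in> carrier (L1F complex_space)"
        using cl.V.minus_closed[OF f(1) p] by (simp only: fp)
      ultimately have "(\<integral>z. cmod (f z - ?p z) \<partial>circle_measure) < e"
        using P(2) by (simp add: norm_L1_class)
      moreover have "fourier 0 d ?p = 0"
        unfolding analytic_polynomial_complex fourier_poly using d by (intro sum.neutral) auto
      then have "fourier 0 d f = fourier 0 d (\<lambda>z. f z - ?p z)"
        using fourier_diff[OF fi L1_complex_integrable[OF p]] by simp
      moreover have "cmod (fourier 0 d (\<lambda>z. f z - ?p z)) \<le> (\<integral>z. cmod (f z - ?p z) \<partial>circle_measure)"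
        using fi L1_complex_integrable[OF p] by (intro norm_fourier_le) simp
      ultimately show "cmod (fourier 0 d f) \<le> 0 + e" by simp
    qed
    then show ?thesis by simp
  qed
  show ?thesis
    using that[OF fi f(2) _ neg] hardy_coeff_class[OF fi] f norm_L1_class[OF f(1)]
    by (simp add: hardy_space_simps)
qed

lemma hardy_coeff_add:
  assumes "h \<in> carrier H1" "g \<in> carrier H1"
  shows "hardy_coeff k (h \<oplus>\<^bsub>H1\<^esub> g) = hardy_coeff k h + hardy_coeff k g"
proof -
  interpret complex_normed_space complex_space by (rule normed_complex_space)
  interpret cl: linear_pair "L1F complex_space" "L1T complex_space"
    "L1cl complex_space" by (rule L1_class_linear)
  obtain f f' where f: "integrable circle_measure f" "h = L1cl complex_space f"
    and f': "integrable circle_measure f'" "g = L1cl complex_space f'"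
    using assms by (metis scalar_hardyE)
  have "h \<oplus>\<^bsub>H1\<^esub> g = L1cl complex_space (\<lambda>z. f z + f' z)"
    using cl.hom_add[OF integrable_L1_complex[OF f(1)] integrable_L1_complex[OF f'(1)]] f f'
    by (simp add: hardy_space_simps L1_functions_simps)
  then show ?thesis using f f' by (simp add: hardy_coeff_class fourier_add)
qed

lemma hardy_coeff_smult:
  assumes "h \<in> carrier H1"
  shows "hardy_coeff k (c \<odot>\<^bsub>H1\<^esub> h) = c * hardy_coeff k h"
proof -
  interpret complex_normed_space complex_space by (rule normed_complex_space)
  interpret cl: linear_pair "L1F complex_space" "L1T complex_space"
    "L1cl complex_space" by (rule L1_class_linear)
  obtain f where f: "integrable circle_measure f" "h = L1cl complex_space f"
    using assms by (metis scalar_hardyE)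
  have "c \<odot>\<^bsub>H1\<^esub> h = L1cl complex_space (\<lambda>z. c * f z)"
    using cl.hom_smult[OF integrable_L1_complex[OF f(1)], of c] f
    by (simp add: hardy_space_simps L1_functions_simps)
  then show ?thesis using f by (simp add: hardy_coeff_class fourier_cmult)
qed

lemma hardy_fejer_bound:
  assumes "h \<in> carrier H1"
  shows "(\<integral>z. cmod (\<Sum>d\<le>N. of_real (1 - real d / real (N + 1)) * hardy_coeff d h * z ^ d) \<partial>circle_measure)
      \<le> vnorm H1 h"
proof -
  obtain f where "integrable circle_measure f"
    "vnorm H1 h = (\<integral>z. cmod (f z) \<partial>circle_measure)"
    "\<And>d. d > 0 \<Longrightarrow> fourier 0 d f = 0" "\<And>k. hardy_coeff k h = fourier k 0 f"
    using scalar_hardyE[OF assms] by metis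
  then show ?thesis using fejer_bound[of f N] by simp
qed

text \<open>The polynomial \<open>\<Sum>\<^sub>k a\<^sub>k z\<^sup>k\<close> of degree at most \<open>n\<close> as an element of the scalar Hardy space.\<close>

definition scalar_polynomial :: "nat \<Rightarrow> (nat \<Rightarrow> complex) \<Rightarrow> (complex \<Rightarrow> complex) set" where
  "scalar_polynomial n a = L1cl complex_space (\<lambda>z. \<Sum>k\<le>n. a k * z ^ k)"

lemma integrable_scalar_polynomial: "integrable circle_measure (\<lambda>z. \<Sum>k\<le>n. a k * z ^ k)"
proof -
  interpret complex_normed_space complex_space by (rule normed_complex_space)
  show ?thesis using integrable_circle_power by (intro Bochner_Integration.integrable_sum integrable_mult_right)
qed

lemma scalar_polynomial_hardy:
  shows "scalar_polynomial n a \<in> carrier H1"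
    and "vnorm H1 (scalar_polynomial n a) = (\<integral>z. cmod (\<Sum>k\<le>n. a k * z ^ k) \<partial>circle_measure)"
    and "hardy_coeff k (scalar_polynomial n a) = (if k \<le> n then a k else 0)"
proof -
  interpret complex_normed_space complex_space by (rule normed_complex_space)
  show "scalar_polynomial n a \<in> carrier H1"
    unfolding scalar_polynomial_def analytic_polynomial_complex[symmetric]
    by (rule polynomial_class_hardy) (auto simp: polynomial_classes_def)
  show "vnorm H1 (scalar_polynomial n a) = (\<integral>z. cmod (\<Sum>k\<le>n. a k * z ^ k) \<partial>circle_measure)"
    unfolding scalar_polynomial_def
    by (simp add: hardy_space_simps norm_L1_class integrable_L1_complex integrable_scalar_polynomial)
  show "hardy_coeff k (scalar_polynomial n a) = (if k \<le> n then a k else 0)"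
    unfolding scalar_polynomial_def
    by (simp add: hardy_coeff_class integrable_scalar_polynomial fourier_poly)
qed

section \<open>Products of scalar Hardy functions and vectors\<close>

context complex_normed_space
begin

lemma hardy_mult_class:
  assumes f: "integrable circle_measure f" and x: "x \<in> carrier X"
  shows "hardy_mult X (L1cl complex_space f) x = L1cl X (\<lambda>z. f z \<odot> x)"
proof -
  interpret C: complex_normed_space complex_space by (rule normed_complex_space)
  have eq: "L1cl X (\<lambda>z. g z \<odot> x) = L1cl X (\<lambda>z. f z \<odot> x)"
    if "g \<in> L1cl complex_space f" for g
  proof (rule L1_class_eqI)
    have g: "g \<in> carrier (L1F complex_space)" "AE z in circle_measure. g z = f z"
      using that by (simp_all add: C.mem_L1_class_iff integrable_L1_complex f)
    show "(\<lambda>z. g z \<odot> x) \<in> carrier (L1F X)"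
      by (rule smult_fun_L1[OF L1_complex_integrable[OF g(1)] x])
    show "(\<lambda>z. f z \<odot> x) \<in> carrier (L1F X)"
      by (rule smult_fun_L1[OF f x])
    show "AE z in circle_measure. g z \<odot> x = f z \<odot> x" using g(2) by eventually_elim simp
  qed
  have "f \<in> L1cl complex_space f"
    by (simp add: C.mem_L1_class_iff integrable_L1_complex f)
  with eq show ?thesis unfolding hardy_mult_def by blast
qed

lemma norm_hardy_mult:
  assumes h: "h \<in> carrier H1" and x: "x \<in> carrier X"
  shows "vnorm (L1T X) (hardy_mult X h x) = vnorm H1 h * vnorm X x"
proof -
  obtain f where f: "integrable circle_measure f" "h = L1cl complex_space f"
    "vnorm H1 h = (\<integral>z. cmod (f z) \<partial>circle_measure)"
    using scalar_hardyE[OF h] by metis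
  then show ?thesis
    using norm_L1_class[OF smult_fun_L1[OF f(1) x]] x by (simp add: hardy_mult_class norm_smult)
qed

lemma hardy_mult_add_left:
  assumes h: "h \<in> carrier H1" and g: "g \<in> carrier H1" and x: "x \<in> carrier X"
  shows "hardy_mult X (h \<oplus>\<^bsub>H1\<^esub> g) x
      = hardy_mult X h x \<oplus>\<^bsub>L1T X\<^esub> hardy_mult X g x"
proof -
  interpret C: complex_normed_space complex_space by (rule normed_complex_space)
  interpret Ccl: linear_pair "L1F complex_space" "L1T complex_space"
    "L1cl complex_space" by (rule C.L1_class_linear)
  interpret cl: linear_pair "L1F X" "L1T X"
    "L1cl X" by (rule L1_class_linear)
  obtain f f' where f: "integrable circle_measure f" "h = L1cl complex_space f"
    and f': "integrable circle_measure f'" "g = L1cl complex_space f'"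
    using h g by (metis scalar_hardyE)
  have "h \<oplus>\<^bsub>H1\<^esub> g = L1cl complex_space (\<lambda>z. f z + f' z)"
    using Ccl.hom_add[OF integrable_L1_complex[OF f(1)] integrable_L1_complex[OF f'(1)]] f f'
    by (simp add: C.hardy_space_simps L1_functions_simps)
  moreover have "(\<lambda>z. (f z + f' z) \<odot> x) =
      (\<lambda>z. f z \<odot> x) \<oplus>\<^bsub>L1F X\<^esub> (\<lambda>z. f' z \<odot> x)"
    using x by (simp add: L1_functions_simps add_smult)
  ultimately show ?thesis
    using cl.hom_add[OF smult_fun_L1[OF f(1) x] smult_fun_L1[OF f'(1) x]] f f' x
    by (simp add: hardy_mult_class)
qed

lemma hardy_mult_add_right:
  assumes h: "h \<in> carrier H1" and x: "x \<in> carrier X" and y: "y \<in> carrier X"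
  shows "hardy_mult X h (x \<oplus> y) = hardy_mult X h x \<oplus>\<^bsub>L1T X\<^esub> hardy_mult X h y"
proof -
  interpret cl: linear_pair "L1F X" "L1T X"
    "L1cl X" by (rule L1_class_linear)
  obtain f where f: "integrable circle_measure f" "h = L1cl complex_space f"
    using h by (metis scalar_hardyE)
  have "(\<lambda>z. f z \<odot> (x \<oplus> y)) = (\<lambda>z. f z \<odot> x) \<oplus>\<^bsub>L1F X\<^esub> (\<lambda>z. f z \<odot> y)"
    using x y by (simp add: L1_functions_simps smult_add)
  then show ?thesis
    using cl.hom_add[OF smult_fun_L1[OF f(1) x] smult_fun_L1[OF f(1) y]] f x y
    by (simp add: hardy_mult_class)
qed

lemma hardy_mult_smult:
  assumes h: "h \<in> carrier H1" and x: "x \<in> carrier X"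
  shows "hardy_mult X (c \<odot>\<^bsub>H1\<^esub> h) x = c \<odot>\<^bsub>L1T X\<^esub> hardy_mult X h x"
    and "hardy_mult X h (c \<odot> x) = c \<odot>\<^bsub>L1T X\<^esub> hardy_mult X h x"
proof -
  interpret C: complex_normed_space complex_space by (rule normed_complex_space)
  interpret Ccl: linear_pair "L1F complex_space" "L1T complex_space"
    "L1cl complex_space" by (rule C.L1_class_linear)
  interpret cl: linear_pair "L1F X" "L1T X"
    "L1cl X" by (rule L1_class_linear)
  obtain f where f: "integrable circle_measure f" "h = L1cl complex_space f"
    using h by (metis scalar_hardyE)
  have eq: "c \<odot>\<^bsub>L1T X\<^esub> hardy_mult X h x = L1cl X (\<lambda>z. (c * f z) \<odot> x)"
    using cl.hom_smult[OF smult_fun_L1[OF f(1) x], of c] f x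
    by (simp add: hardy_mult_class L1_functions_simps smult_smult)
  have "c \<odot>\<^bsub>H1\<^esub> h = L1cl complex_space (\<lambda>z. c * f z)"
    using Ccl.hom_smult[OF integrable_L1_complex[OF f(1)], of c] f
    by (simp add: C.hardy_space_simps L1_functions_simps)
  then show "hardy_mult X (c \<odot>\<^bsub>H1\<^esub> h) x = c \<odot>\<^bsub>L1T X\<^esub> hardy_mult X h x"
    using eq f x by (simp add: hardy_mult_class)
  show "hardy_mult X h (c \<odot> x) = c \<odot>\<^bsub>L1T X\<^esub> hardy_mult X h x"
    using eq f x by (simp add: hardy_mult_class smult_smult mult.commute)
qed

lemma hardy_mult_scalar_polynomial:
  assumes x: "x \<in> carrier X"
  shows "hardy_mult X (scalar_polynomial n a) x = L1cl X (analytic_polynomial X n (\<lambda>k. a k \<odot> x))"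
proof -
  have "(\<Sum>k\<le>n. a k * z ^ k) \<odot> x = analytic_polynomial X n (\<lambda>k. a k \<odot> x) z" for z
    using x by (simp add: smult_sum analytic_polynomial_def smult_smult mult.commute)
  then show ?thesis
    unfolding scalar_polynomial_def hardy_mult_class[OF integrable_scalar_polynomial x] by simp
qed

text \<open>A polynomial close to \<open>h\<close> has, when multiplied by \<open>x\<close>, a product close to that of \<open>h\<close>.\<close>

lemma hardy_mult_carrier:
  assumes h: "h \<in> carrier H1" and x: "x \<in> carrier X"
  shows "hardy_mult X h x \<in> carrier (hardy_space X)"
proof -
  interpret C: complex_normed_space complex_space by (rule normed_complex_space)
  interpret H: complex_normed_space H1 by (rule C.normed_hardy_space)
  interpret Hl: linear_pair H1 "L1T complex_space" "\<lambda>F. F"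
    by (rule C.hardy_linear)
  interpret cl: linear_pair "L1F X" "L1T X"
    "L1cl X" by (rule L1_class_linear)
  have car: "hardy_mult X h x \<in> carrier (L1T X)" if h: "h \<in> carrier H1" for h
  proof -
    obtain f where f: "integrable circle_measure f" "h = L1cl complex_space f"
      using h by (metis scalar_hardyE)
    then show ?thesis using x smult_fun_L1[OF f(1) x] by (simp add: hardy_mult_class)
  qed
  show ?thesis
    unfolding mem_hardy_iff
  proof (intro conjI allI impI car[OF h])
    fix e :: real assume e: "e > 0"
    define e' where "e' = e / (vnorm X x + 1)"
    have nx: "vnorm X x \<ge> 0" using norm_nonneg x by simp
    have e': "e' > 0" using e nx by (simp add: e'_def)
    obtain P where P: "P \<in> C.polynomial_classes"
      "vnorm (L1T complex_space) (h \<ominus>\<^bsub>L1T complex_space\<^esub> P) < e'"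
      using h e' by (auto simp: C.mem_hardy_iff)
    then obtain n a where a: "P = scalar_polynomial n a"
      by (auto simp: C.polynomial_classes_def scalar_polynomial_def analytic_polynomial_complex)
    have PH: "P \<in> carrier H1" by (rule C.polynomial_class_hardy[OF P(1)])
    have d: "h \<ominus>\<^bsub>H1\<^esub> P \<in> carrier H1" using h PH by simp
    have "hardy_mult X h x = hardy_mult X ((h \<ominus>\<^bsub>H1\<^esub> P) \<oplus>\<^bsub>H1\<^esub> P) x"
      using h PH by (simp add: H.diff_add_cancel)
    also have "\<dots> = hardy_mult X (h \<ominus>\<^bsub>H1\<^esub> P) x \<oplus>\<^bsub>L1T X\<^esub> hardy_mult X P x"
      by (rule hardy_mult_add_left[OF d PH x])
    finally have "hardy_mult X h x \<ominus>\<^bsub>L1T X\<^esub> hardy_mult X P x = hardy_mult X (h \<ominus>\<^bsub>H1\<^esub> P) x"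
      using cl.W.add_diff_cancel[OF car[OF d] car[OF PH]] by simp
    then have "vnorm (L1T X) (hardy_mult X h x \<ominus>\<^bsub>L1T X\<^esub> hardy_mult X P x)
        = vnorm H1 (h \<ominus>\<^bsub>H1\<^esub> P) * vnorm X x"
      using norm_hardy_mult[OF d x] by simp
    also have "\<dots> = vnorm (L1T complex_space) (h \<ominus>\<^bsub>L1T complex_space\<^esub> P) * vnorm X x"
      using Hl.hom_diff[OF h PH] by (simp add: C.hardy_space_simps)
    also have "\<dots> \<le> e' * vnorm X x" using P(2) nx by (intro mult_right_mono) auto
    also have "\<dots> < e" using nx e by (simp add: e'_def field_simps)
    finally show "\<exists>P\<in>polynomial_classes. vnorm (L1T X)
        (hardy_mult X h x \<ominus>\<^bsub>L1T X\<^esub> P) < e"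
      using x unfolding a hardy_mult_scalar_polynomial[OF x] polynomial_classes_def
      by (intro bexI[of _ "L1cl X (analytic_polynomial X n (\<lambda>k. a k \<odot> x))"]) auto
  qed
qed

end


section \<open>Bilinear maps and the algebraic tensor product\<close>

lemma free_space_simps:
  "carrier (free_space A B) = {c. finite {p. c p \<noteq> 0} \<and> {p. c p \<noteq> 0} \<subseteq> carrier A \<times> carrier B}"
  "\<zero>\<^bsub>free_space A B\<^esub> = (\<lambda>p. 0)"
  "c \<oplus>\<^bsub>free_space A B\<^esub> d = (\<lambda>p. c p + d p)"
  "s \<odot>\<^bsub>free_space A B\<^esub> c = (\<lambda>p. s * c p)"
  "vnorm (free_space A B) c = (\<Sum>p | c p \<noteq> 0. cmod (c p) * vnorm A (fst p) * vnorm B (snd p))"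
  by (auto simp: free_space_def)

lemma norm_free_space_superset:
  assumes "finite S" "{p. c p \<noteq> 0} \<subseteq> S"
  shows "vnorm (free_space A B) c = (\<Sum>p\<in>S. cmod (c p) * vnorm A (fst p) * vnorm B (snd p))"
  unfolding free_space_simps using assms by (intro sum.mono_neutral_left) auto

lemma indicator_free_space: "a \<in> carrier A \<Longrightarrow> b \<in> carrier B \<Longrightarrow> indicator {(a, b)} \<in> carrier (free_space A B)"
  by (auto simp: free_space_simps indicator_def split: if_splits)

lemma norm_indicator_free_space:
  "vnorm (free_space A B) (indicator {(a, b)}) = vnorm A a * vnorm B b"
  using norm_free_space_superset[of "{(a, b)}" "indicator {(a, b)}" A B]
  by (auto simp: indicator_def split: if_splits)

lemma seminormed_free_space:
  assumes A: "seminormed_module A" and B: "seminormed_module B"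
  shows "seminormed_module (free_space A B)"
proof (rule seminormed_moduleI)
  interpret A: seminormed_module A by fact
  interpret B: seminormed_module B by fact
  fix c d assume c: "c \<in> carrier (free_space A B)" and d: "d \<in> carrier (free_space A B)"
  let ?S = "{p. c p \<noteq> 0} \<union> {p. d p \<noteq> 0}"
  have S: "finite ?S" "?S \<subseteq> carrier A \<times> carrier B" using c d by (auto simp: free_space_simps(1))
  have sub: "{p. c p + d p \<noteq> 0} \<subseteq> ?S" by auto
  show "c \<oplus>\<^bsub>free_space A B\<^esub> d \<in> carrier (free_space A B)"
    using S sub by (auto simp: free_space_simps(1,3) intro: finite_subset)
  have w: "0 \<le> vnorm A (fst p) * vnorm B (snd p)" if "p \<in> carrier A \<times> carrier B" for p
    using that A.norm_nonneg B.norm_nonneg by (intro mult_nonneg_nonneg) auto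
  have "vnorm (free_space A B) (c \<oplus>\<^bsub>free_space A B\<^esub> d)
      = (\<Sum>p\<in>?S. cmod (c p + d p) * vnorm A (fst p) * vnorm B (snd p))"
    using norm_free_space_superset[OF S(1) sub] by (simp add: free_space_simps(3))
  also have "\<dots> \<le> (\<Sum>p\<in>?S. cmod (c p) * vnorm A (fst p) * vnorm B (snd p)
      + cmod (d p) * vnorm A (fst p) * vnorm B (snd p))"
  proof (rule sum_mono)
    fix p assume "p \<in> ?S"
    then have "0 \<le> vnorm A (fst p) * vnorm B (snd p)" using S(2) w by blast
    from mult_right_mono[OF norm_triangle_ineq[of "c p" "d p"] this]
    show "cmod (c p + d p) * vnorm A (fst p) * vnorm B (snd p)
      \<le> cmod (c p) * vnorm A (fst p) * vnorm B (snd p) + cmod (d p) * vnorm A (fst p) * vnorm B (snd p)"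
      by (simp add: algebra_simps)
  qed
  also have "\<dots> = vnorm (free_space A B) c + vnorm (free_space A B) d"
    using norm_free_space_superset[OF S(1), of c A B] norm_free_space_superset[OF S(1), of d A B]
    by (simp add: sum.distrib)
  finally show "vnorm (free_space A B) (c \<oplus>\<^bsub>free_space A B\<^esub> d)
      \<le> vnorm (free_space A B) c + vnorm (free_space A B) d" .
  have w': "0 \<le> cmod (c p) * vnorm A (fst p) * vnorm B (snd p)" if "p \<in> {p. c p \<noteq> 0}" for p
  proof -
    have "p \<in> carrier A \<times> carrier B" using that S(2) by blast
    from mult_nonneg_nonneg[OF norm_ge_zero w[OF this]] show ?thesis by (simp add: mult.assoc)
  qed
  show "0 \<le> vnorm (free_space A B) c"
    unfolding free_space_simps(5) by (rule sum_nonneg) (rule w')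
  show "s \<odot>\<^bsub>free_space A B\<^esub> c \<in> carrier (free_space A B)" for s
    using c by (auto simp: free_space_simps(1,4) intro: rev_finite_subset)
  show "vnorm (free_space A B) (s \<odot>\<^bsub>free_space A B\<^esub> c) \<le> cmod s * vnorm (free_space A B) c" for s
  proof -
    have "vnorm (free_space A B) (\<lambda>p. s * c p)
        = (\<Sum>p | c p \<noteq> 0. cmod (s * c p) * vnorm A (fst p) * vnorm B (snd p))"
      using c by (intro norm_free_space_superset) (auto simp: free_space_simps(1))
    then show ?thesis
      by (simp add: free_space_simps(4) free_space_simps(5)[of A B c] norm_mult sum_distrib_left mult.assoc)
  qed
qed (auto simp: free_space_simps algebra_simps)

text \<open>The linear extension of \<open>m\<close> from the basis vectors to all formal sums.\<close>

definition linear_extension ::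
    "'c nspace \<Rightarrow> ('a \<Rightarrow> 'b \<Rightarrow> 'c) \<Rightarrow> ('a \<times> 'b \<Rightarrow> complex) \<Rightarrow> 'c" where
  "linear_extension Y m c = (\<Oplus>\<^bsub>Y\<^esub>p\<in>{p. c p \<noteq> 0}. c p \<odot>\<^bsub>Y\<^esub> m (fst p) (snd p))"

text \<open>The submodule generated by the bilinear relations.\<close>

definition tensor_relations :: "'a nspace \<Rightarrow> 'b nspace \<Rightarrow> ('a \<times> 'b \<Rightarrow> complex) set" where
  "tensor_relations A B =
     \<Inter>{N. submodule N complex_ring (free_space A B) \<and> bilinear_relations A B \<subseteq> N}"

lemma tensor_product_eq: "tensor_product A B = quotient_space (free_space A B) (tensor_relations A B)"
  by (simp add: tensor_product_def tensor_relations_def)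

text \<open>Bilinear maps; \<open>L\<close> is the induced linear map, which vanishes on the tensor relations.\<close>

locale bilinear_map = A: seminormed_module A + B: seminormed_module B + Y: seminormed_module Y
  for A :: "'a nspace" and B :: "'b nspace" and Y :: "'c nspace" +
  fixes m :: "'a \<Rightarrow> 'b \<Rightarrow> 'c"
  assumes m_carrier: "a \<in> carrier A \<Longrightarrow> b \<in> carrier B \<Longrightarrow> m a b \<in> carrier Y"
    and m_add_left: "a \<in> carrier A \<Longrightarrow> a' \<in> carrier A \<Longrightarrow> b \<in> carrier B \<Longrightarrow>
      m (a \<oplus>\<^bsub>A\<^esub> a') b = m a b \<oplus>\<^bsub>Y\<^esub> m a' b"
    and m_add_right: "a \<in> carrier A \<Longrightarrow> b \<in> carrier B \<Longrightarrow> b' \<in> carrier B \<Longrightarrow>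
      m a (b \<oplus>\<^bsub>B\<^esub> b') = m a b \<oplus>\<^bsub>Y\<^esub> m a b'"
    and m_smult_left: "a \<in> carrier A \<Longrightarrow> b \<in> carrier B \<Longrightarrow> m (s \<odot>\<^bsub>A\<^esub> a) b = s \<odot>\<^bsub>Y\<^esub> m a b"
    and m_smult_right: "a \<in> carrier A \<Longrightarrow> b \<in> carrier B \<Longrightarrow> m a (s \<odot>\<^bsub>B\<^esub> b) = s \<odot>\<^bsub>Y\<^esub> m a b"
begin

abbreviation "L \<equiv> linear_extension Y m"

lemma linear_extension_superset:
  assumes "finite S" "S \<subseteq> carrier A \<times> carrier B" "{p. c p \<noteq> 0} \<subseteq> S"
  shows "L c = (\<Oplus>\<^bsub>Y\<^esub>p\<in>S. c p \<odot>\<^bsub>Y\<^esub> m (fst p) (snd p))"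
  unfolding linear_extension_def
proof (rule Y.finsum_mono_neutral[symmetric])
  have mp: "m (fst p) (snd p) \<in> carrier Y" if "p \<in> S" for p
    using assms(2) that by (auto intro!: m_carrier)
  show "c p \<odot>\<^bsub>Y\<^esub> m (fst p) (snd p) \<in> carrier Y" if "p \<in> {p. c p \<noteq> 0}" for p
    using mp[of p] assms(3) that by auto
  show "c p \<odot>\<^bsub>Y\<^esub> m (fst p) (snd p) = \<zero>\<^bsub>Y\<^esub>" if "p \<in> S - {p. c p \<noteq> 0}" for p
    using mp[of p] that by simp
qed (use assms in auto)

lemma linear_extension_linear: "linear_pair (free_space A B) Y L"
proof (intro linear_pair.intro linear_pair_axioms.intro seminormed_free_space linear_onI)
  show "seminormed_module A" "seminormed_module B" "seminormed_module Y" by unfold_locales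
  fix c d assume c: "c \<in> carrier (free_space A B)" and d: "d \<in> carrier (free_space A B)"
  let ?S = "{p. c p \<noteq> 0} \<union> {p. d p \<noteq> 0}"
  have S: "finite ?S" "?S \<subseteq> carrier A \<times> carrier B" using c d by (auto simp: free_space_simps(1))
  have mp: "m (fst p) (snd p) \<in> carrier Y" if "p \<in> ?S" for p
  proof -
    have "p \<in> carrier A \<times> carrier B" using that S(2) by blast
    then show ?thesis by (auto intro!: m_carrier)
  qed
  have cl: "(\<lambda>p. c p \<odot>\<^bsub>Y\<^esub> m (fst p) (snd p)) \<in> ?S \<rightarrow> carrier Y" for c
    using mp by blast
  show "L c \<in> carrier Y"
    unfolding linear_extension_superset[OF S, of c, simplified] by (rule Y.finsum_closed[OF cl])
  have "L (c \<oplus>\<^bsub>free_space A B\<^esub> d) = (\<Oplus>\<^bsub>Y\<^esub>p\<in>?S. (c p + d p) \<odot>\<^bsub>Y\<^esub> m (fst p) (snd p))"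
    by (subst linear_extension_superset[OF S]) (auto simp: free_space_simps(3))
  also have "\<dots> = (\<Oplus>\<^bsub>Y\<^esub>p\<in>?S. c p \<odot>\<^bsub>Y\<^esub> m (fst p) (snd p) \<oplus>\<^bsub>Y\<^esub> d p \<odot>\<^bsub>Y\<^esub> m (fst p) (snd p))"
    using mp by (intro Y.finsum_cong') (auto simp: Y.add_smult)
  also have "\<dots> = (\<Oplus>\<^bsub>Y\<^esub>p\<in>?S. c p \<odot>\<^bsub>Y\<^esub> m (fst p) (snd p)) \<oplus>\<^bsub>Y\<^esub> (\<Oplus>\<^bsub>Y\<^esub>p\<in>?S. d p \<odot>\<^bsub>Y\<^esub> m (fst p) (snd p))"
    by (rule Y.finsum_addf[OF cl cl])
  also have "\<dots> = L c \<oplus>\<^bsub>Y\<^esub> L d"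
    by (simp add: linear_extension_superset[OF S])
  finally show "L (c \<oplus>\<^bsub>free_space A B\<^esub> d) = L c \<oplus>\<^bsub>Y\<^esub> L d" .
  fix s
  have "L (s \<odot>\<^bsub>free_space A B\<^esub> c) = (\<Oplus>\<^bsub>Y\<^esub>p\<in>?S. (s * c p) \<odot>\<^bsub>Y\<^esub> m (fst p) (snd p))"
    by (subst linear_extension_superset[OF S]) (auto simp: free_space_simps(4))
  also have "\<dots> = (\<Oplus>\<^bsub>Y\<^esub>p\<in>?S. s \<odot>\<^bsub>Y\<^esub> (c p \<odot>\<^bsub>Y\<^esub> m (fst p) (snd p)))"
    using mp by (intro Y.finsum_cong') (auto simp: Y.smult_smult)
  also have "\<dots> = s \<odot>\<^bsub>Y\<^esub> L c"
    using Y.finsum_smult[OF S(1), of "\<lambda>p. c p \<odot>\<^bsub>Y\<^esub> m (fst p) (snd p)" s] mp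
    by (simp add: linear_extension_superset[OF S])
  finally show "L (s \<odot>\<^bsub>free_space A B\<^esub> c) = s \<odot>\<^bsub>Y\<^esub> L c" .
qed

lemma linear_extension_indicator:
  "a \<in> carrier A \<Longrightarrow> b \<in> carrier B \<Longrightarrow> L (indicator {(a, b)}) = m a b"
  using linear_extension_superset[of "{(a, b)}" "indicator {(a, b)}"] m_carrier[of a b]
  by (auto simp: indicator_def Y.finsum_singleton split: if_splits)

lemma submodule_kernel: "submodule {c \<in> carrier (free_space A B). L c = \<zero>\<^bsub>Y\<^esub>} complex_ring (free_space A B)"
proof -
  interpret L: linear_pair "free_space A B" Y L by (rule linear_extension_linear)
  show ?thesis
    by (rule L.V.submoduleI) (auto simp: L.hom_add L.hom_smult L.hom_uminus)
qed

lemma relations_kernel: "bilinear_relations A B \<subseteq> {c \<in> carrier (free_space A B). L c = \<zero>\<^bsub>Y\<^esub>}"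
proof -
  interpret L: linear_pair "free_space A B" Y L by (rule linear_extension_linear)
  let ?F = "free_space A B"
  let ?i = "\<lambda>a b. indicator {(a, b)} :: 'a \<times> 'b \<Rightarrow> complex"
  have diff: "(\<lambda>p. c p - s * d p) \<in> carrier ?F \<and> L (\<lambda>p. c p - s * d p) = L c \<ominus>\<^bsub>Y\<^esub> s \<odot>\<^bsub>Y\<^esub> L d"
    if cd: "c \<in> carrier ?F" "d \<in> carrier ?F" for c d s
  proof -
    have "(\<lambda>p. c p - s * d p) = c \<oplus>\<^bsub>?F\<^esub> (- s) \<odot>\<^bsub>?F\<^esub> d" by (simp add: free_space_simps)
    then show ?thesis
      using cd by (simp add: L.hom_add L.hom_smult Y.minus_smult a_minus_def)
  qed
  note diff1 = diff[of _ _ 1, simplified]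
  let ?K = "{c \<in> carrier ?F. L c = \<zero>\<^bsub>Y\<^esub>}"
  have 1: "(\<lambda>p. ?i (a \<oplus>\<^bsub>A\<^esub> a') b p - ?i a b p - ?i a' b p) \<in> ?K"
    if "a \<in> carrier A" "a' \<in> carrier A" "b \<in> carrier B" for a a' b
  proof -
    have i: "?i (a \<oplus>\<^bsub>A\<^esub> a') b \<in> carrier ?F" "?i a b \<in> carrier ?F" "?i a' b \<in> carrier ?F"
      using that by (auto intro!: indicator_free_space)
    note d = diff1[OF i(1,2)]
    note d' = diff1[OF conjunct1[OF d] i(3)]
    have "L (\<lambda>p. ?i (a \<oplus>\<^bsub>A\<^esub> a') b p - ?i a b p) = (m a b \<oplus>\<^bsub>Y\<^esub> m a' b) \<ominus>\<^bsub>Y\<^esub> m a b"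
      using d that by (simp add: linear_extension_indicator m_add_left m_carrier)
    then show ?thesis
      using d' that by (simp add: linear_extension_indicator m_carrier Y.add_diff_cancel_left)
  qed
  have 2: "(\<lambda>p. ?i a (b \<oplus>\<^bsub>B\<^esub> b') p - ?i a b p - ?i a b' p) \<in> ?K"
    if "a \<in> carrier A" "b \<in> carrier B" "b' \<in> carrier B" for a b b'
  proof -
    have i: "?i a (b \<oplus>\<^bsub>B\<^esub> b') \<in> carrier ?F" "?i a b \<in> carrier ?F" "?i a b' \<in> carrier ?F"
      using that by (auto intro!: indicator_free_space)
    note d = diff1[OF i(1,2)]
    note d' = diff1[OF conjunct1[OF d] i(3)]
    have "L (\<lambda>p. ?i a (b \<oplus>\<^bsub>B\<^esub> b') p - ?i a b p) = (m a b \<oplus>\<^bsub>Y\<^esub> m a b') \<ominus>\<^bsub>Y\<^esub> m a b"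
      using d that by (simp add: linear_extension_indicator m_add_right m_carrier)
    then show ?thesis
      using d' that by (simp add: linear_extension_indicator m_carrier Y.add_diff_cancel_left)
  qed
  have 3: "(\<lambda>p. ?i (s \<odot>\<^bsub>A\<^esub> a) b p - s * ?i a b p) \<in> ?K" if "a \<in> carrier A" "b \<in> carrier B" for s a b
  proof -
    have i: "?i (s \<odot>\<^bsub>A\<^esub> a) b \<in> carrier ?F" "?i a b \<in> carrier ?F"
      using that by (auto intro!: indicator_free_space)
    show ?thesis
      using diff[OF i, of s] that by (simp add: linear_extension_indicator m_smult_left m_carrier)
  qed
  have 4: "(\<lambda>p. ?i a (s \<odot>\<^bsub>B\<^esub> b) p - s * ?i a b p) \<in> ?K" if "a \<in> carrier A" "b \<in> carrier B" for s a b
  proof -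
    have i: "?i a (s \<odot>\<^bsub>B\<^esub> b) \<in> carrier ?F" "?i a b \<in> carrier ?F"
      using that by (auto intro!: indicator_free_space)
    show ?thesis
      using diff[OF i, of s] that by (simp add: linear_extension_indicator m_smult_right m_carrier)
  qed
  show "bilinear_relations A B \<subseteq> ?K"
    unfolding bilinear_relations_def
    by (intro Un_least subsetI; elim CollectE exE conjE) (simp_all only: 1 2 3 4)
qed

lemma tensor_relations_kernel: "r \<in> tensor_relations A B \<Longrightarrow> L r = \<zero>\<^bsub>Y\<^esub>"
  using submodule_kernel relations_kernel unfolding tensor_relations_def by blast

end

lemma quotient_pair_tensor:
  assumes A: "seminormed_module A" and B: "seminormed_module B"
  shows "quotient_pair (free_space A B) (tensor_relations A B)"
proof -
  interpret F: seminormed_module "free_space A B" by (rule seminormed_free_space[OF assms])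
  interpret A: seminormed_module A by fact
  interpret B: seminormed_module B by fact
  interpret C: complex_normed_space complex_space by (rule normed_complex_space)
  \<comment> \<open>Any bilinear map shows that the relations belong to the space of formal sums; zero will do.\<close>
  interpret zero: bilinear_map A B complex_space "\<lambda>_ _. 0"
    by unfold_locales auto
  have rel: "bilinear_relations A B \<subseteq> carrier (free_space A B)"
    using zero.relations_kernel by blast
  have mem: "x \<in> tensor_relations A B \<longleftrightarrow>
      (\<forall>N. submodule N complex_ring (free_space A B) \<longrightarrow> bilinear_relations A B \<subseteq> N \<longrightarrow> x \<in> N)" for x
    by (auto simp: tensor_relations_def)
  have uminus: "\<ominus>\<^bsub>free_space A B\<^esub> x \<in> N" if "submodule N complex_ring (free_space A B)" "x \<in> N" for x N
    using submodule_mem(3)[OF that, of "- 1"] F.minus_smult[of x 1] submodule_mem(4)[OF that(1)] that(2) by auto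
  have "submodule (tensor_relations A B) complex_ring (free_space A B)"
  proof (rule F.submoduleI)
    show "tensor_relations A B \<subseteq> carrier (free_space A B)"
      using F.carrier_is_submodule rel by (auto simp: mem)
  qed (auto simp: mem intro: submodule_mem uminus)
  then show ?thesis
    by (intro quotient_pair.intro quotient_pair_axioms.intro F.seminormed_module_axioms)
qed


section \<open>Completions\<close>

lemma cauchy_sequences_simps:
  "carrier (cauchy_sequences V) =
     {u. range u \<subseteq> carrier V \<and> (\<forall>e>0. \<exists>N. \<forall>m\<ge>N. \<forall>n\<ge>N. vnorm V (u m \<ominus>\<^bsub>V\<^esub> u n) < e)}"
  "u \<oplus>\<^bsub>cauchy_sequences V\<^esub> v = (\<lambda>n. u n \<oplus>\<^bsub>V\<^esub> v n)"
  "vnorm (cauchy_sequences V) u = lim (\<lambda>n. vnorm V (u n))"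
  by (auto simp: cauchy_sequences_def)

text \<open>The null sequences among the Cauchy sequences, and the class of a Cauchy sequence modulo them.\<close>

definition null_sequences :: "'a nspace \<Rightarrow> (nat \<Rightarrow> 'a) set" where
  "null_sequences V = {u \<in> carrier (cauchy_sequences V). (\<lambda>n. vnorm V (u n)) \<longlonglongrightarrow> 0}"

definition completion_class :: "'a nspace \<Rightarrow> (nat \<Rightarrow> 'a) \<Rightarrow> (nat \<Rightarrow> 'a) set" where
  "completion_class V u = null_sequences V +>\<^bsub>cauchy_sequences V\<^esub> u"

lemma carrier_completion: "carrier (completion V) = completion_class V ` carrier (cauchy_sequences V)"
  by (auto simp: completion_def quotient_space_simps A_RCOSETS_def' null_sequences_def completion_class_def)

lemma mem_completion_class: "w \<in> completion_class V u \<longleftrightarrow> (\<exists>v\<in>null_sequences V. w = (\<lambda>n. v n \<oplus>\<^bsub>V\<^esub> u n))"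
  by (auto simp: completion_class_def a_r_coset_def' cauchy_sequences_simps(2))

context seminormed_module
begin

lemma zero_null_sequence: "(\<lambda>n. \<zero>) \<in> null_sequences V"
  by (simp add: null_sequences_def cauchy_sequences_simps)

lemma mem_completion_class_self: "u \<in> carrier (cauchy_sequences V) \<Longrightarrow> u \<in> completion_class V u"
  unfolding mem_completion_class
  by (intro bexI[OF _ zero_null_sequence]) (auto simp: cauchy_sequences_simps image_subset_iff)

lemma const_cauchy: "x \<in> carrier V \<Longrightarrow> (\<lambda>_. x) \<in> carrier (cauchy_sequences V)"
  by (simp add: cauchy_sequences_simps)

lemma norm_completion_const:
  assumes x: "x \<in> carrier V"
  shows "vnorm (completion V) (completion_class V (\<lambda>_. x)) = vnorm V x"
proof -
  have "lim (\<lambda>n. vnorm V (w n)) = vnorm V x" if w: "w \<in> completion_class V (\<lambda>_. x)" for w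
  proof -
    obtain v where v: "v \<in> null_sequences V" "w = (\<lambda>n. v n \<oplus> x)"
      using w by (auto simp: mem_completion_class)
    have vV: "v n \<in> carrier V" for n
      using v by (auto simp: null_sequences_def cauchy_sequences_simps)
    have "(\<lambda>n. vnorm V (w n) - vnorm V x) \<longlonglongrightarrow> 0"
    proof (rule Lim_null_comparison)
      show "(\<lambda>n. vnorm V (v n)) \<longlonglongrightarrow> 0" using v by (simp add: null_sequences_def)
      have "\<bar>vnorm V (w n) - vnorm V x\<bar> \<le> vnorm V (v n)" for n
        using abs_norm_diff_le[of "w n" x] vV x by (simp add: v(2) add_diff_cancel)
      then show "\<forall>\<^sub>F n in sequentially. norm (vnorm V (w n) - vnorm V x) \<le> vnorm V (v n)" by simp
    qed
    then show ?thesis by (intro limI) (rule LIM_zero_cancel)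
  qed
  then have "(\<lambda>w. lim (\<lambda>n. vnorm V (w n))) ` completion_class V (\<lambda>_. x) = {vnorm V x}"
    using mem_completion_class_self[OF const_cauchy[OF x]] by (auto simp: image_iff)
  then show ?thesis
    by (simp add: completion_def quotient_space_simps cauchy_sequences_simps(3))
qed

end

section \<open>The canonical inclusion\<close>

abbreviation H1_tensor where
  "H1_tensor X \<equiv> tensor_product H1 X"

context complex_normed_space
begin

lemma bilinear_hardy_mult: "bilinear_map H1 X (hardy_space X) (hardy_mult X)"
proof -
  interpret C: complex_normed_space complex_space by (rule normed_complex_space)
  interpret A: complex_normed_space H1 by (rule C.normed_hardy_space)
  interpret Y: complex_normed_space "hardy_space X" by (rule normed_hardy_space)
  show ?thesis
    by (intro bilinear_map.intro bilinear_map_axioms.intro A.seminormed_module_axioms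
        seminormed_module_axioms Y.seminormed_module_axioms)
       (auto simp: hardy_mult_carrier hardy_mult_add_left hardy_mult_add_right hardy_mult_smult
         hardy_space_simps)
qed

lemma tensor_quotient: "quotient_pair (free_space H1 X) (tensor_relations H1 X)"
proof -
  interpret b: bilinear_map H1 X "hardy_space X" "hardy_mult X" by (rule bilinear_hardy_mult)
  show ?thesis
    by (rule quotient_pair_tensor[OF b.A.seminormed_module_axioms seminormed_module_axioms])
qed

text \<open>The tensor represented by a formal sum of pairs.\<close>

definition tensor_class ::
    "((complex \<Rightarrow> complex) set \<times> 'a \<Rightarrow> complex) \<Rightarrow> ((complex \<Rightarrow> complex) set \<times> 'a \<Rightarrow> complex) set" where
  "tensor_class c = tensor_relations H1 X +>\<^bsub>free_space H1 X\<^esub> c"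

lemma tensor_inclusion_class:
  assumes c: "c \<in> carrier (free_space H1 X)"
  shows "tensor_inclusion X (tensor_class c) = linear_extension (hardy_space X) (hardy_mult X) c"
proof -
  interpret b: bilinear_map H1 X "hardy_space X" "hardy_mult X" by (rule bilinear_hardy_mult)
  interpret L: linear_pair "free_space H1 X" "hardy_space X" b.L
    by (rule b.linear_extension_linear)
  interpret Q: quotient_pair "free_space H1 X" "tensor_relations H1 X"
    by (rule tensor_quotient)
  have eq: "b.L d = b.L c" if d: "d \<in> tensor_class c" for d
  proof -
    obtain r where r: "r \<in> tensor_relations H1 X" "d = r \<oplus>\<^bsub>free_space H1 X\<^esub> c"
      using d unfolding tensor_class_def Q.mem_q_iff by blast
    have "r \<in> carrier (free_space H1 X)" using Q.N.a_subset r(1) by blast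
    then show ?thesis
      using c r b.tensor_relations_kernel[OF r(1)] by (simp add: L.hom_add)
  qed
  have "c \<in> tensor_class c"
    unfolding tensor_class_def by (rule Q.N.a_rcos_self[OF c])
  then show ?thesis
    using eq unfolding tensor_inclusion_def linear_extension_def[symmetric] by blast
qed

lemma carrier_tensor:
  "carrier (H1_tensor X) = tensor_class ` carrier (free_space H1 X)"
proof -
  interpret Q: quotient_pair "free_space H1 X" "tensor_relations H1 X"
    by (rule tensor_quotient)
  show ?thesis using Q.carrier_Q by (simp add: tensor_product_eq tensor_class_def[abs_def])
qed

lemma norm_tensor_class_le:
  "c \<in> carrier (free_space H1 X) \<Longrightarrow>
     vnorm (H1_tensor X) (tensor_class c) \<le> vnorm (free_space H1 X) c"
proof -
  interpret Q: quotient_pair "free_space H1 X" "tensor_relations H1 X"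
    by (rule tensor_quotient)
  assume "c \<in> carrier (free_space H1 X)"
  then show ?thesis using Q.norm_q_le_norm by (simp add: tensor_product_eq tensor_class_def)
qed

lemma norm_tensor_class_lessD:
  assumes c: "c \<in> carrier (free_space H1 X)"
    and less: "vnorm (H1_tensor X) (tensor_class c) < r"
  obtains d where "d \<in> carrier (free_space H1 X)" "tensor_class d = tensor_class c"
    "vnorm (free_space H1 X) d < r"
    "d \<ominus>\<^bsub>free_space H1 X\<^esub> c \<in> tensor_relations H1 X"
proof -
  interpret Q: quotient_pair "free_space H1 X" "tensor_relations H1 X"
    by (rule tensor_quotient)
  obtain d where d: "d \<in> tensor_class c" "vnorm (free_space H1 X) d < r"
    using Q.norm_q_lessD[OF c] less unfolding tensor_product_eq tensor_class_def by blast
  show ?thesis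
    using that[of d] d Q.q_rep[OF c] Q.mem_q_iff_diff[OF c] unfolding tensor_class_def by blast
qed

lemma tensor_inclusion_linear:
  "linear_pair (H1_tensor X) (hardy_space X) (tensor_inclusion X)"
proof -
  interpret b: bilinear_map H1 X "hardy_space X" "hardy_mult X" by (rule bilinear_hardy_mult)
  interpret L: linear_pair "free_space H1 X" "hardy_space X" b.L
    by (rule b.linear_extension_linear)
  interpret Q: quotient_pair "free_space H1 X" "tensor_relations H1 X"
    by (rule tensor_quotient)
  have add: "tensor_class c \<oplus>\<^bsub>H1_tensor X\<^esub> tensor_class d
      = tensor_class (c \<oplus>\<^bsub>free_space H1 X\<^esub> d)"
    if "c \<in> carrier (free_space H1 X)" "d \<in> carrier (free_space H1 X)" for c d
    using Q.q_add[OF that] by (simp add: tensor_product_eq tensor_class_def)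
  have smult: "s \<odot>\<^bsub>H1_tensor X\<^esub> tensor_class c
      = tensor_class (s \<odot>\<^bsub>free_space H1 X\<^esub> c)"
    if "c \<in> carrier (free_space H1 X)" for c s
    using Q.q_smult[OF that] by (simp add: tensor_product_eq tensor_class_def)
  have Tsem: "seminormed_module (H1_tensor X)"
    unfolding tensor_product_eq by (rule Q.seminormed_Q)
  show ?thesis
  proof (intro linear_pair.intro linear_pair_axioms.intro Tsem b.Y.seminormed_module_axioms linear_onI)
    fix x y s
    assume x: "x \<in> carrier (H1_tensor X)"
    then obtain c where c: "c \<in> carrier (free_space H1 X)" "x = tensor_class c"
      by (auto simp: carrier_tensor)
    show "tensor_inclusion X x \<in> carrier (hardy_space X)"
      using c by (simp add: tensor_inclusion_class)
    show "tensor_inclusion X (s \<odot>\<^bsub>H1_tensor X\<^esub> x) = s \<odot>\<^bsub>hardy_space X\<^esub> tensor_inclusion X x"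
      using c by (simp add: smult tensor_inclusion_class L.hom_smult)
    assume y: "y \<in> carrier (H1_tensor X)"
    then obtain d where d: "d \<in> carrier (free_space H1 X)" "y = tensor_class d"
      by (auto simp: carrier_tensor)
    show "tensor_inclusion X (x \<oplus>\<^bsub>H1_tensor X\<^esub> y)
        = tensor_inclusion X x \<oplus>\<^bsub>hardy_space X\<^esub> tensor_inclusion X y"
      using c d by (simp add: add tensor_inclusion_class L.hom_add)
  qed
qed

lemma norm_tensor_inclusion_le:
  assumes t: "t \<in> carrier (H1_tensor X)"
  shows "vnorm (hardy_space X) (tensor_inclusion X t) \<le> vnorm (H1_tensor X) t"
proof (rule field_le_epsilon)
  interpret b: bilinear_map H1 X "hardy_space X" "hardy_mult X" by (rule bilinear_hardy_mult)
  fix e :: real assume "e > 0"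
  obtain c where c: "c \<in> carrier (free_space H1 X)" "t = tensor_class c"
    using t by (auto simp: carrier_tensor)
  obtain d where d: "d \<in> carrier (free_space H1 X)" "tensor_class d = tensor_class c"
    "vnorm (free_space H1 X) d < vnorm (H1_tensor X) t + e"
    using norm_tensor_class_lessD[OF c(1), of "vnorm (H1_tensor X) t + e"] c(2) \<open>e > 0\<close> by auto
  have fin: "finite {p. d p \<noteq> 0}" "{p. d p \<noteq> 0} \<subseteq> carrier H1 \<times> carrier X"
    using d(1) by (auto simp: free_space_simps(1))
  have p: "hardy_mult X (fst p) (snd p) \<in> carrier (hardy_space X)"
    "vnorm (hardy_space X) (hardy_mult X (fst p) (snd p)) = vnorm H1 (fst p) * vnorm X (snd p)"
    if "p \<in> {p. d p \<noteq> 0}" for p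
  proof -
    have "fst p \<in> carrier H1" "snd p \<in> carrier X" using that fin(2) by force+
    then show "hardy_mult X (fst p) (snd p) \<in> carrier (hardy_space X)"
      "vnorm (hardy_space X) (hardy_mult X (fst p) (snd p)) = vnorm H1 (fst p) * vnorm X (snd p)"
      by (simp_all add: hardy_mult_carrier norm_hardy_mult hardy_space_simps)
  qed
  have "vnorm (hardy_space X) (tensor_inclusion X t) = vnorm (hardy_space X) (b.L d)"
    using c d tensor_inclusion_class by metis
  also have "\<dots> \<le> (\<Sum>p | d p \<noteq> 0. vnorm (hardy_space X) (d p \<odot>\<^bsub>hardy_space X\<^esub> hardy_mult X (fst p) (snd p)))"
    unfolding linear_extension_def using fin(1) p(1) by (intro b.Y.norm_finsum_le b.Y.smult_carrier) auto
  also have "\<dots> = vnorm (free_space H1 X) d"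
    unfolding free_space_simps(5) using p by (intro sum.cong refl) (simp add: b.Y.norm_smult mult.assoc)
  finally show "vnorm (hardy_space X) (tensor_inclusion X t) \<le> vnorm (H1_tensor X) t + e"
    using d(3) by simp
qed

end

context complex_banach_space
begin

text \<open>
  The inclusion is contractive on the algebraic tensor product, so a null sequence does not change
  the limit, and limits in the Hardy space are unique.
\<close>

lemma hardy_inclusion_eq:
  assumes u: "u \<in> carrier (cauchy_sequences (H1_tensor X))"
    and F: "F \<in> carrier (hardy_space X)"
      "(\<lambda>n. vnorm (hardy_space X) (tensor_inclusion X (u n) \<ominus>\<^bsub>hardy_space X\<^esub> F)) \<longlonglongrightarrow> 0"
  shows "hardy_inclusion X (completion_class (H1_tensor X) u) = F"
  unfolding hardy_inclusion_def
proof (rule the_equality)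
  interpret i: linear_pair "H1_tensor X" "hardy_space X" "tensor_inclusion X"
    by (rule tensor_inclusion_linear)
  interpret H: complex_normed_space "hardy_space X" by (rule normed_hardy_space)
  let ?T = "H1_tensor X"
  have uT: "u n \<in> carrier ?T" for n using u by (auto simp: cauchy_sequences_simps)
  show "\<forall>w\<in>completion_class ?T u. limitin (norm_topology (hardy_space X)) (\<lambda>n. tensor_inclusion X (w n)) F sequentially"
  proof
    fix w assume "w \<in> completion_class ?T u"
    then obtain v where v: "v \<in> null_sequences ?T" "w = (\<lambda>n. v n \<oplus>\<^bsub>?T\<^esub> u n)"
      by (auto simp: mem_completion_class)
    have vT: "v n \<in> carrier ?T" for n using v by (auto simp: null_sequences_def cauchy_sequences_simps)
    have v0: "(\<lambda>n. vnorm ?T (v n)) \<longlonglongrightarrow> 0" using v by (simp add: null_sequences_def)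
    have "(\<lambda>n. vnorm (hardy_space X) (tensor_inclusion X (w n) \<ominus>\<^bsub>hardy_space X\<^esub> F)) \<longlonglongrightarrow> 0"
    proof (rule Lim_null_comparison)
      show "(\<lambda>n. vnorm ?T (v n) + vnorm (hardy_space X) (tensor_inclusion X (u n) \<ominus>\<^bsub>hardy_space X\<^esub> F)) \<longlonglongrightarrow> 0"
        using tendsto_add[OF v0 F(2)] by simp
      have "vnorm (hardy_space X) (tensor_inclusion X (w n) \<ominus>\<^bsub>hardy_space X\<^esub> F)
          \<le> vnorm ?T (v n) + vnorm (hardy_space X) (tensor_inclusion X (u n) \<ominus>\<^bsub>hardy_space X\<^esub> F)" for n
      proof -
        have "tensor_inclusion X (w n) \<ominus>\<^bsub>hardy_space X\<^esub> F
            = tensor_inclusion X (v n) \<oplus>\<^bsub>hardy_space X\<^esub> (tensor_inclusion X (u n) \<ominus>\<^bsub>hardy_space X\<^esub> F)"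
          using vT uT F(1) by (simp add: v(2) i.hom_add a_minus_def i.W.a_assoc)
        then show ?thesis
          using i.W.norm_triangle[of "tensor_inclusion X (v n)" "tensor_inclusion X (u n) \<ominus>\<^bsub>hardy_space X\<^esub> F"]
            norm_tensor_inclusion_le[OF vT, of n] vT uT F(1) by simp
      qed
      then show "\<forall>\<^sub>F n in sequentially. norm (vnorm (hardy_space X) (tensor_inclusion X (w n) \<ominus>\<^bsub>hardy_space X\<^esub> F))
          \<le> vnorm ?T (v n) + vnorm (hardy_space X) (tensor_inclusion X (u n) \<ominus>\<^bsub>hardy_space X\<^esub> F)"
        using vT uT F(1) v(2) by (simp add: i.W.norm_nonneg)
    qed
    then show "limitin (norm_topology (hardy_space X)) (\<lambda>n. tensor_inclusion X (w n)) F sequentially"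
      using H.limitin_iff[of "\<lambda>n. tensor_inclusion X (w n)" F] vT uT F(1) by (simp add: v(2))
  qed
  fix G assume "\<forall>w\<in>completion_class ?T u. limitin (norm_topology (hardy_space X)) (\<lambda>n. tensor_inclusion X (w n)) G sequentially"
  then have "limitin (norm_topology (hardy_space X)) (\<lambda>n. tensor_inclusion X (u n)) G sequentially"
    using i.V.mem_completion_class_self[OF u] by blast
  moreover have "limitin (norm_topology (hardy_space X)) (\<lambda>n. tensor_inclusion X (u n)) F sequentially"
    using H.limitin_iff[of "\<lambda>n. tensor_inclusion X (u n)" F] uT F by simp
  ultimately show "G = F"
    unfolding norm_topology_def by (rule H.limitin_metric_unique) simp
qed

lemma tensor_inclusion_convergent:
  assumes u: "u \<in> carrier (cauchy_sequences (H1_tensor X))"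
  shows "\<exists>F\<in>carrier (hardy_space X).
    (\<lambda>n. vnorm (hardy_space X) (tensor_inclusion X (u n) \<ominus>\<^bsub>hardy_space X\<^esub> F)) \<longlonglongrightarrow> 0"
proof -
  interpret i: linear_pair "H1_tensor X" "hardy_space X" "tensor_inclusion X"
    by (rule tensor_inclusion_linear)
  interpret H: complex_banach_space "hardy_space X" by (rule banach_hardy_space)
  let ?T = "H1_tensor X"
  have uT: "u n \<in> carrier ?T" for n using u by (auto simp: cauchy_sequences_simps)
  have "H.MCauchy (\<lambda>n. tensor_inclusion X (u n))"
    unfolding H.MCauchy_def
  proof (intro conjI allI impI)
    show "range (\<lambda>n. tensor_inclusion X (u n)) \<subseteq> carrier (hardy_space X)" using uT by auto
    fix e :: real assume "e > 0"
    moreover have "\<forall>e>0. \<exists>N. \<forall>m\<ge>N. \<forall>n\<ge>N. vnorm ?T (u m \<ominus>\<^bsub>?T\<^esub> u n) < e"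
      using u by (simp add: cauchy_sequences_simps(1))
    ultimately obtain N where N: "\<And>m n. m \<ge> N \<Longrightarrow> n \<ge> N \<Longrightarrow> vnorm ?T (u m \<ominus>\<^bsub>?T\<^esub> u n) < e"
      by meson
    have "vdist (hardy_space X) (tensor_inclusion X (u m)) (tensor_inclusion X (u n)) < e" if "m \<ge> N" "n \<ge> N" for m n
      using norm_tensor_inclusion_le[of "u m \<ominus>\<^bsub>?T\<^esub> u n"] N[OF that] uT
      by (simp add: H.vdist_eq i.hom_diff)
    then show "\<exists>N. \<forall>m n. N \<le> m \<longrightarrow> N \<le> n \<longrightarrow>
        vdist (hardy_space X) (tensor_inclusion X (u m)) (tensor_inclusion X (u n)) < e" by blast
  qed
  then obtain F where "limitin H.mtopology (\<lambda>n. tensor_inclusion X (u n)) F sequentially"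
    using H.complete unfolding H.mcomplete_def by blast
  then show ?thesis
    using H.limitin_iff[of "\<lambda>n. tensor_inclusion X (u n)" F] uT by (auto simp: norm_topology_def)
qed

lemma hardy_inclusion_carrier:
  assumes "\<xi> \<in> carrier (hardy_tensor X)"
  shows "hardy_inclusion X \<xi> \<in> carrier (hardy_space X)"
proof -
  obtain u where "u \<in> carrier (cauchy_sequences (H1_tensor X))"
    "\<xi> = completion_class (H1_tensor X) u"
    using assms by (auto simp: projective_tensor_def carrier_completion)
  then show ?thesis using tensor_inclusion_convergent[of u] hardy_inclusion_eq[of u] by auto
qed

text \<open>A tensor and the class of the constant sequence at it have the same norm and the same image.\<close>

lemma H1_constant_norm_le:
  assumes const: "H1_constant X < ennreal c" and t: "t \<in> carrier (H1_tensor X)"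
  shows "vnorm (H1_tensor X) t \<le> c * vnorm (hardy_space X) (tensor_inclusion X t)"
proof -
  interpret i: linear_pair "H1_tensor X" "hardy_space X" "tensor_inclusion X"
    by (rule tensor_inclusion_linear)
  let ?\<xi> = "completion_class (H1_tensor X) (\<lambda>_. t)"
  have \<xi>: "?\<xi> \<in> carrier (hardy_tensor X)"
    using i.V.const_cauchy[OF t] by (simp add: projective_tensor_def carrier_completion)
  have incl: "hardy_inclusion X ?\<xi> = tensor_inclusion X t"
    using t by (intro hardy_inclusion_eq i.V.const_cauchy) auto
  have norm: "vnorm (hardy_tensor X) ?\<xi> = vnorm (H1_tensor X) t"
    unfolding projective_tensor_def by (rule i.V.norm_completion_const[OF t])
  obtain c' where c': "c' < ennreal c" "\<forall>\<xi>\<in>carrier (hardy_tensor X).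
      ennreal (vnorm (hardy_tensor X) \<xi>) \<le> c' * ennreal (vnorm (hardy_space X) (hardy_inclusion X \<xi>))"
    using const unfolding H1_constant_def Inf_less_iff by blast
  have c0: "0 < c"
    using c'(1) by (metis ennreal_neg linorder_not_le not_less_zero)
  have "ennreal (vnorm (H1_tensor X) t) \<le> c' * ennreal (vnorm (hardy_space X) (tensor_inclusion X t))"
    using c'(2)[rule_format, OF \<xi>] by (simp add: incl norm)
  also have "\<dots> \<le> ennreal c * ennreal (vnorm (hardy_space X) (tensor_inclusion X t))"
    using c'(1) by (intro mult_right_mono) auto
  also have "\<dots> = ennreal (c * vnorm (hardy_space X) (tensor_inclusion X t))"
    using c0 t by (intro ennreal_mult[symmetric]) (auto simp: i.W.norm_nonneg)
  finally show ?thesis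
  proof (subst (asm) ennreal_le_iff)
    show "0 \<le> c * vnorm (hardy_space X) (tensor_inclusion X t)"
      using c0 t by (simp add: i.W.norm_nonneg)
  qed
qed

end


section \<open>A criterion for projectivity\<close>

text \<open>
  Every element of the Hardy space is the limit of polynomials \<open>P\<^sub>n\<close> whose differences \<open>P\<^sub>n\<^sub>+\<^sub>1 - P\<^sub>n\<close> have
  norm at most \<open>2 (1/2)\<^sup>n\<close>. The partial sums of the lifted differences form a Cauchy sequence in the
  algebraic tensor product.
\<close>

lemma (in complex_banach_space) H1_projectiveI:
  assumes C: "C \<ge> 0"
    and lift: "\<And>n x e. (\<And>k. k \<le> n \<Longrightarrow> x k \<in> carrier X) \<Longrightarrow> e > 0 \<Longrightarrow>
      \<exists>t\<in>carrier (H1_tensor X).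
        tensor_inclusion X t = L1cl X (analytic_polynomial X n x) \<and>
        vnorm (H1_tensor X) t
          \<le> C * (\<integral>z. vnorm X (analytic_polynomial X n x z) \<partial>circle_measure) + e"
  shows "H1_projective X"
proof -
  interpret i: linear_pair "H1_tensor X" "hardy_space X" "tensor_inclusion X"
    by (rule tensor_inclusion_linear)
  interpret H: complex_normed_space "hardy_space X" by (rule normed_hardy_space)
  interpret Hl: linear_pair "hardy_space X" "L1T X" "\<lambda>F. F" by (rule hardy_linear)
  let ?T = "H1_tensor X" and ?H = "hardy_space X"
  have lift': "\<exists>t\<in>carrier ?T. tensor_inclusion X t = P \<and> vnorm ?T t \<le> C * vnorm ?H P + e"
    if P: "P \<in> polynomial_classes" and "e > 0" for P e
  proof -
    obtain n x where x: "\<And>k. k \<le> n \<Longrightarrow> x k \<in> carrier X"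
      "P = L1cl X (analytic_polynomial X n x)"
      using P by (auto simp: polynomial_classes_def)
    show ?thesis
      using lift[OF x(1) \<open>e > 0\<close>, of n] x norm_L1_class[OF analytic_polynomial_L1[OF x(1)], of n]
      by (simp add: hardy_space_simps)
  qed
  have surj: "\<exists>\<xi>\<in>carrier (hardy_tensor X). hardy_inclusion X \<xi> = F" if F: "F \<in> carrier ?H" for F
  proof -
    have "\<exists>P\<in>polynomial_classes. vnorm ?H (F \<ominus>\<^bsub>?H\<^esub> P) < (1/2) ^ n" for n
    proof -
      have "(0::real) < (1/2) ^ n" by simp
      then obtain P where "P \<in> polynomial_classes"
        "vnorm (L1T X) (F \<ominus>\<^bsub>L1T X\<^esub> P) < (1/2) ^ n"
        using F[unfolded mem_hardy_iff] by blast
      then show ?thesis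
        using Hl.hom_diff[OF F polynomial_class_hardy, of P]
        by (intro bexI[of _ P]) (simp_all add: hardy_space_simps)
    qed
    then obtain P where P: "\<And>n. P n \<in> polynomial_classes" "\<And>n. vnorm ?H (F \<ominus>\<^bsub>?H\<^esub> P n) < (1/2) ^ n"
      by metis
    have PH: "P n \<in> carrier ?H" for n by (rule polynomial_class_hardy[OF P(1)])
    have diffP: "P (Suc n) \<ominus>\<^bsub>?H\<^esub> P n \<in> polynomial_classes" for n
    proof -
      have "P (Suc n) \<ominus>\<^bsub>?H\<^esub> P n = P (Suc n) \<oplus>\<^bsub>L1T X\<^esub> (- 1) \<odot>\<^bsub>L1T X\<^esub> P n"
        using PH i.W.minus_smult[OF PH, of 1] by (simp add: a_minus_def hardy_space_simps)
      then show ?thesis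
        using submodule_mem(2,3)[OF submodule_polynomial_classes] P(1) by metis
    qed
    have diff_norm: "vnorm ?H (P (Suc n) \<ominus>\<^bsub>?H\<^esub> P n) \<le> 2 * (1/2) ^ n" for n
    proof -
      have "vnorm ?H (P (Suc n) \<ominus>\<^bsub>?H\<^esub> P n) \<le> vnorm ?H (F \<ominus>\<^bsub>?H\<^esub> P (Suc n)) + vnorm ?H (F \<ominus>\<^bsub>?H\<^esub> P n)"
        using i.W.norm_diff_triangle[OF PH F PH, of "Suc n" n] i.W.norm_diff_commute[OF F PH, of "Suc n"] by simp
      also have "\<dots> \<le> (1/2) ^ Suc n + (1/2) ^ n"
        using P(2)[of "Suc n"] P(2)[of n] by (intro add_mono) auto
      also have "\<dots> \<le> 2 * (1/2) ^ n" by simp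
      finally show ?thesis .
    qed
    obtain t0 where t0: "t0 \<in> carrier ?T" "tensor_inclusion X t0 = P 0"
      using lift'[OF P(1), of 1 0] by auto
    have "\<exists>t\<in>carrier ?T. tensor_inclusion X t = P (Suc n) \<ominus>\<^bsub>?H\<^esub> P n \<and>
        vnorm ?T t \<le> (2 * C + 1) * (1/2) ^ n" for n
    proof -
      obtain t where t: "t \<in> carrier ?T" "tensor_inclusion X t = P (Suc n) \<ominus>\<^bsub>?H\<^esub> P n"
        "vnorm ?T t \<le> C * vnorm ?H (P (Suc n) \<ominus>\<^bsub>?H\<^esub> P n) + (1/2) ^ n"
        using lift'[OF diffP[of n], of "(1/2) ^ n"] by auto
      have "C * vnorm ?H (P (Suc n) \<ominus>\<^bsub>?H\<^esub> P n) \<le> C * (2 * (1/2) ^ n)"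
        using C by (intro mult_left_mono diff_norm)
      with t show ?thesis by (intro bexI[of _ t]) (auto simp: algebra_simps)
    qed
    then obtain d where d: "\<And>n. d n \<in> carrier ?T" "\<And>n. tensor_inclusion X (d n) = P (Suc n) \<ominus>\<^bsub>?H\<^esub> P n"
      "\<And>n. vnorm ?T (d n) \<le> (2 * C + 1) * (1/2) ^ n"
      by metis
    define u where "u = rec_nat t0 (\<lambda>n v. d n \<oplus>\<^bsub>?T\<^esub> v)"
    have u_simps: "u 0 = t0" "u (Suc n) = d n \<oplus>\<^bsub>?T\<^esub> u n" for n by (auto simp: u_def)
    have uT: "u n \<in> carrier ?T" for n by (induction n) (auto simp: u_simps t0 d(1))
    have incl: "tensor_inclusion X (u n) = P n" for n
    proof (induction n)
      case (Suc n)
      then show ?case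
        using i.W.diff_add_cancel[OF PH PH, of "Suc n" n] by (simp add: u_simps i.hom_add d uT)
    qed (simp add: u_simps t0)
    have step: "vnorm ?T (u (Suc n) \<ominus>\<^bsub>?T\<^esub> u n) \<le> (2 * C + 1) * (1/2) ^ n" for n
      using d(1,3) uT by (simp add: u_simps i.V.add_diff_cancel)
    have sm: "summable (\<lambda>n. (2 * C + 1) * (1/2) ^ n)" by (intro summable_mult summable_geometric) simp
    have uC: "u \<in> carrier (cauchy_sequences ?T)"
      unfolding cauchy_sequences_simps(1)
    proof (intro CollectI conjI allI impI)
      show "range u \<subseteq> carrier ?T" using uT by auto
      fix e :: real assume "e > 0"
      have "eventually (\<lambda>m. (\<Sum>k. (2 * C + 1) * (1/2) ^ (k + m)) < e) sequentially"
        using order_tendstoD(2)[OF suminf_exist_split2[OF sm] \<open>e > 0\<close>] .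
      then obtain N where N: "\<And>m. m \<ge> N \<Longrightarrow> (\<Sum>k. (2 * C + 1) * (1/2) ^ (k + m)) < e"
        by (auto simp: eventually_sequentially)
      have *: "vnorm ?T (u n \<ominus>\<^bsub>?T\<^esub> u m) < e" if "m \<le> n" "N \<le> m" for m n
        using i.V.Cauchy_step_bound[OF uT step sm that(1)] N[OF that(2)] by simp
      have "vnorm ?T (u m \<ominus>\<^bsub>?T\<^esub> u n) < e" if "N \<le> m" "N \<le> n" for m n
        using *[of m n] *[of n m] i.V.norm_diff_commute[OF uT uT, of m n] that by (cases "m \<le> n") auto
      then show "\<exists>N. \<forall>m\<ge>N. \<forall>n\<ge>N. vnorm ?T (u m \<ominus>\<^bsub>?T\<^esub> u n) < e" by blast
    qed
    have "(\<lambda>n. vnorm ?H (P n \<ominus>\<^bsub>?H\<^esub> F)) \<longlonglongrightarrow> 0"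
    proof (rule Lim_null_comparison)
      show "(\<lambda>n. (1/2::real) ^ n) \<longlonglongrightarrow> 0" by (rule LIMSEQ_power_zero) simp
      have "norm (vnorm ?H (P n \<ominus>\<^bsub>?H\<^esub> F)) \<le> (1/2) ^ n" for n
        using P(2)[of n] PH F i.W.norm_diff_commute[OF F PH, of n] i.W.norm_nonneg[of "P n \<ominus>\<^bsub>?H\<^esub> F"] by simp
      then show "\<forall>\<^sub>F n in sequentially. norm (vnorm ?H (P n \<ominus>\<^bsub>?H\<^esub> F)) \<le> (1/2) ^ n" by simp
    qed
    then have "hardy_inclusion X (completion_class ?T u) = F"
      by (intro hardy_inclusion_eq uC F) (simp add: incl)
    then show ?thesis
      using uC by (intro bexI[of _ "completion_class ?T u"]) (auto simp: projective_tensor_def carrier_completion)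
  qed
  have "hardy_inclusion X ` carrier (hardy_tensor X) = carrier (hardy_space X)"
    using hardy_inclusion_carrier surj by (auto simp: image_iff)
  then show ?thesis
    unfolding H1_projective_def by (intro conjI complex_banach_space_axioms)
qed

section \<open>Polynomials as tensors\<close>

text \<open>The function \<open>z\<^sup>k\<close>.\<close>

definition monomial :: "nat \<Rightarrow> (complex \<Rightarrow> complex) set" where
  "monomial k = scalar_polynomial k (\<lambda>j. if j = k then 1 else 0)"

lemma monomial_hardy [simp]:
  shows "monomial k \<in> carrier H1" "vnorm H1 (monomial k) = 1"
    "hardy_coeff j (monomial k) = (if j = k then 1 else 0)"
proof -
  have eq: "(\<Sum>j\<le>k. (if j = k then 1 else 0) * z ^ j) = z ^ k" for z :: complex
    by (simp add: if_distrib[of "\<lambda>c. c * _"] cong: if_cong)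
  show "monomial k \<in> carrier H1" "hardy_coeff j (monomial k) = (if j = k then 1 else 0)"
    by (auto simp: monomial_def scalar_polynomial_hardy)
  have "(\<integral>z. cmod (z ^ k) \<partial>circle_measure) = (\<integral>z. 1 \<partial>circle_measure)"
    by (intro Bochner_Integration.integral_cong) (auto simp: norm_power)
  then show "vnorm H1 (monomial k) = 1"
    by (simp add: monomial_def scalar_polynomial_hardy eq)
qed

context complex_normed_space
begin

lemma hardy_mult_monomial:
  assumes "x \<in> carrier X"
  shows "hardy_mult X (monomial k) x = L1cl X (\<lambda>z. z ^ k \<odot> x)"
proof -
  have "monomial k = L1cl complex_space (\<lambda>z. z ^ k)"
    by (simp add: monomial_def scalar_polynomial_def if_distrib[of "\<lambda>c. c * _"] cong: if_cong)
  then show ?thesis using hardy_mult_class[OF integrable_circle_power assms] by simp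
qed

text \<open>The formal sum \<open>\<Sum>\<^sub>k z\<^sup>k \<otimes> x\<^sub>k\<close>.\<close>

definition polynomial_tensor :: "nat \<Rightarrow> (nat \<Rightarrow> 'a) \<Rightarrow> (complex \<Rightarrow> complex) set \<times> 'a \<Rightarrow> complex" where
  "polynomial_tensor n x = (\<Oplus>\<^bsub>free_space H1 X\<^esub>k\<in>{..n}. indicator {(monomial k, x k)})"

lemma bilinear_hardy_coeff: "bilinear_map H1 X X (\<lambda>h x. hardy_coeff k h \<odot> x)"
proof -
  interpret C: complex_normed_space complex_space by (rule normed_complex_space)
  interpret A: complex_normed_space H1 by (rule C.normed_hardy_space)
  show ?thesis
    by (intro bilinear_map.intro bilinear_map_axioms.intro A.seminormed_module_axioms
        seminormed_module_axioms)
       (auto simp: hardy_coeff_add hardy_coeff_smult add_smult smult_add smult_smult mult.commute)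
qed

lemma polynomial_tensor:
  assumes x: "\<And>k. k \<le> n \<Longrightarrow> x k \<in> carrier X"
  shows "polynomial_tensor n x \<in> carrier (free_space H1 X)"
    and "vnorm (free_space H1 X) (polynomial_tensor n x) \<le> (\<Sum>k\<le>n. vnorm X (x k))"
    and "linear_extension (hardy_space X) (hardy_mult X) (polynomial_tensor n x)
      = L1cl X (analytic_polynomial X n x)"
    and "linear_extension X (\<lambda>h x. hardy_coeff k h \<odot> x) (polynomial_tensor n x) = (if k \<le> n then x k else \<zero>)"
proof -
  interpret b: bilinear_map H1 X "hardy_space X" "hardy_mult X" by (rule bilinear_hardy_mult)
  interpret L: linear_pair "free_space H1 X" "hardy_space X" b.L
    by (rule b.linear_extension_linear)
  interpret Hl: linear_pair "hardy_space X" "L1T X" "\<lambda>F. F" by (rule hardy_linear)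
  interpret b': bilinear_map H1 X X "\<lambda>h x. hardy_coeff k h \<odot> x" by (rule bilinear_hardy_coeff)
  interpret L': linear_pair "free_space H1 X" X b'.L
    by (rule b'.linear_extension_linear)
  have ind: "indicator {(monomial k, x k)} \<in> carrier (free_space H1 X)" if "k \<in> {..n}" for k
    using x that by (intro indicator_free_space) auto
  show "polynomial_tensor n x \<in> carrier (free_space H1 X)"
    unfolding polynomial_tensor_def using ind by (intro L.V.finsum_closed) auto
  show "vnorm (free_space H1 X) (polynomial_tensor n x) \<le> (\<Sum>k\<le>n. vnorm X (x k))"
    unfolding polynomial_tensor_def
    by (rule order_trans[OF L.V.norm_finsum_le[OF finite_atMost]])
       (use ind in \<open>auto simp: norm_indicator_free_space\<close>)
  have "b.L (polynomial_tensor n x) = (\<Oplus>\<^bsub>hardy_space X\<^esub>k\<in>{..n}. b.L (indicator {(monomial k, x k)}))"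
    unfolding polynomial_tensor_def by (rule L.hom_finsum[OF finite_atMost ind])
  also have "\<dots> = (\<Oplus>\<^bsub>L1T X\<^esub>k\<in>{..n}. b.L (indicator {(monomial k, x k)}))"
    using ind by (intro Hl.hom_finsum[OF finite_atMost]) auto
  also have "\<dots> = (\<Oplus>\<^bsub>L1T X\<^esub>k\<in>{..n}. L1cl X (\<lambda>z. z ^ k \<odot> x k))"
  proof (rule Hl.W.finsum_cong')
    show "(\<lambda>k. L1cl X (\<lambda>z. z ^ k \<odot> x k)) \<in> {..n} \<rightarrow> carrier (L1T X)"
      using x smult_fun_L1[OF integrable_circle_power] by (auto simp: carrier_L1_space)
    show "b.L (indicator {(monomial k, x k)}) = L1cl X (\<lambda>z. z ^ k \<odot> x k)" if "k \<in> {..n}" for k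
      using x that by (simp add: b.linear_extension_indicator hardy_mult_monomial)
  qed simp
  also have "\<dots> = L1cl X (analytic_polynomial X n x)"
    unfolding analytic_polynomial_def[abs_def]
    using x by (intro finsum_smult_fun_L1(2)[symmetric] integrable_circle_power) auto
  finally show "b.L (polynomial_tensor n x) = L1cl X (analytic_polynomial X n x)" .
  have "b'.L (polynomial_tensor n x) = (\<Oplus>j\<in>{..n}. b'.L (indicator {(monomial j, x j)}))"
    unfolding polynomial_tensor_def by (rule L'.hom_finsum[OF finite_atMost ind])
  also have "\<dots> = (\<Oplus>j\<in>{..n}. if j = k then x j else \<zero>)"
    using x by (intro finsum_cong') (auto simp: b'.linear_extension_indicator)
  also have "\<dots> = (\<Oplus>j\<in>{j. j = k \<and> j \<le> n}. if j = k then x j else \<zero>)"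
    using x by (intro finsum_mono_neutral) auto
  also have "\<dots> = (if k \<le> n then x k else \<zero>)"
  proof (cases "k \<le> n")
    case True
    then have "{j. j = k \<and> j \<le> n} = {k}" by auto
    then show ?thesis using True x by (simp add: finsum_singleton)
  next
    case False
    then have e: "{j. j = k \<and> j \<le> n} = {}" by auto
    show ?thesis unfolding e using False by simp
  qed
  finally show "b'.L (polynomial_tensor n x) = (if k \<le> n then x k else \<zero>)" .
qed

lemma analytic_polynomial_finsum:
  assumes "finite G" "\<And>g k. g \<in> G \<Longrightarrow> a g k \<in> carrier X"
  shows "(\<Oplus>g\<in>G. analytic_polynomial X n (a g) z) = analytic_polynomial X n (\<lambda>k. \<Oplus>g\<in>G. a g k) z"
  using assms
proof (induction G)
  case empty
  have "(\<Oplus>k\<in>{..n}. z ^ k \<odot> \<zero>) = (\<Oplus>k\<in>{}. z ^ k \<odot> \<zero>)"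
    by (intro finsum_mono_neutral) auto
  then show ?case by (simp add: analytic_polynomial_def)
next
  case (insert g G)
  have p: "analytic_polynomial X n (a h) z \<in> carrier X" if "h \<in> insert g G" for h
    unfolding analytic_polynomial_def using insert.prems that by (intro finsum_closed) auto
  have "(\<Oplus>h\<in>insert g G. analytic_polynomial X n (a h) z)
      = analytic_polynomial X n (a g) z \<oplus> analytic_polynomial X n (\<lambda>k. \<Oplus>h\<in>G. a h k) z"
    using insert p by (subst finsum_insert) auto
  also have "\<dots> = analytic_polynomial X n (\<lambda>k. a g k \<oplus> (\<Oplus>h\<in>G. a h k)) z"
    using insert.prems by (intro analytic_polynomial_add[symmetric] finsum_closed) auto
  also have "(\<lambda>k. a g k \<oplus> (\<Oplus>h\<in>G. a h k)) = (\<lambda>k. \<Oplus>h\<in>insert g G. a h k)"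
    using insert by (intro ext) (simp add: finsum_insert Pi_def)
  finally show ?case .
qed

text \<open>
  The tensor is \<open>\<Sum>\<^sub>g g \<otimes> y\<^sub>g + \<Sum>\<^sub>k z\<^sup>k \<otimes> r\<^sub>k\<close>, where the \<open>r\<^sub>k\<close> are the remainders in the second sum of the
  bound. A function \<open>g\<close> in \<open>G\<close> stands for the polynomial \<open>\<Sum>\<^sub>k g\<^sub>k z\<^sup>k\<close>; only its values up to \<open>N\<close>
  matter.
\<close>

lemma tensor_of_factorization:
  assumes G: "finite G" "\<And>g. g \<in> G \<Longrightarrow> (\<integral>z. cmod (\<Sum>k\<le>N. g k * z ^ k) \<partial>circle_measure) \<le> 1"
    and y: "\<And>g. g \<in> G \<Longrightarrow> y g \<in> carrier X" and x: "\<And>k. k \<le> N \<Longrightarrow> x k \<in> carrier X"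
  shows "\<exists>t\<in>carrier (H1_tensor X).
    tensor_inclusion X t = L1cl X (analytic_polynomial X N x) \<and>
    vnorm (H1_tensor X) t
      \<le> (\<Sum>g\<in>G. vnorm X (y g)) + (\<Sum>k\<le>N. vnorm X (x k \<ominus> (\<Oplus>g\<in>G. g k \<odot> y g)))"
proof -
  interpret b: bilinear_map H1 X "hardy_space X" "hardy_mult X" by (rule bilinear_hardy_mult)
  interpret L: linear_pair "free_space H1 X" "hardy_space X" b.L
    by (rule b.linear_extension_linear)
  interpret Hl: linear_pair "hardy_space X" "L1T X" "\<lambda>F. F" by (rule hardy_linear)
  interpret cl: linear_pair "L1F X" "L1T X" "L1cl X"
    by (rule L1_class_linear)
  let ?F = "free_space H1 X"
  define s where "s k = (\<Oplus>g\<in>G. g k \<odot> y g)" for k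
  have sX: "s k \<in> carrier X" for k unfolding s_def using y by (intro finsum_closed) auto
  define r where "r k = x k \<ominus> s k" for k
  have rX: "r k \<in> carrier X" if "k \<le> N" for k using x sX that by (simp add: r_def)
  define c where "c = (\<Oplus>\<^bsub>?F\<^esub>g\<in>G. indicator {(scalar_polynomial N g, y g)})"
  have ind: "indicator {(scalar_polynomial N g, y g)} \<in> carrier ?F" if "g \<in> G" for g
    using y that by (intro indicator_free_space scalar_polynomial_hardy)
  have cF: "c \<in> carrier ?F" unfolding c_def using ind by (intro L.V.finsum_closed) auto
  have "vnorm ?F c \<le> (\<Sum>g\<in>G. vnorm ?F (indicator {(scalar_polynomial N g, y g)}))"
    unfolding c_def by (rule L.V.norm_finsum_le[OF G(1) ind])
  also have "\<dots> \<le> (\<Sum>g\<in>G. vnorm X (y g))"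
    using G(2) y by (intro sum_mono)
      (auto simp: norm_indicator_free_space scalar_polynomial_hardy norm_nonneg mult_left_le_one_le
        intro!: integral_nonneg)
  finally have c_norm: "vnorm ?F c \<le> (\<Sum>g\<in>G. vnorm X (y g))" .
  have pL1: "analytic_polynomial X N (\<lambda>k. g k \<odot> y g) \<in> carrier (L1F X)" if "g \<in> G" for g
    using y that by (intro analytic_polynomial_L1) auto
  have "b.L c = (\<Oplus>\<^bsub>hardy_space X\<^esub>g\<in>G. b.L (indicator {(scalar_polynomial N g, y g)}))"
    unfolding c_def by (rule L.hom_finsum[OF G(1) ind])
  also have "\<dots> = (\<Oplus>\<^bsub>L1T X\<^esub>g\<in>G. b.L (indicator {(scalar_polynomial N g, y g)}))"
    using ind by (intro Hl.hom_finsum[OF G(1)]) auto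
  also have "\<dots> = (\<Oplus>\<^bsub>L1T X\<^esub>g\<in>G.
      L1cl X (analytic_polynomial X N (\<lambda>k. g k \<odot> y g)))"
    using y pL1 by (intro Hl.W.finsum_cong')
      (auto simp: b.linear_extension_indicator scalar_polynomial_hardy hardy_mult_scalar_polynomial)
  also have "\<dots> = L1cl X
      (\<Oplus>\<^bsub>L1F X\<^esub>g\<in>G. analytic_polynomial X N (\<lambda>k. g k \<odot> y g))"
    by (rule cl.hom_finsum[OF G(1) pL1, symmetric])
  also have "(\<Oplus>\<^bsub>L1F X\<^esub>g\<in>G. analytic_polynomial X N (\<lambda>k. g k \<odot> y g))
      = analytic_polynomial X N s"
  proof
    fix z
    show "(\<Oplus>\<^bsub>L1F X\<^esub>g\<in>G. analytic_polynomial X N (\<lambda>k. g k \<odot> y g)) z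
      = analytic_polynomial X N s z"
    proof -
      have "(\<Oplus>\<^bsub>L1F X\<^esub>g\<in>G. analytic_polynomial X N (\<lambda>k. g k \<odot> y g)) z
          = (\<Oplus>g\<in>G. analytic_polynomial X N (\<lambda>k. g k \<odot> y g) z)"
        by (rule L1_finsum_apply[OF G(1)]) (rule pL1)
      also have "\<dots> = analytic_polynomial X N s z"
        unfolding s_def[abs_def] by (rule analytic_polynomial_finsum[OF G(1)]) (use y in auto)
      finally show ?thesis .
    qed
  qed
  finally have Lc: "b.L c = L1cl X (analytic_polynomial X N s)" .
  note pt = polynomial_tensor[OF rX]
  let ?t = "c \<oplus>\<^bsub>?F\<^esub> polynomial_tensor N r"
  have tF: "?t \<in> carrier ?F" using cF pt(1) by simp
  have "b.L ?t = L1cl X (analytic_polynomial X N s) \<oplus>\<^bsub>L1T X\<^esub>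
      L1cl X (analytic_polynomial X N r)"
    using cF pt(1,3) by (simp add: L.hom_add Lc hardy_space_simps)
  also have "\<dots> = L1cl X (analytic_polynomial X N s \<oplus>\<^bsub>L1F X\<^esub> analytic_polynomial X N r)"
    using sX rX by (intro cl.hom_add[symmetric] analytic_polynomial_L1)
  also have "analytic_polynomial X N s \<oplus>\<^bsub>L1F X\<^esub> analytic_polynomial X N r = analytic_polynomial X N x"
  proof
    fix z
    have "analytic_polynomial X N s z \<oplus> analytic_polynomial X N r z = analytic_polynomial X N (\<lambda>k. s k \<oplus> r k) z"
      using sX rX by (intro analytic_polynomial_add[symmetric])
    also have "\<dots> = analytic_polynomial X N x z"
      unfolding analytic_polynomial_def
    proof (rule finsum_cong')
      fix k assume "k \<in> {..N}"
      then have "s k \<oplus> r k = x k"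
        using x[of k] sX[of k] diff_add_cancel[of "x k" "s k"] by (simp add: r_def a_comm)
      then show "z ^ k \<odot> (s k \<oplus> r k) = z ^ k \<odot> x k" by simp
    qed (use x in auto)
    finally show "(analytic_polynomial X N s \<oplus>\<^bsub>L1F X\<^esub> analytic_polynomial X N r) z = analytic_polynomial X N x z"
      by (simp add: L1_functions_simps)
  qed
  finally have Lt: "b.L ?t = L1cl X (analytic_polynomial X N x)" .
  have "vnorm (H1_tensor X) (tensor_class ?t) \<le> vnorm ?F ?t"
    by (rule norm_tensor_class_le[OF tF])
  also have "\<dots> \<le> vnorm ?F c + vnorm ?F (polynomial_tensor N r)"
    by (rule L.V.norm_triangle[OF cF pt(1)])
  also have "\<dots> \<le> (\<Sum>g\<in>G. vnorm X (y g)) + (\<Sum>k\<le>N. vnorm X (r k))"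
    by (intro add_mono c_norm pt(2))
  finally have "vnorm (H1_tensor X) (tensor_class ?t)
      \<le> (\<Sum>g\<in>G. vnorm X (y g)) + (\<Sum>k\<le>N. vnorm X (x k \<ominus> (\<Oplus>g\<in>G. g k \<odot> y g)))"
    by (simp only: r_def s_def)
  then show ?thesis
    using tF Lt tensor_inclusion_class[OF tF]
    by (intro bexI[of _ "tensor_class ?t"]) (auto simp: carrier_tensor)
qed

end


section \<open>Finite nets of scalar polynomials\<close>

lemma coefficient_le_integral:
  assumes "k \<le> N"
  shows "cmod (q k) \<le> (\<integral>z. cmod (\<Sum>j\<le>N. q j * z ^ j) \<partial>circle_measure)"
  using norm_fourier_le[OF integrable_scalar_polynomial, of k 0 q N] assms
  by (simp add: fourier_poly)

text \<open>
  The coefficients of a polynomial of norm at most \<open>1\<close> are bounded by \<open>1\<close>. Rounding them to a grid of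
  width \<open>\<delta> / 2\<close> therefore divides these polynomials into finitely many classes, and the net consists
  of one polynomial from each class.
\<close>

lemma finite_polynomial_net:
  assumes \<delta>: "\<delta> > 0"
  obtains G :: "(nat \<Rightarrow> complex) set" where "finite G"
    "\<And>g. g \<in> G \<Longrightarrow> (\<integral>z. cmod (\<Sum>k\<le>N. g k * z ^ k) \<partial>circle_measure) \<le> 1"
    "\<And>q. (\<integral>z. cmod (\<Sum>k\<le>N. q k * z ^ k) \<partial>circle_measure) \<le> 1 \<Longrightarrow> \<exists>g\<in>G. \<forall>k\<le>N. cmod (q k - g k) \<le> \<delta>"
proof -
  define \<eta> where "\<eta> = \<delta> / 2"
  have \<eta>: "\<eta> > 0" "\<eta> + \<eta> = \<delta>" using \<delta> by (auto simp: \<eta>_def)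
  define B where "B = {q. (\<integral>z. cmod (\<Sum>k\<le>N. q k * z ^ k) \<partial>circle_measure) \<le> 1}"
  define \<rho> where "\<rho> q = restrict (\<lambda>k. (\<lfloor>Re (q k) / \<eta>\<rfloor>, \<lfloor>Im (q k) / \<eta>\<rfloor>)) {..N}" for q :: "nat \<Rightarrow> complex"
  define K where "K = \<lceil>1 / \<eta>\<rceil>"
  have floor_range: "\<lfloor>t / \<eta>\<rfloor> \<in> {- K..K}" if "\<bar>t\<bar> \<le> 1" for t :: real
  proof -
    have t: "t / \<eta> \<le> 1 / \<eta>" "- (1 / \<eta>) \<le> t / \<eta>"
      using that \<eta> by (auto simp: field_simps)
    have "\<lfloor>t / \<eta>\<rfloor> \<le> K"
      using t(1) unfolding K_def by linarith
    moreover have "- K \<le> \<lfloor>t / \<eta>\<rfloor>"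
      using t(2) unfolding K_def by linarith
    ultimately show ?thesis by simp
  qed
  have "\<rho> ` B \<subseteq> Pi\<^sub>E {..N} (\<lambda>_. {- K..K} \<times> {- K..K})"
  proof (rule image_subsetI)
    fix q assume q: "q \<in> B"
    have "\<bar>Re (q k)\<bar> \<le> 1" "\<bar>Im (q k)\<bar> \<le> 1" if "k \<le> N" for k
    proof -
      have "cmod (q k) \<le> 1" using coefficient_le_integral[OF that, of q] q by (simp add: B_def)
      then show "\<bar>Re (q k)\<bar> \<le> 1" "\<bar>Im (q k)\<bar> \<le> 1"
        using abs_Re_le_cmod[of "q k"] abs_Im_le_cmod[of "q k"] by linarith+
    qed
    then show "\<rho> q \<in> Pi\<^sub>E {..N} (\<lambda>_. {- K..K} \<times> {- K..K})"
      unfolding \<rho>_def using floor_range by auto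
  qed
  then have fin: "finite (\<rho> ` B)"
    by (rule finite_subset) (intro finite_PiE finite_atMost finite_cartesian_product finite_atLeastAtMost_int)
  define G where "G = inv_into B \<rho> ` \<rho> ` B"
  have close: "\<bar>s - t\<bar> \<le> \<eta>" if "\<lfloor>s / \<eta>\<rfloor> = \<lfloor>t / \<eta>\<rfloor>" for s t :: real
  proof -
    have "\<bar>s / \<eta> - t / \<eta>\<bar> \<le> 1" using that by linarith
    then have "\<bar>s - t\<bar> / \<eta> \<le> 1"
      using \<eta>(1) by (simp add: diff_divide_distrib[symmetric])
    then show ?thesis using \<eta>(1) by (simp add: pos_divide_le_eq)
  qed
  show ?thesis
  proof
    show "finite G" unfolding G_def using fin by simp
    show "(\<integral>z. cmod (\<Sum>k\<le>N. g k * z ^ k) \<partial>circle_measure) \<le> 1" if "g \<in> G" for g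
    proof -
      have "g \<in> B" using that inv_into_into[of _ \<rho> B] unfolding G_def by blast
      then show ?thesis by (simp add: B_def)
    qed
    show "\<exists>g\<in>G. \<forall>k\<le>N. cmod (q k - g k) \<le> \<delta>"
      if "(\<integral>z. cmod (\<Sum>k\<le>N. q k * z ^ k) \<partial>circle_measure) \<le> 1" for q
    proof -
      have q: "q \<in> B" using that by (simp add: B_def)
      define g where "g = inv_into B \<rho> (\<rho> q)"
      have "\<rho> g = \<rho> q" unfolding g_def by (rule f_inv_into_f[OF imageI[OF q]])
      then have eq: "\<lfloor>Re (q k) / \<eta>\<rfloor> = \<lfloor>Re (g k) / \<eta>\<rfloor>" "\<lfloor>Im (q k) / \<eta>\<rfloor> = \<lfloor>Im (g k) / \<eta>\<rfloor>"
        if "k \<le> N" for k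
        using that unfolding \<rho>_def by (auto dest!: fun_cong[of _ _ k])
      have "cmod (q k - g k) \<le> \<delta>" if "k \<le> N" for k
        using cmod_le[of "q k - g k"] close[OF eq(1)[OF that]] close[OF eq(2)[OF that]] \<eta>(2) by simp
      moreover have "g \<in> G" unfolding G_def g_def using q by blast
      ultimately show ?thesis by blast
    qed
  qed
qed

lemma hardy_coeff_le:
  assumes "h \<in> carrier H1"
  shows "cmod (hardy_coeff k h) \<le> vnorm H1 h"
proof -
  obtain f where "integrable circle_measure f"
    "vnorm H1 h = (\<integral>z. cmod (f z) \<partial>circle_measure)" "\<And>k. hardy_coeff k h = fourier k 0 f"
    using scalar_hardyE[OF assms] by metis
  then show ?thesis using norm_fourier_le[of f k 0] by simp
qed

text \<open>
  The coefficients of the Fejer mean of \<open>h\<close> are within \<open>\<delta> \<parallel>h\<parallel>\<close> of those of \<open>\<parallel>h\<parallel> g\<close> for some \<open>g\<close> in the net.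
\<close>

lemma fejer_mean_near_net:
  assumes h: "h \<in> carrier H1"
    and net: "\<And>q. (\<integral>z. cmod (\<Sum>k\<le>N. q k * z ^ k) \<partial>circle_measure) \<le> 1 \<Longrightarrow> \<exists>g\<in>G. \<forall>k\<le>N. cmod (q k - g k) \<le> \<delta>"
  shows "\<exists>g\<in>G. \<forall>k\<le>N. cmod (of_real (1 - real k / real (N + 1)) * hardy_coeff k h
      - of_real (vnorm H1 h) * g k) \<le> \<delta> * vnorm H1 h"
proof -
  let ?n = "vnorm H1 h"
  let ?c = "\<lambda>k. of_real (1 - real k / real (N + 1)) * hardy_coeff k h"
  interpret C: complex_normed_space complex_space by (rule normed_complex_space)
  interpret H: complex_normed_space H1 by (rule C.normed_hardy_space)
  have n0: "?n \<ge> 0" by (rule H.norm_nonneg[OF h])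
  show ?thesis
  proof (cases "?n = 0")
    case True
    obtain g where "g \<in> G" using net[of "\<lambda>_. 0"] by auto
    then show ?thesis
      using True hardy_coeff_le[OF h] by (intro bexI[of _ g]) auto
  next
    case False
    then have npos: "?n > 0" using n0 by simp
    define q where "q k = ?c k / of_real ?n" for k
    have "(\<integral>z. cmod (\<Sum>k\<le>N. q k * z ^ k) \<partial>circle_measure)
        = (\<integral>z. cmod (\<Sum>k\<le>N. ?c k * z ^ k) / ?n \<partial>circle_measure)"
      using npos by (intro Bochner_Integration.integral_cong refl)
        (simp add: q_def sum_divide_distrib[symmetric] norm_divide)
    also have "\<dots> \<le> 1" using hardy_fejer_bound[OF h, of N] npos by simp
    finally obtain g where g: "g \<in> G" "\<forall>k\<le>N. cmod (q k - g k) \<le> \<delta>" using net by blast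
    have "cmod (?c k - of_real ?n * g k) \<le> \<delta> * ?n" if "k \<le> N" for k
    proof -
      have "?c k - of_real ?n * g k = of_real ?n * (q k - g k)"
      proof -
        have "of_real ?n * q k = ?c k" using npos by (simp add: q_def)
        then show ?thesis by (simp only: right_diff_distrib)
      qed
      then have "cmod (?c k - of_real ?n * g k) = ?n * cmod (q k - g k)"
        using n0 by (simp add: norm_mult)
      then show ?thesis using g(2) that n0 by (simp add: mult.commute[of \<delta>] mult_left_mono)
    qed
    with g(1) show ?thesis by blast
  qed
qed

section \<open>Approximate factorization of polynomials\<close>

context complex_banach_space
begin

text \<open>
  The functional \<open>h \<otimes> x \<mapsto> h\<^sub>k x\<close> is well defined on tensors, so each representation of
  \<open>\<Sum>\<^sub>k z\<^sup>k \<otimes> x\<^sub>k\<close> determines the coefficients \<open>x\<^sub>k\<close>.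
\<close>

lemma tensor_representation:
  assumes const: "H1_constant X < ennreal c" and x: "\<And>k. k \<le> n \<Longrightarrow> x k \<in> carrier X" and e: "e > 0"
  obtains d where "d \<in> carrier (free_space H1 X)"
    "vnorm (free_space H1 X) d
      < c * (\<integral>z. vnorm X (analytic_polynomial X n x z) \<partial>circle_measure) + e"
    "\<And>k. linear_extension X (\<lambda>h x. hardy_coeff k h \<odot> x) d = (if k \<le> n then x k else \<zero>)"
proof -
  note pt = polynomial_tensor[of n x, OF x]
  have tT: "tensor_class (polynomial_tensor n x) \<in> carrier (H1_tensor X)"
    using pt(1) by (simp add: carrier_tensor)
  have "tensor_inclusion X (tensor_class (polynomial_tensor n x)) = L1cl X (analytic_polynomial X n x)"
    using pt(1,3) by (simp add: tensor_inclusion_class)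
  then have "vnorm (H1_tensor X) (tensor_class (polynomial_tensor n x))
      \<le> c * (\<integral>z. vnorm X (analytic_polynomial X n x z) \<partial>circle_measure)"
    using H1_constant_norm_le[OF const tT] norm_L1_class[OF analytic_polynomial_L1[OF x], of n]
    by (simp add: hardy_space_simps)
  then have less: "vnorm (H1_tensor X) (tensor_class (polynomial_tensor n x))
      < c * (\<integral>z. vnorm X (analytic_polynomial X n x z) \<partial>circle_measure) + e"
    using e by simp
  obtain d where d: "d \<in> carrier (free_space H1 X)"
    "vnorm (free_space H1 X) d
      < c * (\<integral>z. vnorm X (analytic_polynomial X n x z) \<partial>circle_measure) + e"
    "d \<ominus>\<^bsub>free_space H1 X\<^esub> polynomial_tensor n x \<in> tensor_relations H1 X"
    by (rule norm_tensor_class_lessD[OF pt(1) less])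
  have "linear_extension X (\<lambda>h x. hardy_coeff k h \<odot> x) d = (if k \<le> n then x k else \<zero>)" for k
  proof -
    interpret b: bilinear_map H1 X X "\<lambda>h x. hardy_coeff k h \<odot> x" by (rule bilinear_hardy_coeff)
    interpret L: linear_pair "free_space H1 X" X b.L
      by (rule b.linear_extension_linear)
    have "b.L d \<ominus> b.L (polynomial_tensor n x) = \<zero>"
      using b.tensor_relations_kernel[OF d(3)] d(1) pt(1) by (simp add: L.hom_diff)
    then have "b.L d = b.L (polynomial_tensor n x)"
      using norm_diff_eq_0_iff[OF L.hom_carrier[OF d(1)] L.hom_carrier[OF pt(1)]] by simp
    then show ?thesis using pt(4)[of k] by simp
  qed
  with that d show ?thesis by blast
qed

text \<open>
  For a representation \<open>\<Sum>\<^sub>p d\<^sub>p (h\<^sub>p \<otimes> v\<^sub>p)\<close> of the polynomial, \<open>y\<^sub>g\<close> collects the vectors \<open>d\<^sub>p \<parallel>h\<^sub>p\<parallel> v\<^sub>p\<close> of all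
  \<open>p\<close> for which the Fejer mean of \<open>h\<^sub>p\<close> is close to \<open>\<parallel>h\<^sub>p\<parallel> g\<close>. With \<open>\<theta> = 1 - k / (N + 1)\<close>, the \<open>k\<close>-th
  remainder splits into \<open>(1 - \<theta>) x\<^sub>k\<close>, the error of the Fejer mean, and \<open>\<theta> x\<^sub>k - \<Sum>\<^sub>g g\<^sub>k y\<^sub>g\<close>, the error
  of the net.
\<close>

lemma approximate_factorization:
  assumes const: "H1_constant X < ennreal c" and x: "\<And>k. x k \<in> carrier X"
    and vanish: "\<And>k. k > n \<Longrightarrow> x k = \<zero>" and e: "e > 0" and G: "finite G"
    and net: "\<And>q. (\<integral>z. cmod (\<Sum>k\<le>N. q k * z ^ k) \<partial>circle_measure) \<le> 1 \<Longrightarrow> \<exists>g\<in>G. \<forall>k\<le>N. cmod (q k - g k) \<le> \<delta>"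
    and \<delta>: "\<delta> \<ge> 0"
  defines "A \<equiv> c * (\<integral>z. vnorm X (analytic_polynomial X n x z) \<partial>circle_measure) + e"
  shows "\<exists>y. (\<forall>g\<in>G. y g \<in> carrier X) \<and> (\<Sum>g\<in>G. vnorm X (y g)) \<le> A \<and>
    (\<forall>k\<le>N. vnorm X (x k \<ominus> (\<Oplus>g\<in>G. g k \<odot> y g)) \<le> real k / real (N + 1) * vnorm X (x k) + \<delta> * A)"
proof -
  let ?w = "\<lambda>h. vnorm H1 h"
  interpret C: complex_normed_space complex_space by (rule normed_complex_space)
  interpret H: complex_normed_space H1 by (rule C.normed_hardy_space)
  obtain d where d: "d \<in> carrier (free_space H1 X)"
    "vnorm (free_space H1 X) d < A"
    "\<And>k. linear_extension X (\<lambda>h x. hardy_coeff k h \<odot> x) d = (if k \<le> n then x k else \<zero>)"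
  proof (rule tensor_representation[where x = x and n = n, OF const x e], goal_cases)
    case (1 d)
    then show ?case by (intro that[of d]) (simp_all only: A_def)
  qed
  define S where "S = {p. d p \<noteq> 0}"
  have S: "finite S" "\<And>p. p \<in> S \<Longrightarrow> fst p \<in> carrier H1" "\<And>p. p \<in> S \<Longrightarrow> snd p \<in> carrier X"
    using d(1) unfolding S_def free_space_simps(1) by (auto simp: subset_iff mem_Times_iff)
  have w0: "?w (fst p) \<ge> 0" if "p \<in> S" for p using S(2)[OF that] by (rule H.norm_nonneg)
  have dnorm: "(\<Sum>p\<in>S. cmod (d p) * ?w (fst p) * vnorm X (snd p)) < A"
    using d(2) by (simp add: S_def free_space_simps(5))
  have "\<exists>g\<in>G. \<forall>k\<le>N. cmod (of_real (1 - real k / real (N + 1)) * hardy_coeff k (fst p)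
      - of_real (?w (fst p)) * g k) \<le> \<delta> * ?w (fst p)" if "p \<in> S" for p
    using fejer_mean_near_net[OF S(2)[OF that] net] by blast
  then obtain \<gamma> where \<gamma>: "\<And>p. p \<in> S \<Longrightarrow> \<gamma> p \<in> G"
    "\<And>p k. p \<in> S \<Longrightarrow> k \<le> N \<Longrightarrow> cmod (of_real (1 - real k / real (N + 1)) * hardy_coeff k (fst p)
      - of_real (?w (fst p)) * \<gamma> p k) \<le> \<delta> * ?w (fst p)"
    by metis
  define S' where "S' g = {p \<in> S. \<gamma> p = g}" for g
  have S': "finite (S' g)" "S' g \<subseteq> S" for g using S(1) by (auto simp: S'_def)
  have US': "(\<Union>g\<in>G. S' g) = S" using \<gamma>(1) by (auto simp: S'_def)
  define y where "y g = (\<Oplus>p\<in>S' g. (d p * of_real (?w (fst p))) \<odot> snd p)" for g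
  have yX: "y g \<in> carrier X" for g
    unfolding y_def using S(3) S'(2) by (intro finsum_closed) blast
  have "(\<Sum>g\<in>G. vnorm X (y g)) \<le> (\<Sum>g\<in>G. \<Sum>p\<in>S' g. cmod (d p) * ?w (fst p) * vnorm X (snd p))"
  proof (rule sum_mono)
    fix g
    have "vnorm X (y g) \<le> (\<Sum>p\<in>S' g. vnorm X ((d p * of_real (?w (fst p))) \<odot> snd p))"
      unfolding y_def using S(3) S'(2) by (intro norm_finsum_le S'(1)) blast
    also have "\<dots> = (\<Sum>p\<in>S' g. cmod (d p) * ?w (fst p) * vnorm X (snd p))"
    proof (rule sum.cong[OF refl])
      fix p assume "p \<in> S' g"
      then have p: "p \<in> S" using S'(2) by blast
      then show "vnorm X ((d p * of_real (?w (fst p))) \<odot> snd p) = cmod (d p) * ?w (fst p) * vnorm X (snd p)"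
        using S(3)[OF p] w0[OF p] by (simp add: norm_smult norm_mult)
    qed
    finally show "vnorm X (y g) \<le> (\<Sum>p\<in>S' g. cmod (d p) * ?w (fst p) * vnorm X (snd p))" .
  qed
  also have "\<dots> = (\<Sum>p\<in>S. cmod (d p) * ?w (fst p) * vnorm X (snd p))"
    unfolding S'_def using G S(1) \<gamma>(1) by (intro sum.group) auto
  finally have y_sum: "(\<Sum>g\<in>G. vnorm X (y g)) \<le> A" using dnorm by simp
  have rem: "vnorm X (x k \<ominus> (\<Oplus>g\<in>G. g k \<odot> y g)) \<le> real k / real (N + 1) * vnorm X (x k) + \<delta> * A"
    if k: "k \<le> N" for k
  proof -
    define \<theta> where "\<theta> = 1 - real k / real (N + 1)"
    have T1: "(\<lambda>p. (d p * hardy_coeff k (fst p)) \<odot> snd p) \<in> S \<rightarrow> carrier X"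
      and T2: "(\<lambda>p. (d p * (of_real (?w (fst p)) * \<gamma> p k)) \<odot> snd p) \<in> S \<rightarrow> carrier X"
      using S(3) by auto
    have xk: "x k = (\<Oplus>p\<in>S. (d p * hardy_coeff k (fst p)) \<odot> snd p)"
    proof -
      have "x k = linear_extension X (\<lambda>h x. hardy_coeff k h \<odot> x) d" using d(3) vanish by simp
      also have "\<dots> = (\<Oplus>p\<in>S. (d p * hardy_coeff k (fst p)) \<odot> snd p)"
        unfolding linear_extension_def S_def[symmetric] using S(3) by (intro finsum_cong') (auto simp: smult_smult)
      finally show ?thesis .
    qed
    have sk: "(\<Oplus>g\<in>G. g k \<odot> y g) = (\<Oplus>p\<in>S. (d p * (of_real (?w (fst p)) * \<gamma> p k)) \<odot> snd p)"
    proof -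
      have "(\<Oplus>g\<in>G. g k \<odot> y g) = (\<Oplus>g\<in>G. \<Oplus>p\<in>S' g. (d p * (of_real (?w (fst p)) * \<gamma> p k)) \<odot> snd p)"
      proof (rule finsum_cong')
        fix g assume "g \<in> G"
        have "g k \<odot> y g = (\<Oplus>p\<in>S' g. g k \<odot> ((d p * of_real (?w (fst p))) \<odot> snd p))"
          unfolding y_def using S(3) S'(2) by (intro finsum_smult S'(1)) blast
        also have "\<dots> = (\<Oplus>p\<in>S' g. (d p * (of_real (?w (fst p)) * \<gamma> p k)) \<odot> snd p)"
          using S(3) by (intro finsum_cong') (auto simp: S'_def smult_smult mult_ac)
        finally show "g k \<odot> y g = (\<Oplus>p\<in>S' g. (d p * (of_real (?w (fst p)) * \<gamma> p k)) \<odot> snd p)" .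
      next
        show "(\<lambda>g. \<Oplus>p\<in>S' g. (d p * (of_real (?w (fst p)) * \<gamma> p k)) \<odot> snd p) \<in> G \<rightarrow> carrier X"
          using S(3) S'(2) by (intro funcsetI finsum_closed) blast
      qed simp
      also have "\<dots> = (\<Oplus>p\<in>(\<Union>g\<in>G. S' g). (d p * (of_real (?w (fst p)) * \<gamma> p k)) \<odot> snd p)"
        using S(3) S' G by (intro add.finprod_UN_disjoint[symmetric]) (auto simp: S'_def pairwise_def disjnt_def)
      finally show ?thesis unfolding US' .
    qed
    define D where "D = (\<Oplus>p\<in>S. (d p * (of_real \<theta> * hardy_coeff k (fst p) - of_real (?w (fst p)) * \<gamma> p k)) \<odot> snd p)"
    have D: "D = of_real \<theta> \<odot> x k \<ominus> (\<Oplus>g\<in>G. g k \<odot> y g)"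
    proof -
      have "of_real \<theta> \<odot> x k = (\<Oplus>p\<in>S. of_real \<theta> \<odot> ((d p * hardy_coeff k (fst p)) \<odot> snd p))"
        unfolding xk using T1 by (intro finsum_smult S(1)) auto
      also have "\<dots> \<ominus> (\<Oplus>g\<in>G. g k \<odot> y g) = (\<Oplus>p\<in>S. of_real \<theta> \<odot> ((d p * hardy_coeff k (fst p)) \<odot> snd p)
          \<ominus> (d p * (of_real (?w (fst p)) * \<gamma> p k)) \<odot> snd p)"
        unfolding sk using S(3) by (intro finsum_diff[symmetric] S(1)) auto
      also have "\<dots> = D"
        unfolding D_def using S(3)
        by (intro finsum_cong') (auto simp: smult_smult diff_smult[symmetric] algebra_simps)
      finally show ?thesis by simp
    qed
    have sX: "(\<Oplus>g\<in>G. g k \<odot> y g) \<in> carrier X" using yX by (intro finsum_closed) auto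
    have DX: "D \<in> carrier X" unfolding D using x sX by simp
    have "vnorm X D \<le> (\<Sum>p\<in>S. vnorm X ((d p * (of_real \<theta> * hardy_coeff k (fst p) - of_real (?w (fst p)) * \<gamma> p k)) \<odot> snd p))"
      unfolding D_def using S(3) by (intro norm_finsum_le S(1)) auto
    also have "\<dots> \<le> (\<Sum>p\<in>S. \<delta> * (cmod (d p) * ?w (fst p) * vnorm X (snd p)))"
    proof (rule sum_mono)
      fix p assume p: "p \<in> S"
      have "cmod (d p) * cmod (of_real \<theta> * hardy_coeff k (fst p) - of_real (?w (fst p)) * \<gamma> p k) * vnorm X (snd p)
          \<le> cmod (d p) * (\<delta> * ?w (fst p)) * vnorm X (snd p)"
        using \<gamma>(2)[OF p k] S(3)[OF p] unfolding \<theta>_def by (intro mult_right_mono mult_left_mono) (auto simp: norm_nonneg)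
      then show "vnorm X ((d p * (of_real \<theta> * hardy_coeff k (fst p) - of_real (?w (fst p)) * \<gamma> p k)) \<odot> snd p)
          \<le> \<delta> * (cmod (d p) * ?w (fst p) * vnorm X (snd p))"
        using S(3)[OF p] by (simp add: norm_smult norm_mult mult_ac)
    qed
    also have "\<dots> = \<delta> * (\<Sum>p\<in>S. cmod (d p) * ?w (fst p) * vnorm X (snd p))"
      by (rule sum_distrib_left[symmetric])
    also have "\<dots> \<le> \<delta> * A" using dnorm \<delta> by (intro mult_left_mono) auto
    finally have D_norm: "vnorm X D \<le> \<delta> * A" .
    have "x k \<ominus> (\<Oplus>g\<in>G. g k \<odot> y g) = (x k \<ominus> of_real \<theta> \<odot> x k) \<oplus> D"
      unfolding D using x sX by (intro diff_add_diff[symmetric]) auto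
    also have "x k \<ominus> of_real \<theta> \<odot> x k = of_real (real k / real (N + 1)) \<odot> x k"
      using diff_smult[OF x, of 1 "of_real \<theta>" k] x by (simp add: \<theta>_def)
    finally have "vnorm X (x k \<ominus> (\<Oplus>g\<in>G. g k \<odot> y g))
        \<le> vnorm X (of_real (real k / real (N + 1)) \<odot> x k) + vnorm X D"
      using norm_triangle[OF _ DX, of "of_real (real k / real (N + 1)) \<odot> x k"] x by simp
    moreover have "vnorm X (of_real (real k / real (N + 1)) \<odot> x k) = real k / real (N + 1) * vnorm X (x k)"
      unfolding norm_smult[OF x] norm_of_real by simp
    ultimately show ?thesis using D_norm by simp
  qed
  show ?thesis using yX y_sum rem by blast
qed

end


section \<open>Ultraproducts of projective spaces\<close>

lemma (in linear_pair) hom_analytic_polynomial: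
  assumes "\<And>k. k \<le> n \<Longrightarrow> x k \<in> carrier V"
  shows "h (analytic_polynomial V n x z) = analytic_polynomial W n (\<lambda>k. h (x k)) z"
proof -
  have "h (analytic_polynomial V n x z) = (\<Oplus>\<^bsub>W\<^esub>k\<in>{..n}. h (z ^ k \<odot>\<^bsub>V\<^esub> x k))"
    unfolding analytic_polynomial_def using assms by (intro hom_finsum) auto
  also have "\<dots> = analytic_polynomial W n (\<lambda>k. h (x k)) z"
    unfolding analytic_polynomial_def using assms by (intro W.finsum_cong') (auto simp: hom_smult)
  finally show ?thesis .
qed

context complex_normed_space
begin

lemma analytic_polynomial_carrier [simp]:
  "(\<And>k. k \<le> n \<Longrightarrow> x k \<in> carrier X) \<Longrightarrow> analytic_polynomial X n x z \<in> carrier X"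
  unfolding analytic_polynomial_def by (intro finsum_closed) auto

lemma norm_analytic_polynomial_le:
  assumes "\<And>k. k \<le> n \<Longrightarrow> x k \<in> carrier X" "cmod z = 1"
  shows "vnorm X (analytic_polynomial X n x z) \<le> (\<Sum>k\<le>n. vnorm X (x k))"
proof -
  have "vnorm X (analytic_polynomial X n x z) \<le> (\<Sum>k\<le>n. vnorm X (z ^ k \<odot> x k))"
    unfolding analytic_polynomial_def using assms by (intro norm_finsum_le) auto
  also have "\<dots> = (\<Sum>k\<le>n. vnorm X (x k))"
    using assms by (intro sum.cong refl) (simp add: norm_smult norm_power)
  finally show ?thesis .
qed

lemma analytic_polynomial_lipschitz:
  assumes x: "\<And>k. k \<le> n \<Longrightarrow> x k \<in> carrier X" and zw: "cmod z = 1" "cmod w = 1"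
  shows "vnorm X (analytic_polynomial X n x z \<ominus> analytic_polynomial X n x w)
    \<le> real n * (\<Sum>k\<le>n. vnorm X (x k)) * cmod (z - w)"
proof -
  have "analytic_polynomial X n x z \<ominus> analytic_polynomial X n x w = (\<Oplus>k\<in>{..n}. z ^ k \<odot> x k \<ominus> w ^ k \<odot> x k)"
    unfolding analytic_polynomial_def using x by (intro finsum_diff[symmetric]) auto
  also have "vnorm X \<dots> \<le> (\<Sum>k\<le>n. vnorm X (z ^ k \<odot> x k \<ominus> w ^ k \<odot> x k))"
    using x by (intro norm_finsum_le) auto
  also have "\<dots> \<le> (\<Sum>k\<le>n. real n * vnorm X (x k) * cmod (z - w))"
  proof (rule sum_mono)
    fix k assume k: "k \<in> {..n}"
    have "cmod (z ^ k - w ^ k) \<le> real k * cmod (z - w)"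
      using zw by (intro norm_power_diff) auto
    also have "\<dots> \<le> real n * cmod (z - w)" using k by (intro mult_right_mono) auto
    finally have "cmod (z ^ k - w ^ k) * vnorm X (x k) \<le> real n * cmod (z - w) * vnorm X (x k)"
      using k x by (intro mult_right_mono) (auto simp: norm_nonneg)
    then show "vnorm X (z ^ k \<odot> x k \<ominus> w ^ k \<odot> x k) \<le> real n * vnorm X (x k) * cmod (z - w)"
      using k x by (simp add: diff_smult[symmetric] norm_smult mult_ac)
  qed
  also have "\<dots> = real n * (\<Sum>k\<le>n. vnorm X (x k)) * cmod (z - w)"
    by (simp add: sum_distrib_left sum_distrib_right)
  finally show ?thesis .
qed

lemma integrable_norm_analytic_polynomial:
  "(\<And>k. k \<le> n \<Longrightarrow> x k \<in> carrier X) \<Longrightarrow> integrable circle_measure (\<lambda>z. vnorm X (analytic_polynomial X n x z))"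
proof -
  assume "\<And>k. k \<le> n \<Longrightarrow> x k \<in> carrier X"
  from analytic_polynomial_L1[of n x, OF this] show ?thesis by (simp add: L1_functions_simps)
qed

lemma integral_norm_analytic_polynomial_le:
  assumes "\<And>k. k \<le> n \<Longrightarrow> x k \<in> carrier X"
  shows "(\<integral>z. vnorm X (analytic_polynomial X n x z) \<partial>circle_measure) \<le> (\<Sum>k\<le>n. vnorm X (x k))"
proof -
  interpret finite_measure circle_measure by (rule finite_measure_circle)
  have "(\<integral>z. vnorm X (analytic_polynomial X n x z) \<partial>circle_measure)
      \<le> (\<integral>z. (\<Sum>k\<le>n. vnorm X (x k)) \<partial>circle_measure)"
    using assms by (intro integral_mono integrable_norm_analytic_polynomial norm_analytic_polynomial_le) auto
  then show ?thesis by simp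
qed

end

context ultraproduct_family
begin

lemma cls_linear: "linear_pair (linf_space E) (ultraproduct U E) cls"
proof -
  interpret L: quotient_pair "linf_space E" "linf_null U E" by (rule quotient_pair)
  show ?thesis unfolding ultraproduct_eq by (rule L.linear_pair_q)
qed

lemma carrier_ultraproduct: "carrier (ultraproduct U E) = cls ` carrier (linf_space E)"
proof -
  interpret L: quotient_pair "linf_space E" "linf_null U E" by (rule quotient_pair)
  show ?thesis unfolding ultraproduct_eq by (rule L.carrier_Q)
qed

text \<open>
  At each point of a finite net of the circle, the norm of the representing polynomial is eventually
  almost bounded by that of the class. All polynomials involved are Lipschitz with constant \<open>R\<close>, so
  a net of mesh \<open>r\<close> with \<open>R r \<le> e / 4\<close> carries the bound over to the whole circle.
\<close>

lemma eventually_polynomial_norm_le: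
  assumes x: "\<And>k. k \<le> n \<Longrightarrow> x k \<in> carrier (linf_space E)" and e: "e > 0"
  shows "eventually (\<lambda>i. (\<integral>z. vnorm (E i) (analytic_polynomial (E i) n (\<lambda>k. x k i) z) \<partial>circle_measure)
    \<le> (\<integral>z. vnorm (ultraproduct U E) (analytic_polynomial (ultraproduct U E) n (\<lambda>k. cls (x k)) z) \<partial>circle_measure) + e) U"
proof -
  let ?W = "ultraproduct U E"
  interpret W: complex_banach_space ?W by (rule banach_ultraproduct)
  interpret c: linear_pair "linf_space E" ?W cls by (rule cls_linear)
  interpret m: finite_measure circle_measure by (rule finite_measure_circle)
  let ?P = "\<lambda>z. analytic_polynomial ?W n (\<lambda>k. cls (x k)) z"
  let ?p = "\<lambda>i z. analytic_polynomial (E i) n (\<lambda>k. x k i) z"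
  define R where "R = real n * (\<Sum>k\<le>n. vnorm (linf_space E) (x k))"
  have R0: "R \<ge> 0" unfolding R_def using x c.V.norm_nonneg by (intro mult_nonneg_nonneg sum_nonneg) auto
  \<comment> \<open>The denominator is \<open>R + 1\<close> because \<open>R\<close> may vanish.\<close>
  define r where "r = e / 4 / (R + 1)"
  have r0: "r > 0" using e R0 by (simp add: r_def)
  have Rr: "R * r \<le> e / 4"
  proof -
    have "R * r \<le> (R + 1) * r" using r0 by (intro mult_right_mono) auto
    also have "\<dots> = e / 4"
      using nonzero_eq_divide_eq[of "R + 1" r "e / 4"] r_def R0 by (simp add: mult.commute)
    finally show ?thesis .
  qed
  have "seq_compact (sphere (0::complex) 1)" by (simp add: compact_imp_seq_compact)
  from seq_compact_imp_totally_bounded[OF this, rule_format, OF r0]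
  obtain Z where Z: "finite Z" "Z \<subseteq> sphere (0::complex) 1" "sphere (0::complex) 1 \<subseteq> (\<Union>w\<in>Z. ball w r)"
    by blast
  have xi: "x k i \<in> carrier (E i)" if "k \<le> n" for k i using x[OF that] by (simp add: linf_simps(1))
  have cx: "cls (x k) \<in> carrier ?W" if "k \<le> n" for k using x[OF that] by simp
  have "eventually (\<lambda>i. vnorm (E i) (?p i w) < vnorm ?W (?P w) + e / 2) U" for w
  proof -
    let ?q = "analytic_polynomial (linf_space E) n x w"
    have q: "?q \<in> carrier (linf_space E)"
      unfolding analytic_polynomial_def using x by (intro c.V.finsum_closed) auto
    have "cls ?q = ?P w" by (rule c.hom_analytic_polynomial[OF x])
    then have "eventually (\<lambda>i. vnorm (E i) (?q i) < vnorm ?W (?P w) + e / 2) U"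
      using e by (intro eventually_norm_less[OF q]) simp
    moreover have "?q i = ?p i w" for i
    proof -
      interpret ev: linear_pair "linf_space E" "E i" "\<lambda>x. x i" by (rule linf_eval[OF semi])
      show ?thesis by (rule ev.hom_analytic_polynomial[OF x])
    qed
    ultimately show ?thesis by simp
  qed
  then have "eventually (\<lambda>i. \<forall>w\<in>Z. vnorm (E i) (?p i w) < vnorm ?W (?P w) + e / 2) U"
    using Z(1) by (intro eventually_ball_finite) auto
  then show ?thesis
  proof eventually_elim
    case (elim i)
    interpret Ei: complex_banach_space "E i" by (rule banach)
    have R1: "real n * (\<Sum>k\<le>n. vnorm (E i) (x k i)) \<le> R"
      unfolding R_def by (intro mult_left_mono sum_mono norm_le_norm_linf x) auto
    have R2: "real n * (\<Sum>k\<le>n. vnorm ?W (cls (x k))) \<le> R"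
      unfolding R_def
    proof (intro mult_left_mono sum_mono)
      fix k assume "k \<in> {..n}"
      then have xk: "x k \<in> carrier (linf_space E)" using x by simp
      show "vnorm ?W (cls (x k)) \<le> vnorm (linf_space E) (x k)"
        using norm_le_norm_linf[OF xk] c.V.norm_nonneg[OF xk] by (intro norm_cls_le[OF xk]) auto
    qed simp
    have le: "vnorm (E i) (?p i z) \<le> vnorm ?W (?P z) + e" if z: "cmod z = 1" for z
    proof -
      obtain w where w: "w \<in> Z" "cmod (z - w) < r"
        using Z(3) z by (auto simp: dist_norm norm_minus_commute)
      have w1: "cmod w = 1" using w(1) Z(2) by auto
      have lip: "t * cmod (z - w) \<le> e / 4" if "t \<le> R" for t
      proof -
        have "t * cmod (z - w) \<le> R * cmod (z - w)" using that by (rule mult_right_mono) simp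
        also have "\<dots> \<le> R * r" using w(2) R0 by (intro mult_left_mono) auto
        finally show ?thesis using Rr by simp
      qed
      have "vnorm (E i) (?p i z) \<le> vnorm (E i) (?p i w) + e / 4"
        using Ei.norm_le_add_diff[of "?p i z" "?p i w"] Ei.analytic_polynomial_lipschitz[of n "\<lambda>k. x k i", OF xi z w1] lip[OF R1]
          xi by simp
      moreover have "vnorm ?W (?P w) \<le> vnorm ?W (?P z) + e / 4"
        using W.norm_le_add_diff[of "?P w" "?P z"] W.norm_diff_commute[of "?P w" "?P z"]
          W.analytic_polynomial_lipschitz[of n "\<lambda>k. cls (x k)", OF cx z w1] lip[OF R2] cx by simp
      ultimately show ?thesis using elim w(1) by fastforce
    qed
    have "(\<integral>z. vnorm (E i) (?p i z) \<partial>circle_measure) \<le> (\<integral>z. vnorm ?W (?P z) + e \<partial>circle_measure)"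
      using xi cx le
      by (intro integral_mono Bochner_Integration.integrable_add Ei.integrable_norm_analytic_polynomial
          W.integrable_norm_analytic_polynomial) auto
    also have "\<dots> = (\<integral>z. vnorm ?W (?P z) \<partial>circle_measure) + e"
      using W.integrable_norm_analytic_polynomial[OF cx] by simp
    finally show ?case .
  qed
qed

lemma eventually_norm_greater:
  assumes U: "ultrafilter U" and x: "x \<in> carrier (linf_space E)" and less: "a < vnorm (ultraproduct U E) (cls x)"
  shows "eventually (\<lambda>i. a < vnorm (E i) (x i)) U"
proof (rule ccontr)
  assume "\<not> ?thesis"
  then have ev: "eventually (\<lambda>i. vnorm (E i) (x i) \<le> a) U"
    using U by (auto simp: ultrafilter_def not_less dest!: spec[of _ "\<lambda>i. a < vnorm (E i) (x i)"])
  moreover have "0 \<le> a"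
  proof -
    obtain i where "vnorm (E i) (x i) \<le> a"
      using eventually_happens[OF ev] U by (auto simp: ultrafilter_def)
    then show ?thesis using norm_nonneg_i[OF x, of i] by simp
  qed
  ultimately show False using norm_cls_le[OF x] less by fastforce
qed

lemma sum_norm_cls_le:
  assumes U: "ultrafilter U" and G: "finite G" and y: "\<And>g. g \<in> G \<Longrightarrow> y g \<in> carrier (linf_space E)"
    and le: "eventually (\<lambda>i. (\<Sum>g\<in>G. vnorm (E i) (y g i)) \<le> a) U"
  shows "(\<Sum>g\<in>G. vnorm (ultraproduct U E) (cls (y g))) \<le> a"
proof (rule field_le_epsilon)
  fix e :: real assume e: "e > 0"
  define \<eta> where "\<eta> = e / (real (card G) + 1)"
  have \<eta>: "\<eta> > 0" "real (card G) * \<eta> \<le> e"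
    using e by (auto simp: \<eta>_def field_simps)
  have "eventually (\<lambda>i. \<forall>g\<in>G. vnorm (ultraproduct U E) (cls (y g)) - \<eta> < vnorm (E i) (y g i)) U"
    using \<eta>(1) by (intro eventually_ball_finite G ballI eventually_norm_greater U y) auto
  then have "eventually (\<lambda>i. (\<Sum>g\<in>G. vnorm (ultraproduct U E) (cls (y g))) \<le> a + e) U"
    using le
  proof eventually_elim
    case (elim i)
    have "(\<Sum>g\<in>G. vnorm (ultraproduct U E) (cls (y g)) - \<eta>) \<le> (\<Sum>g\<in>G. vnorm (E i) (y g i))"
      using elim(1) by (intro sum_mono) auto
    then show ?case using elim(2) \<eta>(2) by (simp add: sum_subtractf)
  qed
  then show "(\<Sum>g\<in>G. vnorm (ultraproduct U E) (cls (y g))) \<le> a + e"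
    using U by (auto simp: ultrafilter_def)
qed

text \<open>
  With \<open>\<epsilon> = e / (c + 3)\<close>, the vectors \<open>y\<^sub>g\<close> contribute at most \<open>c (\<parallel>P\<parallel> + \<epsilon>) + \<epsilon>\<close> to the norm of the tensor,
  and the error of the Fejer means and that of the net contribute at most \<open>\<epsilon>\<close> each.
\<close>

lemma H1_projective_ultraproduct:
  assumes U: "ultrafilter U" and const: "\<And>i. H1_constant (E i) < ennreal c" and c: "c \<ge> 0"
  shows "H1_projective (ultraproduct U E)"
proof -
  let ?W = "ultraproduct U E"
  interpret W: complex_banach_space ?W by (rule banach_ultraproduct)
  interpret q: linear_pair "linf_space E" ?W cls by (rule cls_linear)
  show ?thesis
  proof (rule W.H1_projectiveI[OF c])
    fix n :: nat and x and e :: real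
    assume x: "\<And>k. k \<le> n \<Longrightarrow> x k \<in> carrier ?W" and e: "e > 0"
    have "\<exists>v\<in>carrier (linf_space E). k \<le> n \<longrightarrow> x k = cls v" for k
      using x[of k] q.V.zero_closed by (cases "k \<le> n") (auto simp: carrier_ultraproduct)
    then obtain v0 where v0: "\<And>k. v0 k \<in> carrier (linf_space E)" "\<And>k. k \<le> n \<Longrightarrow> x k = cls (v0 k)"
      by metis
    define v where "v k = (if k \<le> n then v0 k else \<zero>\<^bsub>linf_space E\<^esub>)" for k
    have v: "v k \<in> carrier (linf_space E)" for k using v0 by (simp add: v_def)
    have xv: "x k = cls (v k)" if "k \<le> n" for k using v0(2) that by (simp add: v_def)
    define P where "P = (\<integral>z. vnorm ?W (analytic_polynomial ?W n x z) \<partial>circle_measure)"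
    define R where "R = (\<Sum>k\<le>n. vnorm (linf_space E) (v k))"
    define \<epsilon> where "\<epsilon> = e / (c + 3)"
    define A where "A = c * R + \<epsilon>"
    have R0: "R \<ge> 0" unfolding R_def using v q.V.norm_nonneg by (intro sum_nonneg) auto
    have \<epsilon>: "\<epsilon> > 0" "(c + 3) * \<epsilon> = e" using e c by (auto simp: \<epsilon>_def)
    have A0: "A > 0" unfolding A_def using c R0 \<epsilon> by (simp add: add_nonneg_pos)
    \<comment> \<open>The index \<open>N\<close> bounds the error of the Fejer means; then \<open>\<delta>\<close> bounds that of the net.\<close>
    obtain M :: nat where M: "real n * R / \<epsilon> < real M" using reals_Archimedean2 by blast
    define N where "N = max n M"
    have nN: "n \<le> N" by (simp add: N_def)
    have N1: "real n * R / real (N + 1) \<le> \<epsilon>"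
    proof -
      have "real n * R < real M * \<epsilon>" using M \<epsilon>(1) by (simp add: pos_divide_less_eq)
      also have "\<dots> \<le> real (N + 1) * \<epsilon>" using \<epsilon>(1) by (intro mult_right_mono) (auto simp: N_def)
      finally show ?thesis by (simp add: pos_divide_le_eq mult.commute)
    qed
    define \<delta> where "\<delta> = \<epsilon> / (real (N + 1) * A)"
    have \<delta>: "\<delta> > 0" "real (N + 1) * (\<delta> * A) = \<epsilon>" using \<epsilon> A0 by (auto simp: \<delta>_def)
    obtain G where G: "finite G"
      "\<And>g. g \<in> G \<Longrightarrow> (\<integral>z. cmod (\<Sum>k\<le>N. g k * z ^ k) \<partial>circle_measure) \<le> 1"
      "\<And>q. (\<integral>z. cmod (\<Sum>k\<le>N. q k * z ^ k) \<partial>circle_measure) \<le> 1 \<Longrightarrow> \<exists>g\<in>G. \<forall>k\<le>N. cmod (q k - g k) \<le> \<delta>"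
    proof (rule finite_polynomial_net[OF \<delta>(1), where N = N], goal_cases)
      case (1 G)
      show ?case by (rule 1(1)[OF 1(2-4)])
    qed
    let ?p = "\<lambda>i. \<integral>z. vnorm (E i) (analytic_polynomial (E i) n (\<lambda>k. v k i) z) \<partial>circle_measure"
    have p_le: "?p i \<le> R" for i
    proof -
      interpret Ei: complex_banach_space "E i" by (rule banach)
      have "?p i \<le> (\<Sum>k\<le>n. vnorm (E i) (v k i))"
        using v by (intro Ei.integral_norm_analytic_polynomial_le) (simp add: linf_simps(1))
      also have "\<dots> \<le> R" unfolding R_def using v by (intro sum_mono norm_le_norm_linf)
      finally show ?thesis .
    qed
    define Q where "Q i y \<longleftrightarrow> (\<forall>g\<in>G. y g \<in> carrier (E i)) \<and> (\<Sum>g\<in>G. vnorm (E i) (y g)) \<le> c * ?p i + \<epsilon> \<and>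
        (\<forall>k\<le>N. vnorm (E i) (v k i \<ominus>\<^bsub>E i\<^esub> (\<Oplus>\<^bsub>E i\<^esub>g\<in>G. g k \<odot>\<^bsub>E i\<^esub> y g))
          \<le> real k / real (N + 1) * vnorm (E i) (v k i) + \<delta> * (c * ?p i + \<epsilon>))" for i y
    have "\<exists>y. Q i y" for i
    proof -
      interpret Ei: complex_banach_space "E i" by (rule banach)
      show ?thesis
        unfolding Q_def
      proof (rule Ei.approximate_factorization[OF const _ _ \<epsilon>(1) G(1) G(3)])
        show "v k i \<in> carrier (E i)" for k using v[of k] by (simp add: linf_simps(1))
        show "v k i = \<zero>\<^bsub>E i\<^esub>" if "n < k" for k using that by (simp add: v_def linf_simps(2))
      qed (use \<delta> in auto)
    qed
    then obtain y where yQ: "\<And>i. Q i (y i)" by metis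
    have y: "\<And>i g. g \<in> G \<Longrightarrow> y i g \<in> carrier (E i)"
      "\<And>i. (\<Sum>g\<in>G. vnorm (E i) (y i g)) \<le> c * ?p i + \<epsilon>"
      "\<And>i k. k \<le> N \<Longrightarrow> vnorm (E i) (v k i \<ominus>\<^bsub>E i\<^esub> (\<Oplus>\<^bsub>E i\<^esub>g\<in>G. g k \<odot>\<^bsub>E i\<^esub> y i g))
          \<le> real k / real (N + 1) * vnorm (E i) (v k i) + \<delta> * (c * ?p i + \<epsilon>)"
      using yQ unfolding Q_def by blast+
    have pA: "c * ?p i + \<epsilon> \<le> A" for i unfolding A_def using p_le c by (simp add: mult_left_mono)
    define Y where "Y g i = y i g" for g i
    have Y: "Y g \<in> carrier (linf_space E)" if g: "g \<in> G" for g
    proof (rule linf_carrierI)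
      show "Y g i \<in> carrier (E i)" for i using y(1)[OF g] by (simp add: Y_def)
      fix i
      interpret Ei: complex_banach_space "E i" by (rule banach)
      have "vnorm (E i) (y i g) \<le> (\<Sum>g\<in>G. vnorm (E i) (y i g))"
        using g G(1) y(1) by (intro member_le_sum) (auto simp: Ei.norm_nonneg)
      also have "\<dots> \<le> A" using y(2) pA by (rule order_trans)
      finally show "vnorm (E i) (Y g i) \<le> A" by (simp add: Y_def)
    qed
    have Ysum: "(\<Sum>g\<in>G. vnorm ?W (cls (Y g))) \<le> c * (P + \<epsilon>) + \<epsilon>"
    proof (rule sum_norm_cls_le[OF U G(1) Y])
      have "analytic_polynomial ?W n (\<lambda>k. cls (v k)) = analytic_polynomial ?W n x"
        unfolding analytic_polynomial_def using x xv by (intro ext W.finsum_cong') auto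
      then have "eventually (\<lambda>i. ?p i \<le> P + \<epsilon>) U"
        using eventually_polynomial_norm_le[of n v \<epsilon>] v \<epsilon>(1) by (simp add: P_def)
      then show "eventually (\<lambda>i. (\<Sum>g\<in>G. vnorm (E i) (Y g i)) \<le> c * (P + \<epsilon>) + \<epsilon>) U"
      proof eventually_elim
        case (elim i)
        then have "c * ?p i \<le> c * (P + \<epsilon>)" using c by (rule mult_left_mono)
        then show ?case using y(2)[of i] by (simp add: Y_def)
      qed
    qed
    define r where "r k = v k \<ominus>\<^bsub>linf_space E\<^esub> (\<Oplus>\<^bsub>linf_space E\<^esub>g\<in>G. g k \<odot>\<^bsub>linf_space E\<^esub> Y g)" for k
    have sL: "(\<Oplus>\<^bsub>linf_space E\<^esub>g\<in>G. g k \<odot>\<^bsub>linf_space E\<^esub> Y g) \<in> carrier (linf_space E)" for k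
      using Y by (intro q.V.finsum_closed) auto
    have rL: "r k \<in> carrier (linf_space E)" for k unfolding r_def using v sL by simp
    have r_norm: "vnorm ?W (cls (r k)) \<le> (if k \<le> n then real n * vnorm (linf_space E) (v k) / real (N + 1) else 0) + \<delta> * A"
      if k: "k \<le> N" for k
    proof (rule norm_cls_le[OF rL always_eventually], rule allI)
      fix i
      interpret Ei: complex_banach_space "E i" by (rule banach)
      interpret ev: linear_pair "linf_space E" "E i" "\<lambda>x. x i" by (rule linf_eval[OF semi])
      have "(\<Oplus>\<^bsub>linf_space E\<^esub>g\<in>G. g k \<odot>\<^bsub>linf_space E\<^esub> Y g) i = (\<Oplus>\<^bsub>E i\<^esub>g\<in>G. (g k \<odot>\<^bsub>linf_space E\<^esub> Y g) i)"
        using Y by (intro ev.hom_finsum[OF G(1)]) auto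
      also have "\<dots> = (\<Oplus>\<^bsub>E i\<^esub>g\<in>G. g k \<odot>\<^bsub>E i\<^esub> y i g)"
        by (simp add: linf_simps(4) Y_def)
      finally have "r k i = v k i \<ominus>\<^bsub>E i\<^esub> (\<Oplus>\<^bsub>E i\<^esub>g\<in>G. g k \<odot>\<^bsub>E i\<^esub> y i g)"
        unfolding r_def using ev.hom_diff[OF v sL] by simp
      then have "vnorm (E i) (r k i) \<le> real k / real (N + 1) * vnorm (E i) (v k i) + \<delta> * (c * ?p i + \<epsilon>)"
        using y(3)[OF k] by simp
      also have "\<delta> * (c * ?p i + \<epsilon>) \<le> \<delta> * A" using \<delta>(1) pA by (intro mult_left_mono) auto
      also have "real k / real (N + 1) * vnorm (E i) (v k i)
          \<le> (if k \<le> n then real n * vnorm (linf_space E) (v k) / real (N + 1) else 0)"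
      proof (cases "k \<le> n")
        case True
        have "real k * vnorm (E i) (v k i) \<le> real n * vnorm (linf_space E) (v k)"
          using True norm_le_norm_linf[OF v] norm_nonneg_i[OF v] by (intro mult_mono) auto
        then show ?thesis using True by (simp add: divide_right_mono)
      next
        case False
        then show ?thesis by (simp add: v_def linf_simps(2))
      qed
      finally show "vnorm (E i) (r k i)
          \<le> (if k \<le> n then real n * vnorm (linf_space E) (v k) / real (N + 1) else 0) + \<delta> * A" by simp
    next
      show "0 \<le> (if k \<le> n then real n * vnorm (linf_space E) (v k) / real (N + 1) else 0) + \<delta> * A"
        using \<delta>(1) A0 q.V.norm_nonneg[OF v, of k] by simp
    qed
    have "(\<Sum>k\<le>N. vnorm ?W (cls (r k)))
        \<le> (\<Sum>k\<le>N. (if k \<le> n then real n * vnorm (linf_space E) (v k) / real (N + 1) else 0) + \<delta> * A)"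
      by (intro sum_mono r_norm) simp
    also have "\<dots> = (\<Sum>k\<le>N. if k \<le> n then real n * vnorm (linf_space E) (v k) / real (N + 1) else 0)
        + real (N + 1) * (\<delta> * A)"
      by (simp add: sum.distrib)
    also have "(\<Sum>k\<le>N. if k \<le> n then real n * vnorm (linf_space E) (v k) / real (N + 1) else 0)
        = (\<Sum>k\<le>n. real n * vnorm (linf_space E) (v k) / real (N + 1))"
      using nN by (intro sum.mono_neutral_cong_right) auto
    also have "\<dots> = real n * R / real (N + 1)"
      by (simp add: R_def sum_distrib_left sum_divide_distrib)
    finally have r_sum: "(\<Sum>k\<le>N. vnorm ?W (cls (r k))) \<le> 2 * \<epsilon>"
      using N1 \<delta>(2) by simp
    define x' where "x' k = (if k \<le> n then x k else \<zero>\<^bsub>?W\<^esub>)" for k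
    have x'v: "x' k = cls (v k)" for k
      using xv q.hom_zero by (simp add: x'_def v_def)
    have pad: "analytic_polynomial ?W n x = analytic_polynomial ?W N x'"
      unfolding x'_def[abs_def] by (rule W.analytic_polynomial_pad[OF x nN])
    have r_eq: "cls (r k) = x' k \<ominus>\<^bsub>?W\<^esub> (\<Oplus>\<^bsub>?W\<^esub>g\<in>G. g k \<odot>\<^bsub>?W\<^esub> cls (Y g))" for k
    proof -
      have "cls (\<Oplus>\<^bsub>linf_space E\<^esub>g\<in>G. g k \<odot>\<^bsub>linf_space E\<^esub> Y g) = (\<Oplus>\<^bsub>?W\<^esub>g\<in>G. cls (g k \<odot>\<^bsub>linf_space E\<^esub> Y g))"
        using Y by (intro q.hom_finsum[OF G(1)]) auto
      also have "\<dots> = (\<Oplus>\<^bsub>?W\<^esub>g\<in>G. g k \<odot>\<^bsub>?W\<^esub> cls (Y g))"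
        using Y by (intro W.finsum_cong') (auto simp: q.hom_smult)
      finally show ?thesis
        unfolding r_def x'v using q.hom_diff[OF v sL] by simp
    qed
    obtain t where t: "t \<in> carrier (H1_tensor ?W)"
      "tensor_inclusion ?W t = L1cl ?W (analytic_polynomial ?W N x')"
      "vnorm (H1_tensor ?W) t \<le> (\<Sum>g\<in>G. vnorm ?W (cls (Y g)))
        + (\<Sum>k\<le>N. vnorm ?W (x' k \<ominus>\<^bsub>?W\<^esub> (\<Oplus>\<^bsub>?W\<^esub>g\<in>G. g k \<odot>\<^bsub>?W\<^esub> cls (Y g))))"
      using W.tensor_of_factorization[OF G(1,2), of "\<lambda>g. cls (Y g)" x'] Y v by (auto simp: x'v)
    have "vnorm (H1_tensor ?W) t \<le> (c * (P + \<epsilon>) + \<epsilon>) + 2 * \<epsilon>"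
      using t(3) Ysum r_sum by (simp only: r_eq)
    also have "\<dots> = c * P + e" using \<epsilon>(2) by (simp add: algebra_simps)
    finally show "\<exists>t\<in>carrier (H1_tensor ?W).
        tensor_inclusion ?W t = L1cl ?W (analytic_polynomial ?W n x) \<and>
        vnorm (H1_tensor ?W) t
          \<le> c * (\<integral>z. vnorm ?W (analytic_polynomial ?W n x z) \<partial>circle_measure) + e"
      using t(1,2) by (intro bexI[of _ t]) (simp_all add: P_def pad)
  qed
qed

end

theorem theorem5p4:
  fixes X :: "'i \<Rightarrow> 'a nspace" and U :: "'i filter"
  assumes "\<And>i. H1_projective (X i)"
    and "(SUP i. H1_constant (X i)) < \<infinity>"
    and "ultrafilter U"
  shows "H1_projective (ultraproduct U X)"
proof -
  interpret ultraproduct_family X U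
  proof (rule ultraproduct_family.intro)
    show "complex_banach_space (X i)" for i
      using assms(1)[of i] unfolding H1_projective_def by (rule conjunct1)
  qed
  let ?S = "SUP i. H1_constant (X i)"
  \<comment> \<open>Adding \<open>1\<close> makes the bound on the constants strict.\<close>
  define c where "c = enn2real ?S + 1"
  have c: "c \<ge> 0" by (simp add: c_def)
  have "?S < ennreal c"
  proof -
    have "?S = ennreal (enn2real ?S)" using assms(2) by simp
    also have "\<dots> < ennreal c" unfolding c_def by (rule ennreal_lessI) (simp_all add: add_nonneg_pos)
    finally show ?thesis .
  qed
  then have "H1_constant (X i) < ennreal c" for i
    using SUP_upper[of i UNIV "\<lambda>i. H1_constant (X i)"] by (rule le_less_trans[rotated]) simp
  then show ?thesis by (rule H1_projective_ultraproduct[OF assms(3) _ c])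
qed

end
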